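(* Let $(\alpha,\beta,t)$ be an admissible triple with $\alpha>0$ (see context), let $P=P_UP_L$ be the stochastic UL factorization of the associated stochastic tridiagonal matrix $P$ with the coefficients $x_n,y_n,s_n,t_n$ given in the context, let $\widetilde P=P_LP_U$, and let $\boldsymbol\Psi$ be the spectral matrix of $P$. Then: (i) $\widetilde P$ is a stochastic tridiagonal matrix whose coefficients $\tilde p_n=\widetilde P_{n,n+1}$, $\tilde r_n=\widetilde P_{n,n}$, $\tilde q_n=\widetilde P_{n,n-1}$ ($n\in\mathbb{Z}$) are the coefficients $p_n,r_n,q_n$ with $\alpha$ replaced by $\alpha-1$. (ii) The spectral matrix $\widetilde{\boldsymbol\Psi}$ of $\widetilde P$ is absolutely continuous on $[0,1]$ (no discrete part), it is the spectral matrix $\boldsymbol\Psi$ with $\alpha$ replaced by $\alpha-1$, and it is also given by $$\widetilde{\boldsymbol\Psi}(x)=\frac{y_0}{s_0}\,\boldsymbol S_0(x)\,\frac{\boldsymbol\Psi(x)}{x}\,\boldsymbol S_0^*(x),\qquad \boldsymbol S_0(x)=\begin{pmatrix} s_0& t_0 \\ -\dfrac{x_{-1}s_0}{y_{-1}}& \dfrac{x-x_{-1}t_0}{y_{-1}}\end{pmatrix}.$$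
   Context: Admissible triples with $\alpha>0$: $0<\alpha<1$, $-1<\beta<0$, $t\in\mathbb{R}$, and one of the following holds: (A1) $\beta-\alpha+1>0$, $\alpha>-\beta$, and $t\in\bigcup_{n\in\mathbb{Z}}(n,n-\beta)\cup(n-\alpha,n-\alpha-\beta)$; (A2) $\beta-\alpha+1>0$, $\alpha<-\beta$, and $t\in\bigcup_{n\in\mathbb{Z}}(n-\alpha,n)\cup(n-\alpha-\beta,n-\beta)$; (B1) $\beta-\alpha+1<0$, $\alpha>-\beta$, and $t\in\bigcup_{n\in\mathbb{Z}}(n,n-\alpha+1)\cup(n-\beta,n-\alpha-\beta+1)$; (B2) $\beta-\alpha+1<0$, $\alpha<-\beta$, and $t\in\bigcup_{n\in\mathbb{Z}}(n-\beta-1,n)\cup(n-\alpha-\beta,n-\alpha+1)$. Coefficients: for $n\in\mathbb{Z}$, $$p_n=\frac{(n+t+\beta+1)(n+t+\alpha+\beta+1)}{(2n+2t+\alpha+\beta+1)(2n+2t+\alpha+\beta+2)},\qquad q_n=\frac{(n+t)(n+t+\alpha)}{(2n+2t+\alpha+\beta)(2n+2t+\alpha+\beta+1)},$$ $$r_n=\frac{(n+t+\beta+1)(n+t+1)}{(2n+2t+\alpha+\beta+1)(2n+2t+\alpha+\beta+2)}+\frac{(n+t+\alpha)(n+t+\alpha+\beta)}{(2n+2t+\alpha+\beta)(2n+2t+\alpha+\beta+1)}.$$ $P$ is the doubly infinite tridiagonal matrix (indexed by $\mathbb{Z}$) with $P_{n,n+1}=p_n$, $P_{n,n}=r_n$,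 $P_{n,n-1}=q_n$, other entries $0$. It is stochastic with $p_n,r_n,q_n>0$ for admissible triples. Factorization: with $$y_n=\frac{n+t+\alpha}{2n+2t+\alpha+\beta+1},\quad x_n=\frac{n+t+\beta+1}{2n+2t+\alpha+\beta+1},\quad s_n=\frac{n+t+\alpha+\beta}{2n+2t+\alpha+\beta},\quad t_n=\frac{n+t}{2n+2t+\alpha+\beta},$$ let $P_U$ be the doubly infinite upper bidiagonal matrix with $(P_U)_{n,n}=y_n$, $(P_U)_{n,n+1}=x_n$, and $P_L$ the doubly infinite lower bidiagonal matrix with $(P_L)_{n,n}=s_n$, $(P_L)_{n,n-1}=t_n$. Then $P=P_UP_L$ and both factors are stochastic. (The sequence $(t_n)$ is not to be confused with the parameter $t$.) Spectral matrix: for a doubly infinite stochastic tridiagonal matrix with coefficients $p_n,q_n>0$, $r_n$, let $Q^\eta_n$, $\eta=1,2$, $n\in\mathbb{Z}$, be the polynomials with $Q^1_0=1,Q^1_{-1}=0$, $Q^2_0=0,Q^2_{-1}=1$ and $xQ^\eta_n=p_nQ^\eta_{n+1}+r_nQ^\eta_n+q_nQ^\eta_{n-1}$ for all $n\in\mathbb{Z}$. Let $\pi_0=1$, $\pi_n=\frac{p_0\cdots p_{n-1}}{q_1\cdots q_n}$, $\pi_{-n}=\frac{q_0q_{-1}\cdots q_{-n+1}}{p_{-1}\cdots p_{-n}}$ for $n\ge1$. The spectral matrix is the $2\times2$ matrix of measures $\boldsymbol\Psi$, positive semidefinite and supported on $[-1,1]$, such that $$\int (Q^1_i(x),Q^2_i(x))\,d\boldsymbol\Psi(x)\,(Q^1_j(x),Q^2_j(x))^T=\frac{\delta_{ij}}{\pi_j},\qquad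 i,j\in\mathbb{Z}.$$ When it is absolutely continuous its density is denoted $\boldsymbol\Psi(x)$. It is a known result (Grünbaum–Haine) that, for $-1<\alpha,\beta<1$ and $t$ real such that $p_{n-1}q_n>0$ for all $n\in\mathbb{Z}$, the spectral matrix of the matrix with the coefficients $p_n,r_n,q_n$ displayed above is absolutely continuous and supported on $[0,1]$. $M^*$ denotes the Hermitian transpose of $M$. *)

theory Defs
  imports "HOL-Analysis.Analysis" "HOL-Computational_Algebra.Polynomial"
begin

section \<open>Doubly infinite matrices\<close>

type_synonym dimat = "int \<Rightarrow> int \<Rightarrow> real"

text \<open>For the banded matrices used here every sum below has finitely many nonzero terms.\<close>

definition mat_prod :: "dimat \<Rightarrow> dimat \<Rightarrow> dimat" where
  "mat_prod A B = (\<lambda>i j. \<Sum>\<^sub>\<infinity>k. A i k * B k j)"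

definition stochastic :: "dimat \<Rightarrow> bool" where
  "stochastic A \<longleftrightarrow> (\<forall>i j. 0 \<le> A i j) \<and> (\<forall>i. (A i has_sum 1) UNIV)"

text \<open>Tridiagonal with positive off-diagonal coefficients, as required for the spectral matrix.\<close>

definition tridiagonal :: "dimat \<Rightarrow> bool" where
  "tridiagonal A \<longleftrightarrow> (\<forall>i j. 1 < \<bar>i - j\<bar> \<longrightarrow> A i j = 0) \<and>
     (\<forall>n. 0 < A n (n + 1) \<and> 0 < A n (n - 1))"


section \<open>The coefficients\<close>

definition admissible :: "real \<Rightarrow> real \<Rightarrow> real \<Rightarrow> bool" where
  "admissible \<alpha> \<beta> t \<longleftrightarrow> 0 < \<alpha> \<and> \<alpha> < 1 \<and> -1 < \<beta> \<and> \<beta> < 0 \<and>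
    ((\<beta> - \<alpha> + 1 > 0 \<and> \<alpha> > - \<beta> \<and>
        t \<in> (\<Union>n::int. {of_int n <..< of_int n - \<beta>} \<union> {of_int n - \<alpha> <..< of_int n - \<alpha> - \<beta>})) \<or>
     (\<beta> - \<alpha> + 1 > 0 \<and> \<alpha> < - \<beta> \<and>
        t \<in> (\<Union>n::int. {of_int n - \<alpha> <..< of_int n} \<union> {of_int n - \<alpha> - \<beta> <..< of_int n - \<beta>})) \<or>
     (\<beta> - \<alpha> + 1 < 0 \<and> \<alpha> > - \<beta> \<and>
        t \<in> (\<Union>n::int. {of_int n <..< of_int n - \<alpha> + 1} \<union> {of_int n - \<beta> <..< of_int n - \<alpha> - \<beta> + 1})) \<or>
     (\<beta> - \<alpha> + 1 < 0 \<and> \<alpha> < - \<beta> \<and>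
        t \<in> (\<Union>n::int. {of_int n - \<beta> - 1 <..< of_int n} \<union> {of_int n - \<alpha> - \<beta> <..< of_int n - \<alpha> + 1})))"

definition coef_p :: "real \<Rightarrow> real \<Rightarrow> real \<Rightarrow> int \<Rightarrow> real" where
  "coef_p \<alpha> \<beta> t n = ((of_int n + t + \<beta> + 1) * (of_int n + t + \<alpha> + \<beta> + 1)) /
     ((2 * of_int n + 2 * t + \<alpha> + \<beta> + 1) * (2 * of_int n + 2 * t + \<alpha> + \<beta> + 2))"

definition coef_q :: "real \<Rightarrow> real \<Rightarrow> real \<Rightarrow> int \<Rightarrow> real" where
  "coef_q \<alpha> \<beta> t n = ((of_int n + t) * (of_int n + t + \<alpha>)) /
     ((2 * of_int n + 2 * t + \<alpha> + \<beta>) * (2 * of_int n + 2 * t + \<alpha> + \<beta> + 1))"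

definition coef_r :: "real \<Rightarrow> real \<Rightarrow> real \<Rightarrow> int \<Rightarrow> real" where
  "coef_r \<alpha> \<beta> t n =
     ((of_int n + t + \<beta> + 1) * (of_int n + t + 1)) /
       ((2 * of_int n + 2 * t + \<alpha> + \<beta> + 1) * (2 * of_int n + 2 * t + \<alpha> + \<beta> + 2)) +
     ((of_int n + t + \<alpha>) * (of_int n + t + \<alpha> + \<beta>)) /
       ((2 * of_int n + 2 * t + \<alpha> + \<beta>) * (2 * of_int n + 2 * t + \<alpha> + \<beta> + 1))"

definition mat_P :: "real \<Rightarrow> real \<Rightarrow> real \<Rightarrow> dimat" where
  "mat_P \<alpha> \<beta> t = (\<lambda>i j. if j = i + 1 then coef_p \<alpha> \<beta> t i
     else if j = i then coef_r \<alpha> \<beta> t i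
     else if j = i - 1 then coef_q \<alpha> \<beta> t i else 0)"

definition coef_y :: "real \<Rightarrow> real \<Rightarrow> real \<Rightarrow> int \<Rightarrow> real" where
  "coef_y \<alpha> \<beta> t n = (of_int n + t + \<alpha>) / (2 * of_int n + 2 * t + \<alpha> + \<beta> + 1)"

definition coef_x :: "real \<Rightarrow> real \<Rightarrow> real \<Rightarrow> int \<Rightarrow> real" where
  "coef_x \<alpha> \<beta> t n = (of_int n + t + \<beta> + 1) / (2 * of_int n + 2 * t + \<alpha> + \<beta> + 1)"

definition coef_s :: "real \<Rightarrow> real \<Rightarrow> real \<Rightarrow> int \<Rightarrow> real" where
  "coef_s \<alpha> \<beta> t n = (of_int n + t + \<alpha> + \<beta>) / (2 * of_int n + 2 * t + \<alpha> + \<beta>)"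

definition coef_t :: "real \<Rightarrow> real \<Rightarrow> real \<Rightarrow> int \<Rightarrow> real" where
  "coef_t \<alpha> \<beta> t n = (of_int n + t) / (2 * of_int n + 2 * t + \<alpha> + \<beta>)"

definition mat_PU :: "real \<Rightarrow> real \<Rightarrow> real \<Rightarrow> dimat" where
  "mat_PU \<alpha> \<beta> t = (\<lambda>i j. if j = i then coef_y \<alpha> \<beta> t i
     else if j = i + 1 then coef_x \<alpha> \<beta> t i else 0)"

definition mat_PL :: "real \<Rightarrow> real \<Rightarrow> real \<Rightarrow> dimat" where
  "mat_PL \<alpha> \<beta> t = (\<lambda>i j. if j = i then coef_s \<alpha> \<beta> t i
     else if j = i - 1 then coef_t \<alpha> \<beta> t i else 0)"

definition mat_Ptilde :: "real \<Rightarrow> real \<Rightarrow> real \<Rightarrow> dimat" where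
  "mat_Ptilde \<alpha> \<beta> t = mat_prod (mat_PL \<alpha> \<beta> t) (mat_PU \<alpha> \<beta> t)"

definition S0 :: "real \<Rightarrow> real \<Rightarrow> real \<Rightarrow> real \<Rightarrow> real^2^2" where
  "S0 \<alpha> \<beta> t x = vector
     [vector [coef_s \<alpha> \<beta> t 0, coef_t \<alpha> \<beta> t 0],
      vector [- (coef_x \<alpha> \<beta> t (-1) * coef_s \<alpha> \<beta> t 0) / coef_y \<alpha> \<beta> t (-1),
              (x - coef_x \<alpha> \<beta> t (-1) * coef_t \<alpha> \<beta> t 0) / coef_y \<alpha> \<beta> t (-1)]]"


section \<open>Matrices of measures\<close>

definition pos_semidef :: "real^2^2 \<Rightarrow> bool" where
  "pos_semidef X \<longleftrightarrow> transpose X = X \<and> (\<forall>v. 0 \<le> v \<bullet> (X *v v))"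

text \<open>
  A positive semidefinite \<open>2 \<times> 2\<close> matrix of (finite, signed) measures on the real line, as a
  countably additive set function on the Borel sets. It is set to \<open>0\<close> off the Borel sets, as
  \<open>emeasure\<close> is, so that equality of matrices of measures is equality of functions.
\<close>

definition matrix_measure :: "(real set \<Rightarrow> real^2^2) \<Rightarrow> bool" where
  "matrix_measure \<Psi> \<longleftrightarrow>
     (\<forall>A. A \<notin> sets borel \<longrightarrow> \<Psi> A = 0) \<and>
     (\<forall>A\<in>sets borel. pos_semidef (\<Psi> A)) \<and>
     (\<forall>A::nat \<Rightarrow> real set. range A \<subseteq> sets borel \<longrightarrow> disjoint_family A \<longrightarrow>
        (\<lambda>n. \<Psi> (A n)) sums \<Psi> (\<Union>n. A n))"

definition supported_on :: "(real set \<Rightarrow> real^2^2) \<Rightarrow> real set \<Rightarrow> bool" where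
  "supported_on \<Psi> S \<longleftrightarrow> (\<forall>A\<in>sets borel. A \<inter> S = {} \<longrightarrow> \<Psi> A = 0)"

definition quad_measure :: "(real set \<Rightarrow> real^2^2) \<Rightarrow> real^2 \<Rightarrow> real measure" where
  "quad_measure \<Psi> v = measure_of UNIV (sets borel) (\<lambda>A. ennreal (v \<bullet> (\<Psi> A *v v)))"

text \<open>
  The integral \<open>\<integral> f d\<Psi>\<^sub>i\<^sub>j\<close> against the signed measure \<open>\<Psi>\<^sub>i\<^sub>j\<close>. By symmetry of \<open>\<Psi>\<close>,
  \<open>4 \<Psi>\<^sub>i\<^sub>j\<close> is the difference of the finite positive measures
  \<open>v\<^sup>T \<Psi> v\<close> for \<open>v = e\<^sub>i + e\<^sub>j\<close> and \<open>v = e\<^sub>i - e\<^sub>j\<close>.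
\<close>

definition entry_integral ::
  "(real set \<Rightarrow> real^2^2) \<Rightarrow> 2 \<Rightarrow> 2 \<Rightarrow> (real \<Rightarrow> real) \<Rightarrow> real" where
  "entry_integral \<Psi> i j f =
     ((LINT x|quad_measure \<Psi> (axis i 1 + axis j 1). f x) -
      (LINT x|quad_measure \<Psi> (axis i 1 - axis j 1). f x)) / 4"

definition abs_continuous :: "(real set \<Rightarrow> real^2^2) \<Rightarrow> bool" where
  "abs_continuous \<Psi> \<longleftrightarrow> (\<forall>A\<in>null_sets lborel. \<Psi> A = 0)"

definition has_density_on ::
  "(real set \<Rightarrow> real^2^2) \<Rightarrow> (real \<Rightarrow> real^2^2) \<Rightarrow> real set \<Rightarrow> bool" where
  "has_density_on \<Psi> W S \<longleftrightarrow> set_integrable lborel S W \<and>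
     (\<forall>A\<in>sets borel. \<Psi> A = (LINT x:A \<inter> S|lborel. W x))"


section \<open>The spectral matrix\<close>

definition Q_system :: "dimat \<Rightarrow> (2 \<Rightarrow> int \<Rightarrow> real poly) \<Rightarrow> bool" where
  "Q_system P Q \<longleftrightarrow>
     Q 1 0 = 1 \<and> Q 1 (-1) = 0 \<and> Q 2 0 = 0 \<and> Q 2 (-1) = 1 \<and>
     (\<forall>\<eta> n. [:0, 1:] * Q \<eta> n =
        smult (P n (n + 1)) (Q \<eta> (n + 1)) + smult (P n n) (Q \<eta> n) +
        smult (P n (n - 1)) (Q \<eta> (n - 1)))"

definition pot :: "dimat \<Rightarrow> int \<Rightarrow> real" where
  "pot P n =
     (if 0 \<le> n then (\<Prod>k\<in>{0..<n}. P k (k + 1)) / (\<Prod>k\<in>{1..n}. P k (k - 1))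
      else (\<Prod>k\<in>{n + 1..0}. P k (k - 1)) / (\<Prod>k\<in>{n..-1}. P k (k + 1)))"

text \<open>If the off-diagonal coefficients of \<open>P\<close> are nonzero, exactly one \<open>Q\<close> satisfies \<open>Q_system P Q\<close>.\<close>

definition spectral_matrix :: "dimat \<Rightarrow> (real set \<Rightarrow> real^2^2) \<Rightarrow> bool" where
  "spectral_matrix P \<Psi> \<longleftrightarrow> matrix_measure \<Psi> \<and> supported_on \<Psi> {-1..1} \<and>
     (\<exists>Q. Q_system P Q \<and>
        (\<forall>i j. (\<Sum>\<eta>\<in>UNIV. \<Sum>\<zeta>\<in>UNIV.
                  entry_integral \<Psi> \<eta> \<zeta> (\<lambda>x. poly (Q \<eta> i) x * poly (Q \<zeta> j) x))
               = (if i = j then 1 / pot P j else 0)))"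

end

theory Submission
  imports Defs
begin

text \<open>
  Throughout, \<open>V\<^sub>n(x)\<close> is the vector \<open>(Q\<^sup>1\<^sub>n(x), Q\<^sup>2\<^sub>n(x))\<close>, and \<open>\<Psi>\<close> is written as a density \<open>M\<close> with respect to
  a scalar measure, first the trace of \<open>\<Psi>\<close> and later Lebesgue measure.

  \<^bold>\<open>Absolute continuity.\<close> The proof uses no hypergeometric functions, only the behaviour of the
  coefficients as \<open>n \<rightarrow> \<infinity>\<close>. After symmetrization the off-diagonal entries \<open>sqrt (p\<^sub>n q\<^sub>n\<^sub>+\<^sub>1)\<close> and the diagonal
  entries \<open>r\<^sub>n\<close> differ from \<open>1/4\<close> and \<open>1/2\<close> by \<open>O(1/n\<^sup>2)\<close>. Such a summable perturbation of a recurrence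
  whose solutions oscillate for \<open>0 < x < 1\<close> leaves the solutions bounded, uniformly for \<open>x\<close> in a
  compact subset of \<open>(0, 1)\<close>, and their difference at \<open>x\<close> and \<open>y\<close> is \<open>O(n \<bar>x - y\<bar>)\<close> (\<open>transfer_bound\<close>, \<open>u_bounds\<close>).
  Because the Casoratian is constant, bounded solutions cannot be small either: the sum of
  \<open>\<pi>\<^sub>n (V\<^sub>n(x) \<bullet> v)\<^sup>2\<close> over \<open>n < 2 N\<close> is at least \<open>c N \<bar>v\<bar>\<^sup>2\<close> (\<open>kernel_lower_bound\<close>). Bessel's inequality
  for the indicator function of an interval of length \<open>O(1/N)\<close> then shows that \<open>\<Psi>\<close> gives it a mass of
  order \<open>1/N\<close> (\<open>tr_mass_interval\<close>), so \<open>\<Psi>\<close> has a locally bounded density in \<open>(0, 1)\<close>. The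
  factorization \<open>P = P\<^sub>U P\<^sub>L\<close> into mutually adjoint factors makes multiplication by \<open>x\<close> nonnegative and
  thereby excludes \<open>x < 0\<close> (\<open>support_nonneg\<close>). A point mass at \<open>0\<close> or \<open>1\<close> would produce a solution of the
  recurrence that is square summable for \<open>\<pi>\<close>. One solution is explicit at each of these points, the others
  come from it by summing the Casoratian identity, and Raabe's test shows that none is square summable
  (\<open>atom_free_endpoints\<close>).

  \<^bold>\<open>Darboux transformation.\<close> The vectors \<open>\<phi>\<^sub>n = s\<^sub>n V\<^sub>n + t\<^sub>n V\<^sub>n\<^sub>-\<^sub>1\<close> satisfy the recurrence of
  \<open>P\<^sub>L P\<^sub>U\<close>, and \<open>x V\<^sub>n = y\<^sub>n \<phi>\<^sub>n + x\<^sub>n \<phi>\<^sub>n\<^sub>+\<^sub>1\<close>. The rows of \<open>S\<^sub>0\<close> are \<open>\<phi>\<^sub>0\<close> and \<open>\<phi>\<^sub>-\<^sub>1\<close>, so \<open>\<phi>\<^sub>n\<close> is the row of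
  polynomials of \<open>P\<^sub>L P\<^sub>U\<close> multiplied by \<open>S\<^sub>0\<close>, and the claimed formula for the transformed density says that
  the \<open>\<phi>\<^sub>n\<close> are orthogonal for \<open>\<Psi>(x) / x\<close>. Their Gram matrix exists (\<open>gram_diag\<close>). It satisfies the
  orthogonality relations up to a multiple of \<open>f f\<^sup>T\<close> with \<open>f\<close> in the kernel of \<open>P\<^sub>U\<close>, and the multiple is
  zero because \<open>f\<close> is not square summable in the relevant weight (\<open>gram_eq\<close>, \<open>kernel_U_not_summable\<close>).

  Uniqueness of the spectral matrix is the determinacy of the moment problem on \<open>[-1, 1]\<close>
  (\<open>spectral_matrix_unique\<close>), and \<open>P\<^sub>L P\<^sub>U\<close> has the coefficients for \<open>\<alpha> - 1\<close> by a computation with rational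
  functions (\<open>darboux_coefs\<close>).
\<close>


section \<open>Matrices of measures and their densities\<close>

lemma bilin_mat: "bounded_linear (\<lambda>X::real^2^2. v \<bullet> (X *v w))"
  by (simp add: linear_conv_bounded_linear[symmetric] linear_iff matrix_vector_mult_add_rdistrib
      inner_add_right scaleR_matrix_vector_assoc[symmetric])

lemma inner_mat_2:
  "v \<bullet> (X *v w) = v$1 * X$1$1 * w$1 + v$1 * X$1$2 * w$2 + v$2 * X$2$1 * w$1 + v$2 * X$2$2 * w$2"
  for X :: "real^2^2"
  by (simp add: inner_vec_def matrix_vector_mult_def sum_2 algebra_simps)

lemma inner_axis_mat: "axis i 1 \<bullet> (X *v axis j 1) = X $ i $ j" for X :: "real^2^2"
  using exhaust_2[of i] exhaust_2[of j] by (auto simp: inner_mat_2 axis_def)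

lemma bounded_linear_entry: "bounded_linear (\<lambda>X::real^2^2. X $ i $ j)"
  using bilin_mat[of "axis i 1" "axis j 1"] unfolding inner_axis_mat .

lemma pos_semidef_iff:
  "pos_semidef X \<longleftrightarrow> X$1$2 = X$2$1 \<and> (\<forall>v. 0 \<le> v \<bullet> (X *v v))"
  by (auto simp: pos_semidef_def transpose_def vec_eq_iff forall_2)

lemma pos_semidef_inner_commute:
  assumes "pos_semidef X" shows "v \<bullet> (X *v w) = w \<bullet> (X *v v)"
  using assms by (auto simp: pos_semidef_iff inner_mat_2)

lemma pos_semidef_scaleR: "pos_semidef X \<Longrightarrow> 0 \<le> c \<Longrightarrow> pos_semidef (c *\<^sub>R X)"
  by (auto simp: pos_semidef_iff scaleR_matrix_vector_assoc[symmetric])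

lemma pos_semidef_inner_le:
  assumes "pos_semidef X"
  shows "2 * \<bar>v \<bullet> (X *v w)\<bar> \<le> v \<bullet> (X *v v) + w \<bullet> (X *v w)"
proof -
  have "0 \<le> (v + w) \<bullet> (X *v (v + w))" "0 \<le> (v - w) \<bullet> (X *v (v - w))"
    using assms by (auto simp: pos_semidef_iff)
  then show ?thesis
    using pos_semidef_inner_commute[OF assms, of v w]
    by (simp add: matrix_vector_right_distrib matrix_vector_mult_diff_distrib inner_add_left
        inner_add_right inner_diff_left inner_diff_right)
qed

lemma pos_semidef_trace_nonneg: "pos_semidef X \<Longrightarrow> 0 \<le> X$1$1 + X$2$2"
  using inner_axis_mat[of 1 X 1] inner_axis_mat[of 2 X 2] by (metis add_nonneg_nonneg pos_semidef_iff)

lemma pos_semidef_diag_nonneg: "pos_semidef X \<Longrightarrow> 0 \<le> X$i$i"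
  using inner_axis_mat[of i X i] by (metis pos_semidef_iff)

lemma pos_semidef_entry_le_trace:
  assumes "pos_semidef X" shows "\<bar>X$i$j\<bar> \<le> X$1$1 + X$2$2"
proof -
  have "2 * \<bar>X$i$j\<bar> \<le> X$i$i + X$j$j"
    using pos_semidef_inner_le[OF assms, of "axis i 1" "axis j 1"] by (simp add: inner_axis_mat)
  moreover have "X$k$k \<le> X$1$1 + X$2$2" for k
    using exhaust_2[of k] pos_semidef_diag_nonneg[OF assms] by auto
  ultimately show ?thesis by (smt (verit))
qed

lemma pos_semidef_trace_0:
  assumes "pos_semidef X" "X$1$1 + X$2$2 = 0" shows "X = 0"
  using pos_semidef_entry_le_trace[OF assms(1)] assms(2) by (simp add: vec_eq_iff)

lemma closed_pos_semidef: "closed {X. pos_semidef X}"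
proof -
  have "{X. pos_semidef X} = {X. X$1$2 = X$2$1} \<inter> (\<Inter>v. {X. 0 \<le> v \<bullet> (X *v v)})"
    by (auto simp: pos_semidef_iff)
  also have "closed \<dots>"
    by (intro closed_Int closed_INT ballI closed_Collect_eq closed_Collect_le
        linear_continuous_on[OF bilin_mat] linear_continuous_on[OF bounded_linear_entry] continuous_intros)
  finally show ?thesis .
qed

text \<open>
  A density of \<open>\<Psi>\<close> with respect to a scalar measure turns every integral against \<open>\<Psi>\<close>
  into one Lebesgue integral. Positivity is asked almost everywhere only, since a density that is
  merely given by its integrals is determined up to null sets.
\<close>

definition represents :: "real measure \<Rightarrow> (real \<Rightarrow> real^2^2) \<Rightarrow> (real set \<Rightarrow> real^2^2) \<Rightarrow> bool" where
  "represents \<mu> M \<Psi> \<longleftrightarrow> sets \<mu> = sets borel \<and> integrable \<mu> M \<and> (AE x in \<mu>. pos_semidef (M x)) \<and>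
     (\<forall>A. \<Psi> A = (if A \<in> sets borel then LINT x:A|\<mu>. M x else 0))"

text \<open>
  The averages of \<open>M\<close> over sets of positive measure lie in the closed cone of positive semidefinite
  matrices, hence so does \<open>M x\<close> for almost all \<open>x\<close> by the averaging theorem.
\<close>

lemma representsI:
  assumes "sigma_finite_measure \<mu>" "sets \<mu> = sets borel" "integrable \<mu> M" "matrix_measure \<Psi>"
    and "\<And>A. A \<in> sets borel \<Longrightarrow> \<Psi> A = (LINT x:A|\<mu>. M x)"
  shows "represents \<mu> M \<Psi>"
proof -
  interpret sigma_finite_measure \<mu> by fact
  have "AE x in \<mu>. M x \<in> {X. pos_semidef X}"
  proof (rule averaging_theorem[OF assms(3) closed_pos_semidef])
    fix A assume "A \<in> sets \<mu>" "0 < measure \<mu> A"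
    moreover have "pos_semidef (\<Psi> A)"
      using \<open>A \<in> sets \<mu>\<close> assms(2,4) by (auto simp: matrix_measure_def)
    ultimately show "(1 / measure \<mu> A) *\<^sub>R set_lebesgue_integral \<mu> A M \<in> {X. pos_semidef X}"
      using assms(2,5) by (auto intro!: pos_semidef_scaleR)
  qed
  then show ?thesis using assms by (auto simp: represents_def matrix_measure_def)
qed

lemma quad_measure_eq_density:
  assumes "represents \<mu> M \<Psi>"
  shows "quad_measure \<Psi> v = density \<mu> (\<lambda>x. ennreal (v \<bullet> (M x *v v)))"
proof -
  let ?D = "density \<mu> (\<lambda>x. ennreal (v \<bullet> (M x *v v)))"
  have s: "sets \<mu> = sets borel" and i: "integrable \<mu> M" and p: "AE x in \<mu>. pos_semidef (M x)"
    and \<Psi>: "\<And>A. A \<in> sets borel \<Longrightarrow> \<Psi> A = (LINT x:A|\<mu>. M x)"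
    using assms by (auto simp: represents_def)
  have sp: "space \<mu> = UNIV" using s sets_eq_imp_space_eq by fastforce
  have "?D = measure_of UNIV (sets borel) (emeasure ?D)"
    using measure_of_of_measure[of ?D] s sp by simp
  also have "\<dots> = measure_of UNIV (sets borel) (\<lambda>A. ennreal (v \<bullet> (\<Psi> A *v v)))"
  proof (rule measure_of_eq)
    fix A assume "A \<in> sigma_sets UNIV (sets (borel :: real measure))"
    then have A: "A \<in> sets borel" by (simp add: sets.sigma_sets_eq[of borel, simplified])
    have iA: "integrable \<mu> (\<lambda>x. indicator A x *\<^sub>R M x)"
      using A s i by (intro integrable_mult_indicator) auto
    have "emeasure ?D A = (\<integral>\<^sup>+x. ennreal (v \<bullet> (M x *v v)) * indicator A x \<partial>\<mu>)"
      using A s borel_measurable_integrable[OF integrable_bounded_linear[OF bilin_mat i]]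
      by (intro emeasure_density) auto
    also have "\<dots> = (\<integral>\<^sup>+x. ennreal (v \<bullet> ((indicator A x *\<^sub>R M x) *v v)) \<partial>\<mu>)"
      by (intro nn_integral_cong) (auto simp: indicator_def)
    also have "\<dots> = ennreal (\<integral>x. v \<bullet> ((indicator A x *\<^sub>R M x) *v v) \<partial>\<mu>)"
      by (intro nn_integral_eq_integral integrable_bounded_linear[OF bilin_mat iA] eventually_mono[OF p])
        (auto simp: pos_semidef_iff indicator_def)
    also have "(\<integral>x. v \<bullet> ((indicator A x *\<^sub>R M x) *v v) \<partial>\<mu>) = v \<bullet> (\<Psi> A *v v)"
      unfolding \<Psi>[OF A] set_lebesgue_integral_def
      by (rule integral_bounded_linear[OF bilin_mat iA])
    finally show "emeasure ?D A = ennreal (v \<bullet> (\<Psi> A *v v))" .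
  qed auto
  finally show ?thesis by (simp add: quad_measure_def)
qed

lemma entry_integral_eq:
  assumes R: "represents \<mu> M \<Psi>" and f: "f \<in> borel_measurable borel"
    and fM: "integrable \<mu> (\<lambda>x. f x *\<^sub>R M x)"
  shows "entry_integral \<Psi> i j f = (\<integral>x. f x * M x $ i $ j \<partial>\<mu>)"
proof -
  have s: "sets \<mu> = sets borel" and iM: "integrable \<mu> M" and p: "AE x in \<mu>. pos_semidef (M x)"
    using R by (auto simp: represents_def)
  have f': "f \<in> borel_measurable \<mu>" using f s measurable_cong_sets by blast
  have int: "integrable \<mu> (\<lambda>x. v \<bullet> ((f x *\<^sub>R M x) *v v))" for v
    by (rule integrable_bounded_linear[OF bilin_mat fM])
  have q: "(LINT x|quad_measure \<Psi> v. f x) = (\<integral>x. v \<bullet> ((f x *\<^sub>R M x) *v v) \<partial>\<mu>)" for v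
    unfolding quad_measure_eq_density[OF R] using p
    by (subst integral_density[OF f' borel_measurable_integrable[OF integrable_bounded_linear[OF bilin_mat iM]]])
       (auto simp: pos_semidef_iff scaleR_matrix_vector_assoc[symmetric] mult.commute)
  let ?v = "axis i 1 + axis j 1" and ?w = "axis i 1 - axis j (1::real)"
  have "entry_integral \<Psi> i j f
      = (\<integral>x. (?v \<bullet> ((f x *\<^sub>R M x) *v ?v) - ?w \<bullet> ((f x *\<^sub>R M x) *v ?w)) / 4 \<partial>\<mu>)"
    unfolding entry_integral_def q using int by simp
  also have "\<dots> = (\<integral>x. f x * M x $ i $ j \<partial>\<mu>)"
  proof (rule integral_cong_AE)
    show "AE x in \<mu>. (?v \<bullet> ((f x *\<^sub>R M x) *v ?v) - ?w \<bullet> ((f x *\<^sub>R M x) *v ?w)) / 4 = f x * M x $ i $ j"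
      using p
    proof (rule AE_mp, intro AE_I2 impI)
      fix x assume "pos_semidef (M x)"
      then have c: "axis i 1 \<bullet> (M x *v axis j 1) = axis j 1 \<bullet> (M x *v axis i 1)"
        by (rule pos_semidef_inner_commute)
      show "(?v \<bullet> ((f x *\<^sub>R M x) *v ?v) - ?w \<bullet> ((f x *\<^sub>R M x) *v ?w)) / 4 = f x * M x $ i $ j"
        unfolding scaleR_matrix_vector_assoc[symmetric] inner_scaleR_right matrix_vector_right_distrib
          matrix_vector_mult_diff_distrib inner_add_left inner_add_right inner_diff_left
          inner_diff_right
        using c unfolding inner_axis_mat by (simp add: algebra_simps)
    qed
    show "(\<lambda>x. (?v \<bullet> ((f x *\<^sub>R M x) *v ?v) - ?w \<bullet> ((f x *\<^sub>R M x) *v ?w)) / 4) \<in> borel_measurable \<mu>"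
      using int by (auto intro!: borel_measurable_integrable)
    show "(\<lambda>x. f x * M x $ i $ j) \<in> borel_measurable \<mu>"
      using borel_measurable_integrable[OF integrable_bounded_linear[OF bounded_linear_entry fM]] by simp
  qed
  finally show ?thesis .
qed

lemma represents_matrix_measure:
  assumes "represents \<mu> M \<Psi>" shows "matrix_measure \<Psi>"
proof -
  have s: "sets \<mu> = sets borel" and i: "integrable \<mu> M" and p: "AE x in \<mu>. pos_semidef (M x)"
    and \<Psi>: "\<And>A. \<Psi> A = (if A \<in> sets borel then LINT x:A|\<mu>. M x else 0)"
    using assms by (auto simp: represents_def)
  have iA: "integrable \<mu> (\<lambda>x. indicator A x *\<^sub>R M x)" if "A \<in> sets borel" for A
      using that s i by (intro integrable_mult_indicator) auto
  have "pos_semidef (\<Psi> A)" if A: "A \<in> sets borel" for A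
    unfolding pos_semidef_iff
  proof
    have e: "\<Psi> A $ i $ j = (\<integral>x. (indicator A x *\<^sub>R M x) $ i $ j \<partial>\<mu>)" for i j
      using A integral_bounded_linear[OF bounded_linear_entry iA[OF A], of i j]
      by (simp add: \<Psi> set_lebesgue_integral_def)
    have "AE x in \<mu>. (indicator A x *\<^sub>R M x) $ 1 $ 2 = (indicator A x *\<^sub>R M x) $ 2 $ 1"
      by (rule eventually_mono[OF p]) (auto simp: pos_semidef_iff)
    then show "\<Psi> A $ 1 $ 2 = \<Psi> A $ 2 $ 1" unfolding e
      using integrable_bounded_linear[OF bounded_linear_entry iA[OF A]]
      by (intro integral_cong_AE borel_measurable_integrable) auto
    show "\<forall>v. 0 \<le> v \<bullet> (\<Psi> A *v v)"
    proof
      fix v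
      have "v \<bullet> (\<Psi> A *v v) = (\<integral>x. v \<bullet> ((indicator A x *\<^sub>R M x) *v v) \<partial>\<mu>)"
        using A integral_bounded_linear[OF bilin_mat iA[OF A], of v v]
        by (simp add: \<Psi> set_lebesgue_integral_def)
      also have "\<dots> \<ge> 0"
        by (intro integral_nonneg_AE eventually_mono[OF p]) (auto simp: pos_semidef_iff indicator_def)
      finally show "0 \<le> v \<bullet> (\<Psi> A *v v)" .
    qed
  qed
  moreover have "(\<lambda>n. \<Psi> (A n)) sums \<Psi> (\<Union>n. A n)"
    if A: "range A \<subseteq> sets borel" "disjoint_family A" for A :: "nat \<Rightarrow> real set"
  proof -
    have A': "A n \<in> sets \<mu>" for n using A s by auto
    have si: "set_integrable \<mu> B M" if "B \<in> sets \<mu>" for B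
      using iA that s by (auto simp: set_integrable_def)
    have "(\<Sum>i<n. \<Psi> (A i)) = (LINT x:(\<Union>i<n. A i)|\<mu>. M x)" for n
      using A A' s
      by (subst set_integral_finite_Union) (auto simp: \<Psi> disjoint_family_on_def intro!: si)
    moreover have "(\<lambda>n. LINT x:(\<Union>i<n. A i)|\<mu>. M x) \<longlonglongrightarrow> (LINT x:(\<Union>n. \<Union>i<n. A i)|\<mu>. M x)"
      using A' by (intro set_integral_cont_up si) (force simp: incseq_def intro!: si)+
    moreover have "(\<Union>n. \<Union>i<n. A i) = (\<Union>n. A n)" by blast
    ultimately show ?thesis using A' s by (simp add: sums_def \<Psi>)
  qed
  ultimately show ?thesis by (auto simp: matrix_measure_def \<Psi>)
qed

lemma emeasure_linear_matrix_measure: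
  assumes \<Psi>: "matrix_measure \<Psi>" and L: "bounded_linear L" "\<forall>X. pos_semidef X \<longrightarrow> 0 \<le> L X"
  defines "N \<equiv> measure_of UNIV (sets borel) (\<lambda>A. ennreal (L (\<Psi> A)))"
  shows "sets N = sets borel" "A \<in> sets borel \<Longrightarrow> emeasure N A = ennreal (L (\<Psi> A))" "finite_measure N"
proof -
  interpret bounded_linear L by fact
  show s: "sets N = sets borel" by (simp add: N_def sets.sigma_sets_eq[of borel, simplified])
  have p: "0 \<le> L (\<Psi> A)" if "A \<in> sets borel" for A
    using that \<Psi> L by (auto simp: matrix_measure_def)
  show e: "emeasure N A = ennreal (L (\<Psi> A))" if "A \<in> sets borel" for A
  proof (rule emeasure_measure_of[OF N_def[THEN meta_eq_to_obj_eq]])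
    show "A \<in> sets N" using that s by simp
    have "(\<lambda>n::nat. \<Psi> {}) sums \<Psi> (\<Union>n::nat. {})"
      using \<Psi> unfolding matrix_measure_def by (elim conjE allE[of _ "\<lambda>n. {}"]) (auto simp: disjoint_family_on_def)
    then have "\<Psi> {} = 0" by (auto dest!: sums_summable summable_LIMSEQ_zero simp: LIMSEQ_const_iff)
    then show "positive (sets N) (\<lambda>A. ennreal (L (\<Psi> A)))" by (simp add: positive_def zero)
    show "countably_additive (sets N) (\<lambda>A. ennreal (L (\<Psi> A)))"
    proof (rule countably_additiveI)
      fix A :: "nat \<Rightarrow> real set" assume A: "range A \<subseteq> sets N" "disjoint_family A"
      then have "(\<lambda>n. \<Psi> (A n)) sums \<Psi> (\<Union>n. A n)" using \<Psi> s by (auto simp: matrix_measure_def)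
      then have "(\<lambda>n. L (\<Psi> (A n))) sums L (\<Psi> (\<Union>n. A n))" by (rule sums)
      then show "(\<Sum>i. ennreal (L (\<Psi> (A i)))) = ennreal (L (\<Psi> (\<Union> (range A))))"
        using A s p by (metis rangeI subsetD suminf_ennreal_eq)
    qed
  qed auto
  show "finite_measure N"
    by (rule finite_measureI) (simp add: e sets_eq_imp_space_eq[OF s])
qed

text \<open>
  The trace of \<open>\<Psi>\<close> is a finite measure. A positive semidefinite matrix with trace zero vanishes, so
  every quadratic measure \<open>v\<^sup>T \<Psi> v\<close> is absolutely continuous with respect to the trace. The
  Radon-Nikodym derivatives for \<open>v = e\<^sub>i + e\<^sub>j\<close> and \<open>v = e\<^sub>i - e\<^sub>j\<close> give the entries of \<open>M\<close> by polarization.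
\<close>

lemma matrix_measure_represents:
  assumes \<Psi>: "matrix_measure \<Psi>"
  obtains \<mu> M where "finite_measure \<mu>" "represents \<mu> M \<Psi>"
    "\<And>A. A \<in> sets borel \<Longrightarrow> emeasure \<mu> A = ennreal (\<Psi> A $ 1 $ 1 + \<Psi> A $ 2 $ 2)"
proof -
  have tr: "bounded_linear (\<lambda>X::real^2^2. X $ 1 $ 1 + X $ 2 $ 2)"
    by (intro bounded_linear_add bounded_linear_entry)
  define \<mu> where "\<mu> = measure_of UNIV (sets borel) (\<lambda>A. ennreal (\<Psi> A $ 1 $ 1 + \<Psi> A $ 2 $ 2))"
  have trn: "\<forall>X. pos_semidef X \<longrightarrow> 0 \<le> X $ 1 $ 1 + X $ 2 $ 2"
    using pos_semidef_trace_nonneg by blast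
  note m = emeasure_linear_matrix_measure[OF \<Psi> tr trn, folded \<mu>_def]
  interpret finite_measure \<mu> by (rule m(3))
  have nn: "\<forall>X. pos_semidef X \<longrightarrow> 0 \<le> v \<bullet> (X *v v)" for v
    by (auto simp: pos_semidef_iff)
  note q = emeasure_linear_matrix_measure[OF \<Psi> bilin_mat nn, folded quad_measure_def]
  have ac: "absolutely_continuous \<mu> (quad_measure \<Psi> v)" for v
    unfolding absolutely_continuous_def
  proof
    fix A assume A: "A \<in> null_sets \<mu>"
    then have b: "A \<in> sets borel" using m(1) by auto
    then have psd: "pos_semidef (\<Psi> A)" using \<Psi> by (auto simp: matrix_measure_def)
    have "\<Psi> A $ 1 $ 1 + \<Psi> A $ 2 $ 2 \<le> 0"
      using A m(2)[OF b] by (auto simp: null_sets_def ennreal_eq_0_iff)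
    then have "\<Psi> A = 0" using pos_semidef_trace_0[OF psd] pos_semidef_trace_nonneg[OF psd] by simp
    then show "A \<in> null_sets (quad_measure \<Psi> v)"
      using b q(1,2) by (auto simp: null_sets_def)
  qed
  have "\<exists>D. integrable \<mu> D \<and> (\<forall>A\<in>sets borel. (LINT x:A|\<mu>. D x) = v \<bullet> (\<Psi> A *v v))" for v
  proof -
    obtain D where D: "D \<in> borel_measurable \<mu>"
      "AE x in \<mu>. RN_deriv \<mu> (quad_measure \<Psi> v) x = ennreal (D x)" "\<And>x. 0 \<le> D x"
      using real_RN_deriv[OF q(3) ac] q(1) m(1) by metis
    have "density \<mu> (\<lambda>x. ennreal (D x)) = density \<mu> (RN_deriv \<mu> (quad_measure \<Psi> v))"
      using D by (intro density_cong) auto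
    also have "\<dots> = quad_measure \<Psi> v"
      using ac q(1) m(1) by (intro density_RN_deriv) auto
    finally have d: "density \<mu> (\<lambda>x. ennreal (D x)) = quad_measure \<Psi> v" .
    have n: "(\<integral>\<^sup>+x. ennreal (indicator A x * D x) \<partial>\<mu>) = ennreal (v \<bullet> (\<Psi> A *v v))"
      if A: "A \<in> sets borel" for A
    proof -
      have "(\<integral>\<^sup>+x. ennreal (indicator A x * D x) \<partial>\<mu>) = (\<integral>\<^sup>+x. ennreal (D x) * indicator A x \<partial>\<mu>)"
        by (intro nn_integral_cong) (auto simp: indicator_def)
      also have "\<dots> = emeasure (density \<mu> (\<lambda>x. ennreal (D x))) A"
        using A D m(1) by (subst emeasure_density) auto
      finally show ?thesis unfolding d using q(2)[OF A] by simp
    qed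
    have "integrable \<mu> D"
      using n[of UNIV] D by (intro integrableI_nonneg) auto
    moreover have "(LINT x:A|\<mu>. D x) = v \<bullet> (\<Psi> A *v v)" if A: "A \<in> sets borel" for A
    proof -
      have "(LINT x:A|\<mu>. D x) = enn2real (\<integral>\<^sup>+x. ennreal (indicator A x * D x) \<partial>\<mu>)"
        unfolding set_lebesgue_integral_def using D A m(1)
        by (subst integral_eq_nn_integral) auto
      also have "\<dots> = v \<bullet> (\<Psi> A *v v)"
        unfolding n[OF A] using \<Psi> A by (auto simp: matrix_measure_def pos_semidef_iff)
      finally show ?thesis .
    qed
    ultimately show ?thesis by blast
  qed
  then obtain D where D: "\<And>v. integrable \<mu> (D v)"
    "\<And>v A. A \<in> sets borel \<Longrightarrow> (LINT x:A|\<mu>. D v x) = v \<bullet> (\<Psi> A *v v)"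
    by metis
  define m where "m i j x = (D (axis i 1 + axis j 1) x - D (axis i 1 - axis j 1) x) / 4" for i j :: 2 and x
  define M :: "real \<Rightarrow> real^2^2" where
    "M x = (\<Sum>i\<in>UNIV. \<Sum>j\<in>UNIV. m i j x *\<^sub>R axis i (axis j 1))" for x
  have M: "M x $ i $ j = m i j x" for x i j
    using exhaust_2[of i] exhaust_2[of j] by (auto simp: M_def sum_2 axis_def)
  have intM: "integrable \<mu> M" unfolding M_def m_def using D by auto
  have "\<Psi> A = (LINT x:A|\<mu>. M x)" if A: "A \<in> sets borel" for A
  proof -
    have iA: "integrable \<mu> (\<lambda>x. indicator A x *\<^sub>R M x)"
      using A m(1) intM by (intro integrable_mult_indicator) auto
    have si: "set_integrable \<mu> A (D v)" for v
      unfolding set_integrable_def using A m(1) D by (intro integrable_mult_indicator) auto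
    have "(LINT x:A|\<mu>. M x) $ i $ j = \<Psi> A $ i $ j" for i j
    proof -
      have "(LINT x:A|\<mu>. M x) $ i $ j = (LINT x:A|\<mu>. m i j x)"
        using integral_bounded_linear[OF bounded_linear_entry iA, of i j]
        by (simp add: set_lebesgue_integral_def M)
      also have "\<dots> = ((LINT x:A|\<mu>. D (axis i 1 + axis j 1) x) - (LINT x:A|\<mu>. D (axis i 1 - axis j 1) x)) / 4"
        unfolding m_def using si by simp
      also have "\<dots> = \<Psi> A $ i $ j"
      proof -
        have c: "axis i 1 \<bullet> (\<Psi> A *v axis j 1) = axis j 1 \<bullet> (\<Psi> A *v axis i 1)"
          using A \<Psi> by (intro pos_semidef_inner_commute) (auto simp: matrix_measure_def)
        show ?thesis unfolding D(2)[OF A] matrix_vector_right_distrib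
          matrix_vector_mult_diff_distrib inner_add_left inner_add_right inner_diff_left
          inner_diff_right
        using c unfolding inner_axis_mat by (simp add: algebra_simps)
      qed
      finally show ?thesis .
    qed
    then show ?thesis by (simp add: vec_eq_iff)
  qed
  then have "represents \<mu> M \<Psi>"
    using m(1) intM \<Psi> by (intro representsI) (auto intro: sigma_finite_measure_axioms)
  then show thesis using m that by blast
qed

lemma represents_support:
  assumes R: "represents \<mu> M \<Psi>" and "sigma_finite_measure \<mu>"
    and S: "supported_on \<Psi> S" "S \<in> sets borel"
  shows "AE x in \<mu>. x \<notin> S \<longrightarrow> M x = 0"
proof -
  interpret sigma_finite_measure \<mu> by fact
  have s: "sets \<mu> = sets borel" and i: "integrable \<mu> M" 
    and \<Psi>: "\<And>A. A \<in> sets borel \<Longrightarrow> \<Psi> A = (LINT x:A|\<mu>. M x)"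
    using R by (auto simp: represents_def)
  have "AE x in \<mu>. indicator (- S) x *\<^sub>R M x = 0"
  proof (rule density_zero)
    show "integrable \<mu> (\<lambda>x. indicator (- S) x *\<^sub>R M x)"
      using S s i by (intro integrable_mult_indicator) auto
    fix A assume "A \<in> sets \<mu>"
    then have "\<Psi> (A - S) = 0" "A - S \<in> sets borel" using S s by (auto simp: supported_on_def)
    moreover have "(LINT x:A|\<mu>. indicator (- S) x *\<^sub>R M x) = (LINT x:A - S|\<mu>. M x)"
      unfolding set_lebesgue_integral_def by (intro Bochner_Integration.integral_cong) (auto simp: indicator_def)
    ultimately show "(LINT x:A|\<mu>. indicator (- S) x *\<^sub>R M x) = 0" using \<Psi> by simp
  qed
  then show ?thesis by (rule eventually_mono) (auto simp: indicator_def split: if_splits)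
qed


section \<open>The quadratic form of a matrix weight\<close>

text \<open>
  The test functions: every weight below is carried by \<open>[-1, 1]\<close>, so this class contains the
  polynomials as well as the indicator functions needed for Bessel's inequality.
\<close>

definition bdd_borel :: "(real \<Rightarrow> 'a::{real_normed_vector}) \<Rightarrow> bool" where
  "bdd_borel f \<longleftrightarrow> f \<in> borel_measurable borel \<and> (\<exists>C. \<forall>x\<in>{-1..1}. norm (f x) \<le> C)"

lemma bdd_borel_continuous: "continuous_on UNIV f \<Longrightarrow> bdd_borel f"
  unfolding bdd_borel_def
proof
  assume c: "continuous_on UNIV f"
  then show "f \<in> borel_measurable borel" by (rule borel_measurable_continuous_onI)
  have "compact (f ` {-1..1})"
    using c by (intro compact_continuous_image continuous_on_subset[OF c]) auto
  then show "\<exists>C. \<forall>x\<in>{-1..1}. norm (f x) \<le> C"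
    using compact_imp_bounded by (fastforce simp: bounded_iff)
qed

lemma bdd_borel_const: "bdd_borel (\<lambda>x. c)"
  by (rule bdd_borel_continuous) simp

lemma bdd_borel_add:
  fixes f g :: "real \<Rightarrow> 'a::{real_normed_vector, second_countable_topology}"
  assumes "bdd_borel f" "bdd_borel g" shows "bdd_borel (\<lambda>x. f x + g x)"
proof -
  obtain C D where "\<forall>x\<in>{-1..1}. norm (f x) \<le> C" "\<forall>x\<in>{-1..1}. norm (g x) \<le> D"
    using assms by (auto simp: bdd_borel_def)
  then have "\<forall>x\<in>{-1..1}. norm (f x + g x) \<le> C + D"
    by (meson norm_add_rule_thm)
  then show ?thesis using assms by (auto simp: bdd_borel_def)
qed

lemma bdd_borel_scaleR:
  fixes f :: "real \<Rightarrow> 'a::{real_normed_vector, second_countable_topology}"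
  assumes "bdd_borel h" "bdd_borel f" shows "bdd_borel (\<lambda>x. h x *\<^sub>R f x)"
proof -
  obtain C D where "\<forall>x\<in>{-1..1}. norm (h x) \<le> C" "\<forall>x\<in>{-1..1}. norm (f x) \<le> D"
    using assms by (auto simp: bdd_borel_def)
  then have "\<forall>x\<in>{-1..1}. norm (h x *\<^sub>R f x) \<le> C * D"
    unfolding norm_scaleR by (intro ballI mult_mono) (auto intro: order_trans[OF abs_ge_zero])
  then show ?thesis using assms by (auto simp: bdd_borel_def)
qed

lemma bdd_borel_mult: "bdd_borel h \<Longrightarrow> bdd_borel f \<Longrightarrow> bdd_borel (\<lambda>x. h x * f x :: real)"
  using bdd_borel_scaleR[of h f] by simp

lemma bdd_borel_cscaleR:
  fixes f :: "real \<Rightarrow> 'a::{real_normed_vector, second_countable_topology}"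
  shows "bdd_borel f \<Longrightarrow> bdd_borel (\<lambda>x. c *\<^sub>R f x)"
  by (rule bdd_borel_scaleR[OF bdd_borel_const])

lemma bdd_borel_sum:
  fixes f :: "'b \<Rightarrow> real \<Rightarrow> 'a::{real_normed_vector, second_countable_topology}"
  assumes "\<And>i. i \<in> F \<Longrightarrow> bdd_borel (f i)" shows "bdd_borel (\<lambda>x. \<Sum>i\<in>F. f i x)"
  using assms by (induction F rule: infinite_finite_induct) (auto intro: bdd_borel_const bdd_borel_add)

lemma bdd_borel_indicator: "A \<in> sets borel \<Longrightarrow> bdd_borel (indicator A :: real \<Rightarrow> real)"
  by (auto simp: bdd_borel_def intro!: exI[of _ 1] simp: indicator_def)

lemma bdd_borel_poly: "bdd_borel (\<lambda>x. poly p x :: real)"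
  by (rule bdd_borel_continuous) (intro continuous_intros)

lemma bdd_borel_id: "bdd_borel (\<lambda>x::real. x)"
  by (rule bdd_borel_continuous) simp

lemma bdd_borel_nth: "bdd_borel f \<Longrightarrow> bdd_borel (\<lambda>x. f x $ i)" for f :: "real \<Rightarrow> real^2"
  unfolding bdd_borel_def
proof (elim conjE exE, intro conjI exI)
  fix C assume "f \<in> borel_measurable borel" "\<forall>x\<in>{-1..1}. norm (f x) \<le> C"
  then show "(\<lambda>x. f x $ i) \<in> borel_measurable borel" "\<forall>x\<in>{-1..1}. norm (f x $ i) \<le> C"
    by (auto simp: cart_eq_inner_axis)[1]
      (use \<open>\<forall>x\<in>{-1..1}. norm (f x) \<le> C\<close> in \<open>auto intro: order_trans[OF component_le_norm_cart]\<close>)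
qed

locale weight =
  fixes \<mu> :: "real measure" and M :: "real \<Rightarrow> real^2^2"
  assumes sets_\<mu>: "sets \<mu> = sets borel" and integrable_M: "integrable \<mu> M"
    and psd: "AE x in \<mu>. pos_semidef (M x)"
    and supp: "AE x in \<mu>. x \<notin> {-1..1} \<longrightarrow> M x = 0"
begin

definition B :: "(real \<Rightarrow> real^2) \<Rightarrow> (real \<Rightarrow> real^2) \<Rightarrow> real" where
  "B f g = (\<integral>x. f x \<bullet> (M x *v g x) \<partial>\<mu>)"

lemma bdd_borel_measurable: "bdd_borel f \<Longrightarrow> f \<in> borel_measurable \<mu>"
  using sets_\<mu> measurable_cong_sets unfolding bdd_borel_def by blast

lemma integrable_scaleR_M:
  assumes "bdd_borel h" shows "integrable \<mu> (\<lambda>x. h x *\<^sub>R M x)"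
proof -
  obtain C where C: "\<forall>x\<in>{-1..1}. norm (h x) \<le> C" using assms by (auto simp: bdd_borel_def)
  show ?thesis
  proof (rule Bochner_Integration.integrable_bound)
    show "integrable \<mu> (\<lambda>x. C *\<^sub>R M x)" using integrable_M by simp
    show "(\<lambda>x. h x *\<^sub>R M x) \<in> borel_measurable \<mu>"
      using bdd_borel_measurable[OF assms] integrable_M by measurable
    show "AE x in \<mu>. norm (h x *\<^sub>R M x) \<le> norm (C *\<^sub>R M x)"
    proof (rule eventually_mono[OF supp])
      fix x assume x: "x \<notin> {-1..1} \<longrightarrow> M x = 0"
      show "norm (h x *\<^sub>R M x) \<le> norm (C *\<^sub>R M x)"
      proof (cases "x \<in> {-1..1}")
        case True
        then have "\<bar>h x\<bar> \<le> \<bar>C\<bar>" using C by fastforce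
        then show ?thesis by (simp add: mult_right_mono)
      qed (use x in simp)
    qed
  qed
qed

lemma integrable_entry: "bdd_borel h \<Longrightarrow> integrable \<mu> (\<lambda>x. h x * M x $ i $ j)"
  using integrable_bounded_linear[OF bounded_linear_entry integrable_scaleR_M, of h i j] by simp

lemma integrable_form:
  assumes "bdd_borel f" "bdd_borel g" shows "integrable \<mu> (\<lambda>x. f x \<bullet> (M x *v g x))"
proof -
  have "integrable \<mu> (\<lambda>x. (f x $ i * g x $ j) * M x $ i $ j)" for i j
    by (intro integrable_entry bdd_borel_mult bdd_borel_nth assms)
  then have "integrable \<mu> (\<lambda>x. f x $ i * M x $ i $ j * g x $ j)" for i j
    by (simp add: mult.assoc mult.commute mult.left_commute)
  then show ?thesis unfolding inner_mat_2 by simp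
qed

lemma B_add_left: "bdd_borel f \<Longrightarrow> bdd_borel g \<Longrightarrow> bdd_borel h \<Longrightarrow> B (\<lambda>x. f x + g x) h = B f h + B g h"
  unfolding B_def inner_add_left by (simp add: integrable_form)

lemma B_cscaleR_left: "B (\<lambda>x. c *\<^sub>R f x) h = c * B f h"
  unfolding B_def inner_scaleR_left by simp

lemma B_scaleR_shift: "B (\<lambda>x. c x *\<^sub>R f x) h = B f (\<lambda>x. c x *\<^sub>R h x)"
  unfolding B_def inner_scaleR_left inner_scaleR_right matrix_vector_mult_scaleR by simp

lemma B_sum_left:
  assumes "\<And>i. i \<in> F \<Longrightarrow> bdd_borel (f i)" "bdd_borel h"
  shows "B (\<lambda>x. \<Sum>i\<in>F. f i x) h = (\<Sum>i\<in>F. B (f i) h)"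
  unfolding B_def inner_sum_left using assms by (simp add: integrable_form)

lemma B_commute: "bdd_borel f \<Longrightarrow> bdd_borel g \<Longrightarrow> B f g = B g f"
  unfolding B_def
  by (intro integral_cong_AE borel_measurable_integrable integrable_form eventually_mono[OF psd]
      pos_semidef_inner_commute)

lemma B_nonneg: "0 \<le> B f f"
  unfolding B_def by (intro integral_nonneg_AE eventually_mono[OF psd]) (auto simp: pos_semidef_iff)

lemma B_add_right: "bdd_borel f \<Longrightarrow> bdd_borel g \<Longrightarrow> bdd_borel h \<Longrightarrow> B h (\<lambda>x. f x + g x) = B h f + B h g"
  by (simp add: B_commute[of h] B_add_left bdd_borel_add)

lemma B_sum_right:
  assumes "\<And>i. i \<in> F \<Longrightarrow> bdd_borel (f i)" "bdd_borel h"
  shows "B h (\<lambda>x. \<Sum>i\<in>F. f i x) = (\<Sum>i\<in>F. B h (f i))"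
  using assms by (simp add: B_commute[of h] B_sum_left bdd_borel_sum)

lemma B_cscaleR_right: "B h (\<lambda>x. c *\<^sub>R f x) = c * B h f"
  using B_scaleR_shift[of "\<lambda>x. c" h f] by (simp add: B_cscaleR_left)

lemma B_axis: "B (\<lambda>x. h x *\<^sub>R axis i 1) (\<lambda>x. axis j 1) = (\<integral>x. h x * M x $ i $ j \<partial>\<mu>)"
  unfolding B_def inner_scaleR_left inner_axis_mat ..

lemma sum_entries_eq_B:
  assumes "bdd_borel f" "bdd_borel g"
  shows "(\<Sum>\<eta>\<in>UNIV. \<Sum>\<zeta>\<in>UNIV. \<integral>x. (f x $ \<eta> * g x $ \<zeta>) * M x $ \<eta> $ \<zeta> \<partial>\<mu>) = B f g"
proof -
  have "integrable \<mu> (\<lambda>x. (f x $ \<eta> * g x $ \<zeta>) * M x $ \<eta> $ \<zeta>)" for \<eta> \<zeta>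
    by (intro integrable_entry bdd_borel_mult bdd_borel_nth assms)
  moreover have e: "(f x $ \<eta> * g x $ \<zeta>) * M x $ \<eta> $ \<zeta> = f x $ \<eta> * M x $ \<eta> $ \<zeta> * g x $ \<zeta>" for x \<eta> \<zeta>
    by simp
  ultimately show ?thesis unfolding e B_def inner_mat_2 sum_2 by simp
qed

end

section \<open>Orthogonal solutions of a three-term recurrence\<close>

locale ortho_system = weight +
  fixes V :: "int \<Rightarrow> real \<Rightarrow> real^2" and w :: "int \<Rightarrow> real"
  assumes cont_V: "continuous_on UNIV (V n)" and w_pos: "0 < w n"
    and orth: "B (V i) (V j) = (if i = j then 1 / w j else 0)"
begin

lemma bdd_borel_V: "bdd_borel (V n)"
  by (rule bdd_borel_continuous[OF cont_V])

text \<open>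
  The case of interest is \<open>f = indicator A *\<^sub>R v\<close>: it converts growth of the solutions \<open>V n\<close> on a set \<open>A\<close>
  into smallness of the mass of \<open>A\<close>.
\<close>

lemma bessel:
  assumes f: "bdd_borel f" and "finite F"
  shows "(\<Sum>n\<in>F. w n * (B f (V n))\<^sup>2) \<le> B f f"
proof -
  define c where "c n = - (w n * B f (V n))" for n
  define g where "g = (\<lambda>x. \<Sum>n\<in>F. c n *\<^sub>R V n x)"
  have g: "bdd_borel g" unfolding g_def by (intro bdd_borel_sum bdd_borel_cscaleR bdd_borel_V)
  have *: "B h g = (\<Sum>n\<in>F. c n * B h (V n))" if "bdd_borel h" for h
    unfolding g_def using that by (simp add: B_sum_right bdd_borel_cscaleR bdd_borel_V B_cscaleR_right)
  have "B g (V m) = (if m \<in> F then c m / w m else 0)" for m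
    unfolding g_def
    using \<open>finite F\<close> by (simp add: B_sum_left bdd_borel_cscaleR bdd_borel_V B_cscaleR_left orth if_distrib sum.delta' cong: if_cong)
  then have gg: "B g g = (\<Sum>n\<in>F. w n * (B f (V n))\<^sup>2)"
    unfolding *[OF g]
    by (intro sum.cong) (use w_pos in \<open>auto simp: c_def power2_eq_square less_imp_neq[symmetric]\<close>)
  have fg: "B f g = - (\<Sum>n\<in>F. w n * (B f (V n))\<^sup>2)"
    unfolding *[OF f] c_def by (simp add: power2_eq_square sum_negf mult.assoc)
  have "0 \<le> B (\<lambda>x. f x + g x) (\<lambda>x. f x + g x)" by (rule B_nonneg)
  also have "\<dots> = B f f + 2 * B f g + B g g"
    using f g by (simp add: B_add_left B_add_right bdd_borel_add B_commute[of g f])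
  finally show ?thesis using gg fg by simp
qed

end

text \<open>
  The value of \<open>B (\<lambda>x. x ^ k *\<^sub>R V i x) (V j)\<close>, computed from the recurrence coefficients alone.
\<close>

primrec chain_moment :: "(int \<Rightarrow> real) \<Rightarrow> (int \<Rightarrow> real) \<Rightarrow> (int \<Rightarrow> real) \<Rightarrow> (int \<Rightarrow> real) \<Rightarrow> nat \<Rightarrow> int \<Rightarrow> int \<Rightarrow> real" where
  "chain_moment p r q w 0 = (\<lambda>i j. if i = j then 1 / w j else 0)"
| "chain_moment p r q w (Suc k) = (\<lambda>i j. p i * chain_moment p r q w k (i + 1) j
     + r i * chain_moment p r q w k i j + q i * chain_moment p r q w k (i - 1) j)"

locale ortho_chain = ortho_system +
  fixes p r q :: "int \<Rightarrow> real"
  assumes p_pos: "0 < p n" and q_pos: "0 < q n" and w_0: "w 0 = 1"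
    and w_Suc: "w (n + 1) * q (n + 1) = w n * p n"
    and V_rec: "x *\<^sub>R V n x = p n *\<^sub>R V (n + 1) x + r n *\<^sub>R V n x + q n *\<^sub>R V (n - 1) x"
    and V_0: "V 0 x = axis 1 1" and V_m1: "V (- 1) x = axis 2 1"
begin

lemma B_power_V: "B (\<lambda>x. x ^ k *\<^sub>R V i x) (V j) = chain_moment p r q w k i j"
proof (induction k arbitrary: i)
  case 0
  then show ?case by (simp add: orth)
next
  case (Suc k)
  have n: "bdd_borel (\<lambda>x. c *\<^sub>R (x ^ k *\<^sub>R V i x))" for c i
    by (intro bdd_borel_cscaleR bdd_borel_scaleR bdd_borel_V bdd_borel_continuous continuous_intros)
  have "(\<lambda>x. x ^ Suc k *\<^sub>R V i x) = (\<lambda>x. p i *\<^sub>R (x ^ k *\<^sub>R V (i + 1) x)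
      + r i *\<^sub>R (x ^ k *\<^sub>R V i x) + q i *\<^sub>R (x ^ k *\<^sub>R V (i - 1) x))"
  proof
    fix x
    have "x ^ Suc k *\<^sub>R V i x = x ^ k *\<^sub>R (x *\<^sub>R V i x)" by simp
    then show "x ^ Suc k *\<^sub>R V i x = p i *\<^sub>R (x ^ k *\<^sub>R V (i + 1) x)
      + r i *\<^sub>R (x ^ k *\<^sub>R V i x) + q i *\<^sub>R (x ^ k *\<^sub>R V (i - 1) x)"
      unfolding V_rec by (simp add: scaleR_add_right mult.commute)
  qed
  then show ?case
    by (simp only: B_add_left bdd_borel_add n bdd_borel_V B_cscaleR_left Suc chain_moment.simps)
qed

lemma moment_eq:
  "(\<integral>x. x ^ k * M x $ i $ j \<partial>\<mu>) =
     chain_moment p r q w k (if i = 1 then 0 else - 1) (if j = 1 then 0 else - 1)"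
proof -
  have "V (if i = 1 then 0 else - 1) = (\<lambda>x. axis i 1)" for i :: 2
    using exhaust_2[of i] by (auto simp: V_0 V_m1)
  then show ?thesis unfolding B_power_V[symmetric] B_axis[symmetric] by simp
qed

end

section \<open>Determination by moments\<close>

text \<open>
  By the Weierstrass approximation theorem equal moments give equal integrals of continuous functions,
  and continuous ramps converge to the indicator function of a half-line.
\<close>

lemma measure_eq_of_moments:
  fixes M N :: "real measure"
  assumes "finite_measure M" "finite_measure N" and s: "sets M = sets borel" "sets N = sets borel"
    and M: "AE x in M. x \<in> {-1..1}" and N: "AE x in N. x \<in> {-1..1}"
    and mom: "\<And>k. (\<integral>x. x ^ k \<partial>M) = (\<integral>x. x ^ k \<partial>N)"
  shows "M = N"
proof -
  interpret M: finite_measure M by fact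
  interpret N: finite_measure N by fact
  have int: "integrable K f" if "finite_measure K" "sets K = sets borel" "AE x in K. x \<in> {-1..1}" "continuous_on UNIV f"
    for K and f :: "real \<Rightarrow> real"
  proof -
    interpret finite_measure K by fact
    have n: "bdd_borel f" by (rule bdd_borel_continuous) fact
    then obtain C where C: "\<forall>x\<in>{-1..1}. norm (f x) \<le> C" by (auto simp: bdd_borel_def)
    show ?thesis
      by (rule integrable_const_bound[where B=C])
        (use n that(2) C measurable_cong_sets in \<open>auto intro!: eventually_mono[OF that(3)] simp: bdd_borel_def\<close>)
  qed
  note intM = int[OF M.finite_measure_axioms s(1) M] and intN = int[OF N.finite_measure_axioms s(2) N]
  have poly: "(\<integral>x. (\<Sum>i\<le>n. a i * x ^ i) \<partial>M) = (\<integral>x. (\<Sum>i\<le>n. a i * x ^ i) \<partial>N)" for a and n :: nat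
    using mom by (simp add: intM intN continuous_intros)
  have cont: "(\<integral>x. f x \<partial>M) = (\<integral>x. f x \<partial>N)" if f: "continuous_on UNIV f" for f :: "real \<Rightarrow> real"
  proof (rule ccontr)
    define e where "e = \<bar>(\<integral>x. f x \<partial>M) - (\<integral>x. f x \<partial>N)\<bar>"
    define T where "T = measure M UNIV + measure N UNIV + 1"
    have T: "T > 0" by (simp add: T_def add_nonneg_pos)
    assume "(\<integral>x. f x \<partial>M) \<noteq> (\<integral>x. f x \<partial>N)"
    then have e: "e > 0" by (simp add: e_def)
    obtain g where g: "real_polynomial_function g" "\<And>x. x \<in> {-1..1} \<Longrightarrow> \<bar>f x - g x\<bar> < e / (2 * T)"
      using Stone_Weierstrass_real_polynomial_function[of "{-1..1::real}" f "e / (2 * T)"]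
        continuous_on_subset[OF f] e T by auto
    obtain a n where g': "g = (\<lambda>x. \<Sum>i\<le>n. a i * x ^ i)"
      using g(1) real_polynomial_function_iff_sum by auto
    have gc: "continuous_on UNIV g" unfolding g' by (intro continuous_intros)
    have *: "\<bar>(\<integral>x. f x \<partial>K) - (\<integral>x. g x \<partial>K)\<bar> \<le> e / (2 * T) * measure K UNIV"
      if K: "finite_measure K" "sets K = sets borel" "AE x in K. x \<in> {-1..1}" for K
    proof -
      interpret finite_measure K by fact
      have sp: "space K = UNIV" using K sets_eq_imp_space_eq by fastforce
      have "\<bar>(\<integral>x. f x \<partial>K) - (\<integral>x. g x \<partial>K)\<bar> = \<bar>\<integral>x. f x - g x \<partial>K\<bar>"
        using int[OF K f] int[OF K gc] by simp
      also have "\<dots> \<le> (\<integral>x. \<bar>f x - g x\<bar> \<partial>K)" by (rule integral_abs_bound)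
      also have "\<dots> \<le> (\<integral>x. e / (2 * T) \<partial>K)"
        using int[OF K f] int[OF K gc]
        by (intro integral_mono_AE eventually_mono[OF K(3)]) (auto intro!: less_imp_le[OF g(2)])
      finally show ?thesis by (simp add: sp mult.commute)
    qed
    have "(\<integral>x. g x \<partial>M) = (\<integral>x. g x \<partial>N)" unfolding g' by (rule poly)
    then have "e \<le> \<bar>(\<integral>x. f x \<partial>M) - (\<integral>x. g x \<partial>M)\<bar> + \<bar>(\<integral>x. f x \<partial>N) - (\<integral>x. g x \<partial>N)\<bar>"
      unfolding e_def by linarith
    also have "\<dots> \<le> e / (2 * T) * measure M UNIV + e / (2 * T) * measure N UNIV"
      by (rule add_mono[OF *[OF M.finite_measure_axioms s(1) M] *[OF N.finite_measure_axioms s(2) N]])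
    finally have "e \<le> e / (2 * T) * measure M UNIV + e / (2 * T) * measure N UNIV" .
    also have "\<dots> \<le> e / (2 * T) * T"
      using e T by (subst distrib_left[symmetric], intro mult_left_mono) (auto simp: T_def)
    also have "\<dots> = e / 2" using T by simp
    finally show False using e by simp
  qed
  show ?thesis
  proof (rule measure_eqI_lessThan[OF s])
    fix a :: real
    define f where "f k x = min 1 (max 0 (real k * (x - a)))" for k and x :: real
    have lim: "(\<lambda>k. \<integral>x. f k x \<partial>K) \<longlonglongrightarrow> measure K {a<..}" if K: "finite_measure K" "sets K = sets borel" for K
    proof -
      interpret finite_measure K by fact
      have m: "f k \<in> borel_measurable borel" for k
        unfolding f_def by (intro borel_measurable_continuous_onI continuous_intros)
      have "(\<lambda>k. \<integral>x. f k x \<partial>K) \<longlonglongrightarrow> (\<integral>x. indicator {a<..} x \<partial>K)"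
      proof (rule integral_dominated_convergence[where w="\<lambda>x. 1"])
        show "AE x in K. (\<lambda>k. f k x) \<longlonglongrightarrow> indicator {a<..} x"
        proof (rule AE_I2)
          fix x
          show "(\<lambda>k. f k x) \<longlonglongrightarrow> indicator {a<..} x"
          proof (cases "x > a")
            case True
            obtain k0 where "real k0 * (x - a) > 1" using True ex_less_of_nat_mult[of "x - a" 1] by auto
            moreover have "real k0 * (x - a) \<le> real k * (x - a)" if "k \<ge> k0" for k
              using that True by (intro mult_right_mono) auto
            ultimately have "f k x = 1" if "k \<ge> k0" for k
              using that unfolding f_def by (smt (verit))
            then have "eventually (\<lambda>k. f k x = 1) sequentially"
              by (auto simp: eventually_sequentially)
            then show ?thesis using True by (simp add: tendsto_eventually)
          next
            case False
            then have "f k x = 0" for k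
              by (simp add: f_def mult_nonneg_nonpos)
            then show ?thesis using False by simp
          qed
        qed
        show "AE x in K. norm (f k x) \<le> 1" for k by (simp add: f_def)
      qed (use m K measurable_cong_sets in auto)
      also have "(\<integral>x. indicator {a<..} x \<partial>K) = measure K {a<..}"
        using K sets_eq_imp_space_eq[OF K(2)] by simp
      finally show ?thesis .
    qed
    have "measure M {a<..} = measure N {a<..}"
    proof (rule LIMSEQ_unique[OF lim[OF M.finite_measure_axioms s(1)]])
      have "(\<integral>x. f k x \<partial>M) = (\<integral>x. f k x \<partial>N)" for k
        by (rule cont) (auto simp: f_def intro!: continuous_intros)
      then show "(\<lambda>k. \<integral>x. f k x \<partial>M) \<longlonglongrightarrow> measure N {a<..}"
        using lim[OF N.finite_measure_axioms s(2)] by simp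
    qed
    then show "emeasure M {a<..} = emeasure N {a<..}"
      by (simp add: M.emeasure_eq_measure N.emeasure_eq_measure)
    show "emeasure M {a<..} < \<infinity>" using M.emeasure_finite[of "{a<..}"] by (simp add: less_top[symmetric])
  qed
qed

lemma represents_unique:
  assumes "weight \<mu> M" "represents \<mu> M \<Psi>" "weight \<mu>' M'" "represents \<mu>' M' \<Psi>'"
    and mom: "\<And>k i j. (\<integral>x. x ^ k * M x $ i $ j \<partial>\<mu>) = (\<integral>x. x ^ k * M' x $ i $ j \<partial>\<mu>')"
  shows "\<Psi> = \<Psi>'"
proof -
  have fin: "finite_measure (quad_measure \<Psi> v)" "sets (quad_measure \<Psi> v) = sets borel"
    "A \<in> sets borel \<Longrightarrow> emeasure (quad_measure \<Psi> v) A = ennreal (v \<bullet> (\<Psi> A *v v))"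
    "AE x in quad_measure \<Psi> v. x \<in> {-1..1}"
    "(\<integral>x. x ^ k \<partial>quad_measure \<Psi> v) = (\<Sum>i\<in>UNIV. \<Sum>j\<in>UNIV. v $ i * v $ j * (\<integral>x. x ^ k * M x $ i $ j \<partial>\<mu>))"
    if R: "weight \<mu> M" "represents \<mu> M \<Psi>" for \<mu> M \<Psi> v k A
  proof -
    interpret weight \<mu> M by fact
    have nn: "\<forall>X. pos_semidef X \<longrightarrow> 0 \<le> v \<bullet> (X *v v)" for v
      by (auto simp: pos_semidef_iff)
    note q = emeasure_linear_matrix_measure[OF represents_matrix_measure[OF R(2)] bilin_mat nn, folded quad_measure_def]
    show "finite_measure (quad_measure \<Psi> v)" "sets (quad_measure \<Psi> v) = sets borel"
     "A \<in> sets borel \<Longrightarrow> emeasure (quad_measure \<Psi> v) A = ennreal (v \<bullet> (\<Psi> A *v v))"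
      using q by auto
    note m = borel_measurable_integrable[OF integrable_bounded_linear[OF bilin_mat integrable_M]]
    have m': "(\<lambda>x. ennreal (v \<bullet> (M x *v v))) \<in> borel_measurable \<mu>" using m by simp
    show "AE x in quad_measure \<Psi> v. x \<in> {-1..1}"
      unfolding quad_measure_eq_density[OF R(2)] AE_density[OF m']
      by (rule eventually_mono[OF supp]) auto
    have "(\<integral>x. x ^ k \<partial>quad_measure \<Psi> v) = (\<integral>x. (v \<bullet> (M x *v v)) *\<^sub>R x ^ k \<partial>\<mu>)"
      unfolding quad_measure_eq_density[OF R(2)]
      by (intro integral_density m bdd_borel_measurable bdd_borel_continuous continuous_intros eventually_mono[OF psd])
        (auto simp: pos_semidef_iff)
    also have "\<dots> = (\<integral>x. (\<Sum>i\<in>UNIV. \<Sum>j\<in>UNIV. v $ i * v $ j * (x ^ k * M x $ i $ j)) \<partial>\<mu>)"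
      by (intro Bochner_Integration.integral_cong) (auto simp: inner_mat_2 sum_2 algebra_simps)
    also have "\<dots> = (\<Sum>i\<in>UNIV. \<Sum>j\<in>UNIV. v $ i * v $ j * (\<integral>x. x ^ k * M x $ i $ j \<partial>\<mu>))"
      by (subst Bochner_Integration.integral_sum
         , (intro Bochner_Integration.integrable_sum integrable_mult_right integrable_entry bdd_borel_continuous continuous_intros)
         , subst Bochner_Integration.integral_sum
         , (intro integrable_mult_right integrable_entry bdd_borel_continuous continuous_intros)) simp
    finally show "(\<integral>x. x ^ k \<partial>quad_measure \<Psi> v) = (\<Sum>i\<in>UNIV. \<Sum>j\<in>UNIV. v $ i * v $ j * (\<integral>x. x ^ k * M x $ i $ j \<partial>\<mu>))" .
  qed
  note f1 = fin[OF assms(1,2)] and f2 = fin[OF assms(3,4)]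
  have q: "quad_measure \<Psi> v = quad_measure \<Psi>' v" for v
    by (rule measure_eq_of_moments[OF f1(1) f2(1) f1(2) f2(2) f1(4) f2(4)]) (simp add: f1(5) f2(5) mom)
  show ?thesis
  proof
    fix A
    show "\<Psi> A = \<Psi>' A"
    proof (cases "A \<in> sets borel")
      case A: True
      have p: "pos_semidef (\<Psi> A)" "pos_semidef (\<Psi>' A)"
        using A assms(2,4)[THEN represents_matrix_measure] by (auto simp: matrix_measure_def)
      have e: "v \<bullet> (\<Psi> A *v v) = v \<bullet> (\<Psi>' A *v v)" for v
        using f1(3)[OF A, of v] f2(3)[OF A, of v] p by (simp add: q pos_semidef_iff)
      have "\<Psi> A $ i $ i = \<Psi>' A $ i $ i" for i
        using e[of "axis i 1"] by (simp add: inner_axis_mat)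
      moreover have "\<Psi> A $ 1 $ 2 = \<Psi>' A $ 1 $ 2"
        using e[of "axis 1 1 + axis 2 1"] p calculation
        by (simp add: inner_mat_2 axis_def pos_semidef_iff)
      ultimately show ?thesis using p by (auto simp: vec_eq_iff forall_2 pos_semidef_iff)
    qed (use assms in \<open>auto simp: represents_def\<close>)
  qed
qed


section \<open>Perturbations of the constant recurrence\<close>

text \<open>
  For \<open>a = 1/4\<close>, \<open>b = 1/2\<close>, \<open>d = 0\<close> and \<open>2 x - 1 = cos \<theta>\<close> the recurrence reads
  \<open>u (n + 2) + u n = 2 cos \<theta> u (n + 1)\<close>, and \<open>Z n = u (n + 1) - exp (\<i> \<theta>) u n\<close> is multiplied by
  \<open>exp (- \<i> \<theta>)\<close> in each step, so that its modulus is constant. Since \<open>Im (Z n) = - sin \<theta> u n\<close> and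
  \<open>sin \<theta>\<close> is bounded below on \<open>[\<delta>, 1 - \<delta>]\<close>, the modulus of \<open>Z n\<close> controls \<open>u n\<close> and \<open>u (n + 1)\<close>. A summable
  perturbation of \<open>a\<close> and \<open>b\<close> multiplies it by at most \<open>1 + \<epsilon> n\<close> with summable \<open>\<epsilon>\<close>. The inhomogeneity \<open>d\<close>
  is there for the difference of the solutions at two nearby points.
\<close>

lemma transfer_bound:
  fixes a b :: "nat \<Rightarrow> real" and \<delta> :: real
  assumes a_pos: "\<And>n. 0 < a n" and a: "summable (\<lambda>n. \<bar>a n - 1/4\<bar>)" and b: "summable (\<lambda>n. \<bar>b n - 1/2\<bar>)"
    and \<delta>: "0 < \<delta>" "\<delta> < 1/2"
  obtains D where "0 < D" "\<And>x u d n. \<delta> \<le> x \<Longrightarrow> x \<le> 1 - \<delta> \<Longrightarrow>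
    (\<And>n. a (Suc n) * u (Suc (Suc n)) + b (Suc n) * u (Suc n) + a n * u n = x * u (Suc n) + d n) \<Longrightarrow>
    \<bar>u n\<bar> \<le> D * (\<bar>u 0\<bar> + \<bar>u 1\<bar> + (\<Sum>k<n. \<bar>d k\<bar>))"
proof -
  have lim: "a \<longlonglongrightarrow> 1/4"
    using summable_LIMSEQ_zero[OF a] by (simp add: tendsto_rabs_zero_iff LIM_zero_iff)
  obtain m where m: "0 < m" "\<And>n. m \<le> a n"
  proof -
    have "eventually (\<lambda>n. a n > 1/8) sequentially" using lim by (rule order_tendstoD) simp
    then obtain N where N: "\<And>n. n \<ge> N \<Longrightarrow> a n > 1/8" by (auto simp: eventually_sequentially)
    define m where "m = Min (insert (1/8) (a ` {..<N}))"
    have "0 < m" unfolding m_def using a_pos by (subst Min_gr_iff) auto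
    moreover have "m \<le> a n" for n
    proof (cases "n < N")
      case True then show ?thesis unfolding m_def by (intro Min_le) auto
    next
      case False
      have "m \<le> 1/8" unfolding m_def by (intro Min_le) auto
      then show ?thesis using N[of n] False by simp
    qed
    ultimately show thesis using that by blast
  qed
  define s where "s = sqrt (1 - (1 - 2 * \<delta>)\<^sup>2)"
  have "\<bar>1 - 2 * \<delta>\<bar> < 1" using \<delta> by (simp add: abs_less_iff)
  then have "(1 - 2 * \<delta>)\<^sup>2 < 1" by (simp add: abs_square_less_1)
  then have s: "0 < s" by (simp add: s_def)
  define E where "E = (16 / (4 * m)) * (1 + 1 / s)"
  define \<epsilon> where "\<epsilon> n = E * (\<bar>a (Suc n) - 1/4\<bar> + \<bar>a n - 1/4\<bar> + \<bar>b (Suc n) - 1/2\<bar>)" for n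
  have E: "0 < E" using m s by (simp add: E_def add_pos_pos)
  have \<epsilon>: "0 \<le> \<epsilon> n" for n using E by (simp add: \<epsilon>_def)
  have "summable \<epsilon>" unfolding \<epsilon>_def
    using a b summable_Suc_iff[of "\<lambda>n. \<bar>a n - 1/4\<bar>"] summable_Suc_iff[of "\<lambda>n. \<bar>b n - 1/2\<bar>"]
    by (intro summable_mult summable_add) auto
  then have \<epsilon>_sum: "(\<Sum>k<n. \<epsilon> k) \<le> suminf \<epsilon>" for n
    using \<epsilon> by (intro sum_le_suminf) auto
  define D where "D = exp (suminf \<epsilon>) / s * (1 + 1 / m)"
  show thesis
  proof (rule that)
    show "0 < D" using s m by (simp add: D_def add_pos_pos)
    fix x n and u d :: "nat \<Rightarrow> real"
    assume x: "\<delta> \<le> x" "x \<le> 1 - \<delta>"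
      and rec: "\<And>n. a (Suc n) * u (Suc (Suc n)) + b (Suc n) * u (Suc n) + a n * u n = x * u (Suc n) + d n"
    define c where "c = 2 * x - 1"
    define \<sigma> where "\<sigma> = sqrt (1 - c\<^sup>2)"
    have "\<bar>c\<bar> \<le> 1 - 2 * \<delta>" using x by (auto simp: c_def abs_le_iff)
    then have c2: "c\<^sup>2 \<le> (1 - 2 * \<delta>)\<^sup>2" using power_mono[of "\<bar>c\<bar>" "1 - 2 * \<delta>" 2] by simp
    then have \<sigma>: "s \<le> \<sigma>" by (simp add: s_def \<sigma>_def)
    have \<sigma>2: "\<sigma>\<^sup>2 = 1 - c\<^sup>2" using c2 \<open>(1 - 2 * \<delta>)\<^sup>2 < 1\<close> by (simp add: \<sigma>_def)
    \<comment> \<open>\<open>\<omega> = exp (\<i> \<theta>)\<close> with \<open>c = cos \<theta>\<close> and \<open>\<sigma> = sin \<theta>\<close>.\<close>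
    define \<omega> where "\<omega> = Complex c \<sigma>"
    have \<omega>: "cmod (cnj \<omega>) = 1" by (simp add: \<omega>_def cmod_def \<sigma>2)
    have \<omega>\<omega>: "cnj \<omega> * \<omega> = 1" by (simp add: \<omega>_def complex_eq_iff \<sigma>2 flip: power2_eq_square)
    have \<omega>_add: "\<omega> + cnj \<omega> = of_real (2 * c)" by (simp add: \<omega>_def complex_eq_iff)
    define Z where "Z n = of_real (u (Suc n)) - \<omega> * of_real (u n)" for n
    define \<rho> where "\<rho> n = u (Suc (Suc n)) - 2 * c * u (Suc n) + u n" for n
    have Zrec: "Z (Suc n) = cnj \<omega> * Z n + of_real (\<rho> n)" for n
    proof -
      have "of_real (\<rho> n) = of_real (u (Suc (Suc n))) - (\<omega> + cnj \<omega>) * of_real (u (Suc n)) + (cnj \<omega> * \<omega>) * of_real (u n)"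
        unfolding \<omega>_add \<omega>\<omega> by (simp add: \<rho>_def)
      then show ?thesis by (simp add: Z_def algebra_simps)
    qed
    have u_le: "\<bar>u n\<bar> \<le> cmod (Z n) / s" for n
    proof -
      have "s * \<bar>u n\<bar> \<le> \<sigma> * \<bar>u n\<bar>" using \<sigma> by (simp add: mult_right_mono)
      also have "\<dots> = \<bar>Im (Z n)\<bar>" using \<sigma> s by (simp add: Z_def \<omega>_def abs_mult)
      also have "\<dots> \<le> cmod (Z n)" by (rule abs_Im_le_cmod)
      finally show ?thesis using s by (simp add: field_simps)
    qed
    have u_le': "\<bar>u n\<bar> \<le> (1 + 1 / s) * cmod (Z n)" for n
      using u_le[of n] by (simp add: algebra_simps add_increasing)
    have uS_le: "\<bar>u (Suc n)\<bar> \<le> (1 + 1 / s) * cmod (Z n)" for n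
    proof -
      have "complex_of_real (u (Suc n)) = Z n + \<omega> * of_real (u n)" by (simp add: Z_def)
      then have "\<bar>u (Suc n)\<bar> \<le> cmod (Z n) + cmod (\<omega> * of_real (u n))"
        by (metis norm_of_real norm_triangle_ineq)
      then show ?thesis using u_le[of n] \<omega> by (simp add: norm_mult algebra_simps)
    qed
    have \<rho>_le: "\<bar>\<rho> n\<bar> \<le> \<epsilon> n * cmod (Z n) + \<bar>d n\<bar> / m" for n
    proof -
      let ?a = "\<bar>a n - 1/4\<bar>" and ?a' = "\<bar>a (Suc n) - 1/4\<bar>" and ?b = "\<bar>b (Suc n) - 1/2\<bar>"
      let ?R = "(1 + 1 / s) * cmod (Z n)"
      have R: "0 \<le> ?R" using s by (simp add: add_nonneg_nonneg)
      have eq: "4 * a (Suc n) * \<rho> n = (- 8 * c * (a (Suc n) - 1/4) - 4 * (b (Suc n) - 1/2)) * u (Suc n)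
          + (4 * (a (Suc n) - 1/4) - 4 * (a n - 1/4)) * u n + 4 * d n"
        using rec[of n] unfolding \<rho>_def c_def by algebra
      have c1: "\<bar>c\<bar> \<le> 1" using \<open>\<bar>c\<bar> \<le> 1 - 2 * \<delta>\<close> \<delta> by simp
      have c8: "\<bar>8 * c * (a (Suc n) - 1/4)\<bar> \<le> 8 * ?a'"
        using c1 mult_right_mono[OF c1, of "8 * ?a'"] by (simp add: abs_mult)
      have c8': "\<bar>- 8 * c * (a (Suc n) - 1/4) - 4 * (b (Suc n) - 1/2)\<bar> \<le> 8 * ?a' + 4 * ?b"
      proof (rule order_trans[OF abs_triangle_ineq4 add_mono])
        show "\<bar>- 8 * c * (a (Suc n) - 1/4)\<bar> \<le> 8 * ?a'" using c8 by (simp add: abs_mult)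
        show "\<bar>4 * (b (Suc n) - 1/2)\<bar> \<le> 4 * ?b" unfolding abs_mult by simp
      qed
      have t1: "\<bar>(- 8 * c * (a (Suc n) - 1/4) - 4 * (b (Suc n) - 1/2)) * u (Suc n)\<bar> \<le> (8 * ?a' + 4 * ?b) * ?R"
        unfolding abs_mult[of _ "u _"] by (intro mult_mono c8' uS_le) auto
      have c4: "\<bar>4 * (a (Suc n) - 1/4) - 4 * (a n - 1/4)\<bar> \<le> 4 * ?a' + 4 * ?a"
        using abs_triangle_ineq4[of "4 * (a (Suc n) - 1/4)" "4 * (a n - 1/4)"] unfolding abs_mult by simp
      have t2: "\<bar>(4 * (a (Suc n) - 1/4) - 4 * (a n - 1/4)) * u n\<bar> \<le> (4 * ?a' + 4 * ?a) * ?R"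
        unfolding abs_mult[of _ "u _"] by (intro mult_mono c4 u_le') auto
      have "4 * m * \<bar>\<rho> n\<bar> \<le> \<bar>4 * a (Suc n) * \<rho> n\<bar>"
        using m[of] a_pos[of "Suc n"] by (simp add: abs_mult mult_right_mono)
      also have "\<dots> \<le> (8 * ?a' + 4 * ?b) * ?R + (4 * ?a' + 4 * ?a) * ?R + 4 * \<bar>d n\<bar>"
        unfolding eq using t1 t2 by linarith
      also have "\<dots> = (12 * ?a' + 4 * ?a + 4 * ?b) * ?R + 4 * \<bar>d n\<bar>" by algebra
      also have "\<dots> \<le> (16 * ?a' + 16 * ?a + 16 * ?b) * ?R + 4 * \<bar>d n\<bar>"
        using R by (intro add_right_mono mult_right_mono) auto
      finally show ?thesis using m s by (simp add: \<epsilon>_def E_def field_simps)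
    qed
    have step: "cmod (Z (Suc n)) \<le> (1 + \<epsilon> n) * cmod (Z n) + \<bar>d n\<bar> / m" for n
    proof -
      have "cmod (Z (Suc n)) \<le> cmod (cnj \<omega> * Z n) + cmod (of_real (\<rho> n))"
        unfolding Zrec by (rule norm_triangle_ineq)
      then show ?thesis using \<rho>_le[of n] \<omega> by (simp add: norm_mult algebra_simps)
    qed
    have Zn: "cmod (Z n) \<le> exp (\<Sum>k<n. \<epsilon> k) * (cmod (Z 0) + (\<Sum>k<n. \<bar>d k\<bar> / m))" for n
    proof (induction n)
      case (Suc n)
      let ?e = "exp (\<Sum>k<n. \<epsilon> k)" and ?S = "cmod (Z 0) + (\<Sum>k<n. \<bar>d k\<bar> / m)"
      have e1: "1 \<le> ?e * exp (\<epsilon> n)"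
        using \<epsilon> by (simp add: sum_nonneg add_nonneg_nonneg flip: exp_add)
      have S: "0 \<le> ?S" using m by (intro add_nonneg_nonneg sum_nonneg) auto
      have "cmod (Z (Suc n)) \<le> (1 + \<epsilon> n) * (?e * ?S) + \<bar>d n\<bar> / m"
        using step[of n] mult_left_mono[OF Suc, of "1 + \<epsilon> n"] \<epsilon>[of n] by linarith
      also have "\<dots> \<le> exp (\<epsilon> n) * (?e * ?S) + (?e * exp (\<epsilon> n)) * (\<bar>d n\<bar> / m)"
        using e1 m S mult_right_mono[OF e1, of "\<bar>d n\<bar> / m"]
        by (intro add_mono mult_right_mono exp_ge_add_one_self) auto
      also have "\<dots> = exp (\<Sum>k<Suc n. \<epsilon> k) * (cmod (Z 0) + (\<Sum>k<Suc n. \<bar>d k\<bar> / m))"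
        by (simp add: exp_add algebra_simps)
      finally show ?case .
    qed simp
    have "cmod (Z 0) \<le> \<bar>u 0\<bar> + \<bar>u 1\<bar>"
      using norm_triangle_ineq4[of "of_real (u 1)" "\<omega> * of_real (u 0)"] \<omega> by (simp add: Z_def norm_mult)
    then have "cmod (Z n) \<le> exp (suminf \<epsilon>) * (\<bar>u 0\<bar> + \<bar>u 1\<bar> + (\<Sum>k<n. \<bar>d k\<bar> / m))"
      using \<epsilon>_sum[of n] m by (intro order_trans[OF Zn] mult_mono add_mono add_nonneg_nonneg sum_nonneg) auto
    also have "\<dots> \<le> exp (suminf \<epsilon>) * ((1 + 1 / m) * (\<bar>u 0\<bar> + \<bar>u 1\<bar> + (\<Sum>k<n. \<bar>d k\<bar>)))"
    proof -
      define S where "S = (\<Sum>k<n. \<bar>d k\<bar>)"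
      have S: "(\<Sum>k<n. \<bar>d k\<bar> / m) = S / m" by (simp add: S_def sum_divide_distrib)
      have "0 \<le> S" unfolding S_def by (rule sum_nonneg) simp
      then have "1 * (\<bar>u 0\<bar> + \<bar>u 1\<bar>) + S / m \<le> (1 + 1 / m) * (\<bar>u 0\<bar> + \<bar>u 1\<bar>) + (1 + 1 / m) * S"
        using m by (intro add_mono mult_right_mono) (auto simp: distrib_right)
      then have "\<bar>u 0\<bar> + \<bar>u 1\<bar> + S / m \<le> (1 + 1 / m) * (\<bar>u 0\<bar> + \<bar>u 1\<bar> + S)"
        by (simp only: distrib_left mult_1)
      then show ?thesis unfolding S S_def[symmetric] by (rule mult_left_mono) simp
    qed
    finally have "cmod (Z n) / s \<le> exp (suminf \<epsilon>) * ((1 + 1 / m) * (\<bar>u 0\<bar> + \<bar>u 1\<bar> + (\<Sum>k<n. \<bar>d k\<bar>))) / s"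
      using s by (simp add: divide_right_mono)
    then show "\<bar>u n\<bar> \<le> D * (\<bar>u 0\<bar> + \<bar>u 1\<bar> + (\<Sum>k<n. \<bar>d k\<bar>))"
      using u_le[of n] by (simp add: D_def)
  qed
qed

section \<open>Absolute continuity from bounded solutions\<close>

text \<open>
  An open set of small Lebesgue measure containing \<open>A\<close> is the disjoint union of its components, which
  are intervals, and on intervals \<open>N\<close> is bounded by \<open>C\<close> times the length.
\<close>

lemma null_set_of_lipschitz:
  fixes N :: "real measure"
  assumes N: "finite_measure N" "sets N = sets borel" and "c < d" "0 \<le> C"
    and lip: "\<And>a b. c \<le> a \<Longrightarrow> a < b \<Longrightarrow> b \<le> d \<Longrightarrow> measure N {a..b} \<le> C * (b - a)"
    and A: "A \<in> null_sets lborel" "A \<subseteq> {c<..<d}"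
  shows "emeasure N A = 0"
proof -
  interpret finite_measure N by fact
  have lip': "emeasure N S \<le> C * emeasure lborel S" if S: "open S" "connected S" "S \<subseteq> {c<..<d}" for S
  proof (cases "S = {}")
    case False
    let ?a = "Inf S" and ?b = "Sup S"
    have bd: "bdd_below S" "bdd_above S" using S(3) by (auto intro!: bdd_belowI[of _ c] bdd_aboveI[of _ d])
    have sub: "S \<subseteq> {?a..?b}" using bd by (auto intro: cInf_lower cSup_upper)
    have sup: "{?a<..<?b} \<subseteq> S"
    proof
      fix z assume "z \<in> {?a<..<?b}"
      then obtain l u where "l \<in> S" "l < z" "u \<in> S" "z < u"
        using cInf_less_iff[OF False bd(1)] less_cSup_iff[OF False bd(2)] by auto
      then show "z \<in> S" using S(2) connected_contains_Icc[of S l u] by auto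
    qed
    have ca: "c \<le> ?a" "?b \<le> d" using S(3) False
      by (auto intro!: cInf_greatest cSup_least)
    have ab: "?a < ?b"
    proof -
      obtain z where z: "z \<in> S" using False by auto
      then obtain e where "e > 0" "ball z e \<subseteq> S" using S(1) open_contains_ball by blast
      then have "z + e / 2 \<in> S" by (auto simp: dist_real_def)
      then have "?a \<le> z" "z + e / 2 \<le> ?b" using z sub by auto
      then show ?thesis using \<open>e > 0\<close> by linarith
    qed
    have "emeasure N S \<le> emeasure N {?a..?b}" using sub N by (intro emeasure_mono) auto
    also have "\<dots> \<le> ennreal (C * (?b - ?a))"
      using lip[OF ca(1) ab ca(2)] by (simp add: emeasure_eq_measure ennreal_leI)
    also have "\<dots> = C * emeasure lborel {?a<..<?b}" using ab \<open>0 \<le> C\<close> by (simp add: ennreal_mult)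
    also have "\<dots> \<le> C * emeasure lborel S" using sup S(1) by (intro mult_left_mono emeasure_mono) auto
    finally show ?thesis .
  qed simp
  have "emeasure N A \<le> ennreal (C * e)" if e: "e > 0" for e
  proof -
    have bA: "A \<in> sets borel" using A by auto
    obtain U where U: "open U" "A \<subseteq> U" "emeasure lborel (U - A) < e"
      using outer_regular_lborel[OF bA e] by blast
    define U' where "U' = U \<inter> {c<..<d}"
    have U': "open U'" "A \<subseteq> U'" using U A by (auto simp: U'_def)
    have "emeasure lborel U' \<le> emeasure lborel ((U - A) \<union> A)"
      using U bA by (intro emeasure_mono) (auto simp: U'_def)
    also have "\<dots> \<le> emeasure lborel (U - A) + emeasure lborel A"
      using U bA by (intro emeasure_subadditive) auto
    also have "\<dots> \<le> e" using U(3) A by (auto simp: null_sets_def)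
    finally have lU: "emeasure lborel U' \<le> e" .
    let ?D = "components U'"
    have D: "countable ?D" "disjoint_family_on (\<lambda>S. S) ?D" "\<And>S. S \<in> ?D \<Longrightarrow> open S" "\<Union>?D = U'"
      using countable_disjoint_open_subsets[OF open_components[OF U'(1)] pairwise_disjoint_components[of U', folded disjnt_def]] pairwise_disjoint_components[of U'] open_components[OF U'(1)] Union_components
      by (auto simp: disjoint_family_on_def pairwise_def disjnt_def)
    have sum: "emeasure K U' = (\<integral>\<^sup>+S. emeasure K S \<partial>count_space ?D)" if "sets K = sets borel" for K :: "real measure"
      using emeasure_UN_countable[of ?D "\<lambda>S. S" K] D that by auto
    have "emeasure N A \<le> emeasure N U'" using U' N by (intro emeasure_mono) auto
    also have "\<dots> = (\<integral>\<^sup>+S. emeasure N S \<partial>count_space ?D)" by (rule sum[OF N(2)])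
    also have "\<dots> \<le> (\<integral>\<^sup>+S. C * emeasure lborel S \<partial>count_space ?D)"
      using D(3) in_components_connected in_components_subset[of _ U']
      by (intro nn_integral_mono lip') (auto simp: U'_def)
    also have "\<dots> = C * emeasure lborel U'" by (subst nn_integral_cmult) (auto simp: sum)
    also have "\<dots> \<le> C * ennreal e" using lU by (intro mult_left_mono) auto
    finally show ?thesis using \<open>0 \<le> C\<close> e by (simp add: ennreal_mult)
  qed
  then have le: "measure N A \<le> C * e" if "e > 0" for e
    using that \<open>0 \<le> C\<close> by (simp add: emeasure_eq_measure)
  have "measure N A \<le> 0"
  proof (rule field_le_epsilon)
    fix e :: real assume "e > 0"
    then have "measure N A \<le> C * (e / (C + 1))" using \<open>0 \<le> C\<close> by (intro le) auto
    also have "\<dots> \<le> e" using \<open>0 \<le> C\<close> \<open>e > 0\<close> by (simp add: field_simps)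
    finally show "measure N A \<le> 0 + e" by simp
  qed
  then have "measure N A = 0" using measure_nonneg[of N A] by linarith
  then show ?thesis unfolding emeasure_eq_measure by simp
qed


context weight
begin

definition mass :: "real set \<Rightarrow> real^2^2" where
  "mass A = (LINT x:A|\<mu>. M x)"

lemma integrable_mass: "A \<in> sets borel \<Longrightarrow> integrable \<mu> (\<lambda>x. indicator A x *\<^sub>R M x)"
  using integrable_scaleR_M[OF bdd_borel_indicator] .

lemma inner_mass:
  assumes "A \<in> sets borel"
  shows "v \<bullet> (mass A *v u) = (\<integral>x. indicator A x * (v \<bullet> (M x *v u)) \<partial>\<mu>)"
  unfolding mass_def set_lebesgue_integral_def
  using integral_bounded_linear[OF bilin_mat integrable_mass[OF assms], of v u]
  by (simp add: scaleR_matrix_vector_assoc[symmetric])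

lemma mass_psd: assumes "A \<in> sets borel" shows "pos_semidef (mass A)"
  unfolding pos_semidef_iff
proof
  have "axis 1 1 \<bullet> (mass A *v axis 2 1) = axis 2 1 \<bullet> (mass A *v axis 1 1)"
    unfolding inner_mass[OF assms]
    using integrable_form[OF bdd_borel_scaleR[OF bdd_borel_indicator[OF assms] bdd_borel_const] bdd_borel_const]
    by (intro integral_cong_AE eventually_mono[OF psd] borel_measurable_integrable)
      (auto intro: pos_semidef_inner_commute)
  then show "mass A $ 1 $ 2 = mass A $ 2 $ 1" by (simp add: inner_axis_mat)
  show "\<forall>v. 0 \<le> v \<bullet> (mass A *v v)"
    unfolding inner_mass[OF assms]
    by (intro allI integral_nonneg_AE eventually_mono[OF psd]) (auto simp: pos_semidef_iff)
qed

lemma B_indicator: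
  assumes "A \<in> sets borel"
  shows "B (\<lambda>x. indicator A x *\<^sub>R v) (\<lambda>x. indicator A x *\<^sub>R v) = v \<bullet> (mass A *v v)"
  unfolding B_def inner_mass[OF assms]
  by (intro Bochner_Integration.integral_cong) (auto simp: indicator_def)

end

context ortho_chain
begin

text \<open>
  For \<open>f = indicator {y} *\<^sub>R u\<close> the Fourier coefficient \<open>B f (V n)\<close> is \<open>V n y \<bullet> (mass {y} *v u)\<close>. By Bessel's
  inequality the solution of the recurrence at \<open>y\<close> with initial data \<open>mass {y} *v u\<close> is square summable.
\<close>

lemma atom_free:
  assumes "\<And>v. v \<noteq> 0 \<Longrightarrow> \<not> summable (\<lambda>n. w (int n) * (V (int n) y \<bullet> v)\<^sup>2)"
  shows "mass {y} = 0"
proof -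
  have sv: "mass {y} *v u = 0" for u
  proof (rule ccontr)
    let ?f = "\<lambda>x. indicator {y} x *\<^sub>R u"
    have f: "bdd_borel ?f" by (intro bdd_borel_scaleR bdd_borel_indicator bdd_borel_const) simp
    assume "mass {y} *v u \<noteq> 0"
    moreover have "summable (\<lambda>n. w (int n) * (V (int n) y \<bullet> (mass {y} *v u))\<^sup>2)"
    proof (rule summableI_nonneg_bounded)
      fix n
      have B: "B ?f (V k) = V k y \<bullet> (mass {y} *v u)" for k
      proof -
        have "B ?f (V k) = (\<integral>x. indicator {y} x * (u \<bullet> (M x *v V k y)) \<partial>\<mu>)"
          unfolding B_def by (intro Bochner_Integration.integral_cong) (auto simp: indicator_def)
        then show ?thesis using pos_semidef_inner_commute[OF mass_psd, of "{y}"]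
          by (simp add: inner_mass)
      qed
      have "(\<Sum>i<n. w (int i) * (V (int i) y \<bullet> (mass {y} *v u))\<^sup>2) = (\<Sum>k\<in>int ` {..<n}. w k * (B ?f (V k))\<^sup>2)"
        by (simp add: sum.reindex B)
      also have "\<dots> \<le> B ?f ?f" by (rule bessel[OF f]) simp
      finally show "(\<Sum>i<n. w (int i) * (V (int i) y \<bullet> (mass {y} *v u))\<^sup>2) \<le> B ?f ?f" .
    qed (simp add: w_pos less_imp_le)
    ultimately show False using assms by blast
  qed
  then show ?thesis
    by (metis matrix_vector_mult_0 matrix_eq)
qed

lemma casoratian:
  "w (int n) * p (int n) * (V (int n) x $ 1 * V (int n + 1) x $ 2 - V (int n + 1) x $ 1 * V (int n) x $ 2) = - q 0"
proof (induction n)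
  case 0
  have "x *\<^sub>R V 0 x = p 0 *\<^sub>R V 1 x + r 0 *\<^sub>R V 0 x + q 0 *\<^sub>R V (-1) x" using V_rec[of x 0] by simp
  then have "p 0 * V 1 x $ 2 = - q 0"
    unfolding V_0 V_m1 by (auto simp: vec_eq_iff axis_def forall_2)
  then show ?case by (simp add: w_0 V_0 axis_def)
next
  case (Suc n)
  let ?n = "int n"
  have "x *\<^sub>R V (?n + 1) x = p (?n + 1) *\<^sub>R V (?n + 2) x + r (?n + 1) *\<^sub>R V (?n + 1) x + q (?n + 1) *\<^sub>R V ?n x"
    using V_rec[of x "?n + 1"] by (simp add: add.commute)
  then have e: "x * V (?n + 1) x $ i = p (?n + 1) * V (?n + 2) x $ i + r (?n + 1) * V (?n + 1) x $ i + q (?n + 1) * V ?n x $ i" for i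
    by (auto simp: vec_eq_iff)
  have "w (?n + 1) * p (?n + 1) * (V (?n + 1) x $ 1 * V (?n + 2) x $ 2 - V (?n + 2) x $ 1 * V (?n + 1) x $ 2)
     = w (?n + 1) * (V (?n + 1) x $ 1 * (p (?n + 1) * V (?n + 2) x $ 2) - (p (?n + 1) * V (?n + 2) x $ 1) * V (?n + 1) x $ 2)"
    by (simp add: algebra_simps)
  also have "\<dots> = (w (?n + 1) * q (?n + 1)) * (V ?n x $ 1 * V (?n + 1) x $ 2 - V (?n + 1) x $ 1 * V ?n x $ 2)"
  proof -
    have e': "p (?n + 1) * V (?n + 2) x $ i = (x - r (?n + 1)) * V (?n + 1) x $ i - q (?n + 1) * V ?n x $ i" for i
      using e[of i] by (simp add: algebra_simps)
    show ?thesis unfolding e' by algebra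
  qed
  also have "\<dots> = - q 0" unfolding w_Suc by (rule Suc)
  finally show ?case by (simp add: add.commute)
qed

end

text \<open>
  After multiplication by the square root of \<open>w\<close> the recurrence is symmetric, with off-diagonal entries
  \<open>sqrt (p n * q (n + 1))\<close>. It is a summable perturbation, in the direction \<open>n \<rightarrow> \<infinity>\<close>, of the recurrence
  with constant coefficients whose spectrum is \<open>[0, 1]\<close>.
\<close>

locale nevai_chain = ortho_chain +
  assumes summable_a: "summable (\<lambda>n::nat. \<bar>sqrt (p (int n) * q (int n + 1)) - 1/4\<bar>)"
    and summable_r: "summable (\<lambda>n::nat. \<bar>r (int n) - 1/2\<bar>)"
begin

definition u :: "2 \<Rightarrow> nat \<Rightarrow> real \<Rightarrow> real" where
  "u i n x = sqrt (w (int n)) * V (int n) x $ i"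

definition a :: "nat \<Rightarrow> real" where "a n = sqrt (p (int n) * q (int n + 1))"

lemma a_pos: "0 < a n"
  by (simp add: a_def p_pos q_pos)

lemma sqrt_w_mult_a: "a n * sqrt (w (int n)) = sqrt (w (int n + 1)) * q (int n + 1)"
  "a n * sqrt (w (int n + 1)) = sqrt (w (int n)) * p (int n)"
proof -
  let ?p = "p (int n)" and ?q = "q (int n + 1)"
  have "a n * sqrt (w (int n)) = sqrt (?q * (w (int n) * ?p))"
    by (simp add: a_def real_sqrt_mult[symmetric] mult_ac)
  also have "\<dots> = sqrt (w (int n + 1) * ?q\<^sup>2)"
    using w_Suc[of "int n"] by (simp add: power2_eq_square mult_ac)
  also have "\<dots> = sqrt (w (int n + 1)) * ?q" using q_pos[of "int n + 1"] by (simp add: real_sqrt_mult)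
  finally show "a n * sqrt (w (int n)) = sqrt (w (int n + 1)) * ?q" .
  have "a n * sqrt (w (int n + 1)) = sqrt (?p * (w (int n + 1) * ?q))"
    by (simp add: a_def real_sqrt_mult[symmetric] mult_ac)
  also have "\<dots> = sqrt (w (int n) * ?p\<^sup>2)" unfolding w_Suc by (simp add: power2_eq_square mult_ac)
  also have "\<dots> = sqrt (w (int n)) * ?p" using p_pos[of "int n"] by (simp add: real_sqrt_mult)
  finally show "a n * sqrt (w (int n + 1)) = sqrt (w (int n)) * ?p" .
qed

lemma u_rec: "a (Suc n) * u i (Suc (Suc n)) x + r (int (Suc n)) * u i (Suc n) x + a n * u i n x = x * u i (Suc n) x"
proof -
  have "(x *\<^sub>R V (int n + 1) x) $ i = (p (int n + 1) *\<^sub>R V (int n + 2) x + r (int n + 1) *\<^sub>R V (int n + 1) x + q (int n + 1) *\<^sub>R V (int n) x) $ i"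
    using V_rec[of x "int n + 1"] by (simp add: add.commute)
  then have e: "x * V (int n + 1) x $ i = p (int n + 1) * V (int n + 2) x $ i + r (int n + 1) * V (int n + 1) x $ i + q (int n + 1) * V (int n) x $ i"
    by simp
  have t1: "a (Suc n) * u i (Suc (Suc n)) x = sqrt (w (int n + 1)) * (p (int n + 1) * V (int n + 2) x $ i)"
  proof -
    have "a (Suc n) * u i (Suc (Suc n)) x = (a (Suc n) * sqrt (w (int (Suc n) + 1))) * V (int (Suc n) + 1) x $ i"
      by (simp add: u_def add.commute)
    also have "\<dots> = sqrt (w (int n + 1)) * (p (int n + 1) * V (int n + 2) x $ i)"
      unfolding sqrt_w_mult_a by (simp add: add.commute)
    finally show ?thesis .
  qed
  have t2: "a n * u i n x = sqrt (w (int n + 1)) * (q (int n + 1) * V (int n) x $ i)"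
    unfolding u_def mult.assoc[symmetric] sqrt_w_mult_a ..
  have t3: "u i (Suc n) x = sqrt (w (int n + 1)) * V (int n + 1) x $ i" "int (Suc n) = int n + 1"
    by (simp_all add: u_def add.commute)
  show ?thesis unfolding t1 t2 t3 using e by algebra
qed

text \<open>
  The difference of the solutions at \<open>x\<close> and \<open>y\<close> solves the recurrence at \<open>y\<close> with the inhomogeneity
  \<open>(x - y) * u i (n + 1) x\<close>, which is bounded by a multiple of \<open>\<bar>x - y\<bar>\<close>; summing \<open>n\<close> such terms gives the
  second bound.
\<close>

lemma u_bounds:
  assumes \<delta>: "0 < \<delta>" "\<delta> < 1/2"
  obtains C where "0 < C" "\<And>i n x. x \<in> {\<delta>..1 - \<delta>} \<Longrightarrow> \<bar>u i n x\<bar> \<le> C"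
    "\<And>i n x y. x \<in> {\<delta>..1 - \<delta>} \<Longrightarrow> y \<in> {\<delta>..1 - \<delta>} \<Longrightarrow> \<bar>u i n x - u i n y\<bar> \<le> C * (real n + 1) * \<bar>x - y\<bar>"
proof -
  obtain D where D: "0 < D" "\<And>x v d n. \<delta> \<le> x \<Longrightarrow> x \<le> 1 - \<delta> \<Longrightarrow>
    (\<And>n. a (Suc n) * v (Suc (Suc n)) + r (int (Suc n)) * v (Suc n) + a n * v n = x * v (Suc n) + d n) \<Longrightarrow>
    \<bar>v n\<bar> \<le> D * (\<bar>v 0\<bar> + \<bar>v 1\<bar> + (\<Sum>k<n. \<bar>d k\<bar>))"
    using transfer_bound[of a "\<lambda>n. r (int n)" \<delta>, OF a_pos summable_a[folded a_def] summable_r \<delta>] by metis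
  define k where "k = sqrt (w 1) / p 0"
  have k: "0 < k" using w_pos p_pos by (simp add: k_def)
  have V1: "V 1 x $ i = ((x - r 0) * axis 1 1 $ i - q 0 * axis 2 1 $ i) / p 0" for x i
  proof -
    have "(x *\<^sub>R V 0 x) $ i = (p 0 *\<^sub>R V 1 x + r 0 *\<^sub>R V 0 x + q 0 *\<^sub>R V (-1) x) $ i"
      using V_rec[of x 0] by simp
    then have "x * V 0 x $ i = p 0 * V 1 x $ i + r 0 * V 0 x $ i + q 0 * V (-1) x $ i"
      by (simp only: vector_add_component vector_scaleR_component real_scaleR_def)
    then have "V 1 x $ i * p 0 = (x - r 0) * axis 1 1 $ i - q 0 * axis 2 1 $ i"
      unfolding V_0 V_m1 by algebra
    then have "(x - r 0) * axis 1 1 $ i - q 0 * axis 2 1 $ i = V 1 x $ i * p 0" ..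
    then show ?thesis using p_pos[of 0] by simp
  qed
  have u1: "u i 1 x = k * ((x - r 0) * axis 1 1 $ i - q 0 * axis 2 1 $ i)" for i x
    by (simp add: u_def V1 k_def)
  have ax: "\<bar>axis j (1::real) $ i\<bar> \<le> 1" for i j :: 2 by (simp add: axis_def)
  define C0 where "C0 = D * (1 + k * (1 + \<bar>r 0\<bar> + q 0))"
  have C0: "\<bar>u i n x\<bar> \<le> C0" if x: "x \<in> {\<delta>..1 - \<delta>}" for i n x
  proof -
    have "\<bar>u i n x\<bar> \<le> D * (\<bar>u i 0 x\<bar> + \<bar>u i 1 x\<bar> + (\<Sum>k<n. \<bar>0\<bar>))"
      by (rule D(2)[of x "\<lambda>n. u i n x"]) (use x u_rec in auto)
    also have "\<dots> \<le> C0"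
    proof -
      have "\<bar>x - r 0\<bar> \<le> 1 + \<bar>r 0\<bar>" using x \<delta> by auto
      then have "\<bar>(x - r 0) * axis 1 1 $ i\<bar> \<le> (1 + \<bar>r 0\<bar>) * 1" "\<bar>q 0 * axis 2 1 $ i\<bar> \<le> q 0 * 1"
        unfolding abs_mult using ax q_pos[of 0] by (intro mult_mono; auto)+
      then have "\<bar>(x - r 0) * axis 1 1 $ i - q 0 * axis 2 1 $ i\<bar> \<le> (1 + \<bar>r 0\<bar>) * 1 + q 0 * 1"
        by (rule order_trans[OF abs_triangle_ineq4 add_mono])
      then have "\<bar>u i 1 x\<bar> \<le> k * (1 + \<bar>r 0\<bar> + q 0)"
        unfolding u1 abs_mult[of k] using k by simp
      moreover have "\<bar>u i 0 x\<bar> \<le> 1" using ax by (simp add: u_def w_0 V_0)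
      ultimately show ?thesis unfolding C0_def using D(1) by simp
    qed
    finally show ?thesis .
  qed
  define C where "C = C0 + D * (k + C0) + 1"
  have C0': "0 \<le> C0" unfolding C0_def using D(1) k q_pos[of 0] by (simp add: add_nonneg_nonneg)
  have DC: "0 \<le> D * (k + C0)" using C0' D(1) k by simp
  show thesis
  proof (rule that)
    show "0 < C" unfolding C_def using C0' DC by linarith
    show "\<bar>u i n x\<bar> \<le> C" if "x \<in> {\<delta>..1 - \<delta>}" for i n x
      unfolding C_def using C0[OF that, of i n] DC by linarith
    fix i n x y assume x: "x \<in> {\<delta>..1 - \<delta>}" and y: "y \<in> {\<delta>..1 - \<delta>}"
    have rec: "a (Suc n) * (u i (Suc (Suc n)) x - u i (Suc (Suc n)) y) + r (int (Suc n)) * (u i (Suc n) x - u i (Suc n) y)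
        + a n * (u i n x - u i n y) = y * (u i (Suc n) x - u i (Suc n) y) + (x - y) * u i (Suc n) x" for n
      using u_rec[of n i x] u_rec[of n i y] by (simp add: algebra_simps)
    have "\<bar>u i n x - u i n y\<bar> \<le> D * (\<bar>u i 0 x - u i 0 y\<bar> + \<bar>u i 1 x - u i 1 y\<bar> + (\<Sum>k<n. \<bar>(x - y) * u i (Suc k) x\<bar>))"
      by (rule D(2)[of y "\<lambda>n. u i n x - u i n y"]) (use y rec in auto)
    also have "\<dots> \<le> D * (0 + k * \<bar>x - y\<bar> + real n * (\<bar>x - y\<bar> * C0))"
    proof (intro mult_left_mono add_mono)
      show "\<bar>u i 0 x - u i 0 y\<bar> \<le> 0" by (simp add: u_def V_0)
      have "u i 1 x - u i 1 y = k * ((x - y) * axis 1 1 $ i)" unfolding u1 by algebra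
      also have "\<bar>\<dots>\<bar> \<le> k * (\<bar>x - y\<bar> * 1)"
        unfolding abs_mult using k ax by (intro mult_mono) auto
      finally show "\<bar>u i 1 x - u i 1 y\<bar> \<le> k * \<bar>x - y\<bar>" by simp
      show "(\<Sum>k<n. \<bar>(x - y) * u i (Suc k) x\<bar>) \<le> real n * (\<bar>x - y\<bar> * C0)"
        using sum_bounded_above[of "{..<n}" "\<lambda>k. \<bar>(x - y) * u i (Suc k) x\<bar>" "\<bar>x - y\<bar> * C0"] C0[OF x]
        by (simp add: abs_mult mult_left_mono)
    qed (use D(1) in simp)
    also have "\<dots> \<le> D * ((k + C0) * (real n + 1) * \<bar>x - y\<bar>)"
    proof -
      have "0 \<le> k * real n * \<bar>x - y\<bar>" "0 \<le> C0 * \<bar>x - y\<bar>" using k C0' by auto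
      then show ?thesis using D(1) by (intro mult_left_mono) (auto simp: algebra_simps)
    qed
    also have "\<dots> = (D * (k + C0)) * (real n + 1) * \<bar>x - y\<bar>" by simp
    also have "\<dots> \<le> C * (real n + 1) * \<bar>x - y\<bar>"
      unfolding C_def using C0' by (intro mult_right_mono) auto
    finally show "\<bar>u i n x - u i n y\<bar> \<le> C * (real n + 1) * \<bar>x - y\<bar>" .
  qed
qed

end


context nevai_chain
begin

lemma V_inner_sq: "w (int n) * (V (int n) y \<bullet> v)\<^sup>2 = (u 1 n y * v $ 1 + u 2 n y * v $ 2)\<^sup>2"
proof -
  have "u 1 n y * v $ 1 + u 2 n y * v $ 2 = sqrt (w (int n)) * (V (int n) y \<bullet> v)"
    by (simp add: u_def inner_vec_def sum_2 algebra_simps)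
  then show ?thesis using w_pos[of "int n"] by (simp add: power_mult_distrib)
qed

text \<open>
  The Casoratian of the solutions with initial data \<open>v\<close> and \<open>v\<close> rotated by a right angle is
  \<open>- q 0 * (v \<bullet> v)\<close>, independently of the index. The rotated solution being bounded, two consecutive
  values of the first one cannot both be small.
\<close>

lemma kernel_lower_bound:
  assumes \<delta>: "0 < \<delta>" "\<delta> < 1/2"
  obtains c where "0 < c" "\<And>y v N. y \<in> {\<delta>..1 - \<delta>} \<Longrightarrow>
    c * real N * (v \<bullet> v) \<le> (\<Sum>n<2 * N. w (int n) * (V (int n) y \<bullet> v)\<^sup>2)"
proof -
  obtain C where C: "0 < C" "\<And>i n x. x \<in> {\<delta>..1 - \<delta>} \<Longrightarrow> \<bar>u i n x\<bar> \<le> C"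
    using u_bounds[OF \<delta>] by metis
  have "a \<longlonglongrightarrow> 1/4"
    using summable_LIMSEQ_zero[OF summable_a[folded a_def]] by (simp add: tendsto_rabs_zero_iff LIM_zero_iff)
  then have "Bseq a" by (intro convergent_imp_Bseq convergentI)
  then obtain A where A: "0 < A" "\<And>n. \<bar>a n\<bar> \<le> A" by (auto simp: Bseq_def)
  define c where "c = (q 0)\<^sup>2 / (4 * A\<^sup>2 * C\<^sup>2)"
  have q0: "0 < q 0" by (rule q_pos)
  show thesis
  proof (rule that)
    show "0 < c" using q0 A C by (simp add: c_def)
    fix y :: real and v :: "real^2" and N :: nat
    assume y: "y \<in> {\<delta>..1 - \<delta>}"
    define F where "F n = u 1 n y * v $ 1 + u 2 n y * v $ 2" for n
    define G where "G n = u 2 n y * v $ 1 - u 1 n y * v $ 2" for n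
    have vv: "v \<bullet> v = (v $ 1)\<^sup>2 + (v $ 2)\<^sup>2" by (simp add: inner_vec_def sum_2 power2_eq_square)
    have G: "(G n)\<^sup>2 \<le> 2 * C\<^sup>2 * (v \<bullet> v)" for n
    proof -
      have u2: "(u i n y)\<^sup>2 \<le> C\<^sup>2" for i using power_mono[OF C(2)[OF y], of i n 2] by simp
      have "(G n)\<^sup>2 + (F n)\<^sup>2 = ((u 1 n y)\<^sup>2 + (u 2 n y)\<^sup>2) * (v \<bullet> v)"
        unfolding F_def G_def vv by algebra
      also have "\<dots> \<le> (C\<^sup>2 + C\<^sup>2) * (v \<bullet> v)" by (intro mult_right_mono add_mono u2) auto
      also have "\<dots> = 2 * C\<^sup>2 * (v \<bullet> v)" by simp
      finally show ?thesis using zero_le_power2[of "F n"] by linarith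
    qed
    have pair: "c * (v \<bullet> v) \<le> (F n)\<^sup>2 + (F (Suc n))\<^sup>2" for n
    proof (cases "v = 0")
      case False
      then have v: "0 < v \<bullet> v" by simp
      have wp: "w (int n) * p (int n) = a n * sqrt (w (int n)) * sqrt (w (int n + 1))"
      proof -
        have "a n * sqrt (w (int n)) * sqrt (w (int n + 1)) = sqrt (w (int n)) * (a n * sqrt (w (int n + 1)))"
          by simp
        also have "\<dots> = (sqrt (w (int n)) * sqrt (w (int n))) * p (int n)" unfolding sqrt_w_mult_a(2) by simp
        also have "\<dots> = w (int n) * p (int n)" using w_pos[of "int n"] by simp
        finally show ?thesis by simp
      qed
      have uS: "u i (Suc n) y = sqrt (w (int n + 1)) * V (int n + 1) y $ i" for i
        by (simp add: u_def add.commute)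
      have "a n * (u 1 n y * u 2 (Suc n) y - u 1 (Suc n) y * u 2 n y) = - q 0"
        using casoratian[of n y] unfolding wp uS unfolding u_def by algebra
      then have "a n * (F n * G (Suc n) - F (Suc n) * G n) = - q 0 * (v \<bullet> v)"
        unfolding F_def G_def vv by algebra
      then have "(q 0 * (v \<bullet> v))\<^sup>2 = (a n)\<^sup>2 * (F n * G (Suc n) - F (Suc n) * G n)\<^sup>2"
        by algebra
      also have "\<dots> \<le> A\<^sup>2 * (((F n)\<^sup>2 + (F (Suc n))\<^sup>2) * (4 * C\<^sup>2 * (v \<bullet> v)))"
      proof (rule mult_mono)
        show "(a n)\<^sup>2 \<le> A\<^sup>2" using power_mono[OF A(2), of n 2] by simp
        have "(F n * G (Suc n) - F (Suc n) * G n)\<^sup>2 + (F n * G n + F (Suc n) * G (Suc n))\<^sup>2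
            = ((F n)\<^sup>2 + (F (Suc n))\<^sup>2) * ((G n)\<^sup>2 + (G (Suc n))\<^sup>2)" by algebra
        also have "\<dots> \<le> ((F n)\<^sup>2 + (F (Suc n))\<^sup>2) * (4 * C\<^sup>2 * (v \<bullet> v))"
          using G[of n] G[of "Suc n"] by (intro mult_left_mono) auto
        finally show "(F n * G (Suc n) - F (Suc n) * G n)\<^sup>2 \<le> ((F n)\<^sup>2 + (F (Suc n))\<^sup>2) * (4 * C\<^sup>2 * (v \<bullet> v))"
          using zero_le_power2[of "F n * G n + F (Suc n) * G (Suc n)"] by linarith
      qed auto
      finally have "((q 0)\<^sup>2 * (v \<bullet> v)) * (v \<bullet> v) \<le> (((F n)\<^sup>2 + (F (Suc n))\<^sup>2) * (4 * A\<^sup>2 * C\<^sup>2)) * (v \<bullet> v)"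
        by (simp only: power2_eq_square mult_ac)
      then have "(q 0)\<^sup>2 * (v \<bullet> v) \<le> ((F n)\<^sup>2 + (F (Suc n))\<^sup>2) * (4 * A\<^sup>2 * C\<^sup>2)"
        using v by (rule mult_right_le_imp_le)
      moreover have "0 < 4 * A\<^sup>2 * C\<^sup>2" using A C by simp
      ultimately have "(q 0)\<^sup>2 * (v \<bullet> v) / (4 * A\<^sup>2 * C\<^sup>2) \<le> (F n)\<^sup>2 + (F (Suc n))\<^sup>2"
        by (simp only: pos_divide_le_eq)
      then show ?thesis unfolding c_def by simp
    qed simp
    have "c * real N * (v \<bullet> v) \<le> (\<Sum>n<2 * N. (F n)\<^sup>2)"
    proof (induction N)
      case (Suc N)
      have "c * real (Suc N) * (v \<bullet> v) = c * real N * (v \<bullet> v) + c * (v \<bullet> v)" by (simp add: algebra_simps)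
      also have "\<dots> \<le> (\<Sum>n<2 * N. (F n)\<^sup>2) + ((F (2 * N))\<^sup>2 + (F (Suc (2 * N)))\<^sup>2)"
        by (rule add_mono[OF Suc pair])
      finally show ?case by simp
    qed simp
    then show "c * real N * (v \<bullet> v) \<le> (\<Sum>n<2 * N. w (int n) * (V (int n) y \<bullet> v)\<^sup>2)"
      unfolding V_inner_sq F_def .
  qed
qed

definition tr_mass :: "real set \<Rightarrow> real" where "tr_mass A = mass A $ 1 $ 1 + mass A $ 2 $ 2"

lemma tr_mass_eq:
  assumes A: "A \<in> sets borel"
  shows "tr_mass A = (\<integral>x. indicator A x * (M x $ 1 $ 1 + M x $ 2 $ 2) \<partial>\<mu>)"
    and "integrable \<mu> (\<lambda>x. indicator A x * (M x $ 1 $ 1 + M x $ 2 $ 2))"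
proof -
  have i: "integrable \<mu> (\<lambda>x. indicator A x * M x $ i $ i)" for i
    by (intro integrable_entry bdd_borel_indicator A)
  show "integrable \<mu> (\<lambda>x. indicator A x * (M x $ 1 $ 1 + M x $ 2 $ 2))"
    unfolding distrib_left using i by (intro Bochner_Integration.integrable_add)
  have "mass A $ i $ i = (\<integral>x. indicator A x * M x $ i $ i \<partial>\<mu>)" for i
    using inner_mass[OF A, of "axis i 1" "axis i 1"] by (simp only: inner_axis_mat)
  then show "tr_mass A = (\<integral>x. indicator A x * (M x $ 1 $ 1 + M x $ 2 $ 2) \<partial>\<mu>)"
    unfolding distrib_left tr_mass_def by (simp only: Bochner_Integration.integral_add[OF i i])
qed

lemma tr_mass_nonneg: "A \<in> sets borel \<Longrightarrow> 0 \<le> tr_mass A"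
  unfolding tr_mass_def by (rule pos_semidef_trace_nonneg[OF mass_psd])

lemma tr_mass_mono:
  assumes "A \<in> sets borel" "A' \<in> sets borel" "A \<subseteq> A'" shows "tr_mass A \<le> tr_mass A'"
  unfolding tr_mass_eq(1)[OF assms(1)] tr_mass_eq(1)[OF assms(2)]
proof (intro integral_mono_AE tr_mass_eq(2) assms eventually_mono[OF psd])
  fix x assume "pos_semidef (M x)"
  then have "0 \<le> M x $ 1 $ 1 + M x $ 2 $ 2" by (rule pos_semidef_trace_nonneg)
  moreover have "indicator A x \<le> (indicator A' x :: real)" using assms(3) by (auto simp: indicator_def)
  ultimately show "indicator A x * (M x $ 1 $ 1 + M x $ 2 $ 2) \<le> indicator A' x * (M x $ 1 $ 1 + M x $ 2 $ 2)"
    by (rule mult_right_mono[rotated])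
qed

text \<open>
  Let \<open>I = {l..h}\<close> have length at most \<open>\<eta> / N\<close> and put \<open>z = mass I *v axis i 1\<close>. For \<open>n < 2 * N\<close> the Fourier
  coefficients of \<open>indicator I *\<^sub>R axis i 1\<close> differ from \<open>V n l \<bullet> z\<close> only by a small multiple of the trace
  of \<open>mass I\<close>, because \<open>V n\<close> varies little on \<open>I\<close>. Hence Bessel's inequality bounds the sum of
  \<open>w n * (V n l \<bullet> z)\<^sup>2\<close> over \<open>n < 2 * N\<close>, which is at least \<open>c * N * (z \<bullet> z)\<close>, by the \<open>i\<close>-th diagonal entry of
  \<open>mass I\<close>. So the square of the trace is at most a constant times the trace over \<open>N\<close>.
\<close>

lemma tr_mass_interval:
  assumes \<delta>: "0 < \<delta>" "\<delta> < 1/2"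
  obtains C \<eta> where "0 < C" "0 < \<eta>"
    "\<And>N l h. 0 < N \<Longrightarrow> \<delta> \<le> l \<Longrightarrow> l \<le> h \<Longrightarrow> h \<le> 1 - \<delta> \<Longrightarrow> (h - l) * real N \<le> \<eta> \<Longrightarrow> tr_mass {l..h} * real N \<le> C"
proof -
  obtain C where C: "0 < C" "\<And>i n x y. x \<in> {\<delta>..1 - \<delta>} \<Longrightarrow> y \<in> {\<delta>..1 - \<delta>} \<Longrightarrow> \<bar>u i n x - u i n y\<bar> \<le> C * (real n + 1) * \<bar>x - y\<bar>"
    using u_bounds[OF \<delta>] by metis
  obtain c where c: "0 < c" "\<And>y v N. y \<in> {\<delta>..1 - \<delta>} \<Longrightarrow>
    c * real N * (v \<bullet> v) \<le> (\<Sum>n<2 * N. w (int n) * (V (int n) y \<bullet> v)\<^sup>2)"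
    by (rule kernel_lower_bound[OF \<delta>]) (rule that)
  \<comment> \<open>Chosen so that the error terms add up to at most half of the lower bound.\<close>
  define \<eta> where "\<eta> = sqrt (c / 32) / (4 * C)"
  have \<eta>: "0 < \<eta>" using c C by (simp add: \<eta>_def)
  have \<eta>2: "(4 * C * \<eta>)\<^sup>2 = c / 32" using c C by (simp add: \<eta>_def)
  show thesis
  proof (rule that)
    show "0 < 8 / c" "0 < \<eta>" using c \<eta> by auto
    fix N :: nat and l h :: real
    assume N: "0 < N" and lh: "\<delta> \<le> l" "l \<le> h" "h \<le> 1 - \<delta>" and N\<eta>: "(h - l) * real N \<le> \<eta>"
    let ?I = "{l..h}"
    define \<tau> where "\<tau> = tr_mass ?I"
    have I: "?I \<in> sets borel" by simp
    have \<tau>: "0 \<le> \<tau>" unfolding \<tau>_def by (rule tr_mass_nonneg) simp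
    have l: "l \<in> {\<delta>..1 - \<delta>}" using lh by auto
    have main: "c * real N * (mass ?I $ i $ i)\<^sup>2 \<le> 2 * mass ?I $ i $ i + real N * (c / 8) * \<tau>\<^sup>2" for i
    proof -
      let ?e = "axis i 1 :: real^2"
      let ?f = "\<lambda>x. indicator ?I x *\<^sub>R ?e"
      define z where "z = mass ?I *v ?e"
      have f: "bdd_borel ?f" by (intro bdd_borel_scaleR bdd_borel_indicator bdd_borel_const I)
      have zi: "?e \<bullet> z = mass ?I $ i $ i" unfolding z_def by (rule inner_axis_mat)
      have bound: "w (int n) * (V (int n) l \<bullet> z)\<^sup>2 \<le> 2 * (w (int n) * (B ?f (V (int n)))\<^sup>2) + 2 * (4 * C * \<eta> * \<tau>)\<^sup>2" if n: "n < 2 * N" for n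
      proof -
        let ?g = "\<lambda>x. indicator ?I x * (?e \<bullet> (M x *v V (int n) l))"
        let ?h = "\<lambda>x. indicator ?I x * (?e \<bullet> (M x *v V (int n) x))"
        define d where "d = sqrt (w (int n)) * (V (int n) l \<bullet> z - B ?f (V (int n)))"
        have i1: "integrable \<mu> ?g"
          using integrable_form[OF f bdd_borel_const[of "V (int n) l"]] by (simp only: inner_scaleR_left)
        have i2: "integrable \<mu> ?h"
          using integrable_form[OF f bdd_borel_V[of "int n"]] by (simp only: inner_scaleR_left)
        have "V (int n) l \<bullet> z = integral\<^sup>L \<mu> ?g"
          unfolding z_def pos_semidef_inner_commute[OF mass_psd[OF I], of "V (int n) l"] by (rule inner_mass[OF I])
        moreover have "B ?f (V (int n)) = integral\<^sup>L \<mu> ?h"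
          unfolding B_def by (simp only: inner_scaleR_left)
        ultimately have d: "d = (\<integral>x. sqrt (w (int n)) * (?g x - ?h x) \<partial>\<mu>)"
          unfolding d_def using i1 i2 by simp
        have "\<bar>d\<bar> \<le> (\<integral>x. (4 * C * \<eta>) * (indicator ?I x * (M x $ 1 $ 1 + M x $ 2 $ 2)) \<partial>\<mu>)"
          unfolding d
        proof (rule order_trans[OF integral_abs_bound integral_mono_AE])
          show "integrable \<mu> (\<lambda>x. \<bar>sqrt (w (int n)) * (?g x - ?h x)\<bar>)"
            using i1 i2 by (intro integrable_abs integrable_mult_right Bochner_Integration.integrable_diff)
          show "integrable \<mu> (\<lambda>x. (4 * C * \<eta>) * (indicator ?I x * (M x $ 1 $ 1 + M x $ 2 $ 2)))"
            by (rule integrable_mult_right[OF tr_mass_eq(2)[OF I]])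
          show "AE x in \<mu>. \<bar>sqrt (w (int n)) * (?g x - ?h x)\<bar>
              \<le> (4 * C * \<eta>) * (indicator ?I x * (M x $ 1 $ 1 + M x $ 2 $ 2))"
          proof (rule eventually_mono[OF psd])
            fix x assume P: "pos_semidef (M x)"
            show "\<bar>sqrt (w (int n)) * (?g x - ?h x)\<bar>
              \<le> (4 * C * \<eta>) * (indicator ?I x * (M x $ 1 $ 1 + M x $ 2 $ 2))"
            proof (cases "x \<in> ?I")
              case x: True
              let ?T = "M x $ 1 $ 1 + M x $ 2 $ 2"
              have xK: "x \<in> {\<delta>..1 - \<delta>}" using x lh by auto
              have T: "0 \<le> ?T" by (rule pos_semidef_trace_nonneg[OF P])
              have ej: "?e \<bullet> (M x *v v) = M x $ i $ 1 * v $ 1 + M x $ i $ 2 * v $ 2" for v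
                using exhaust_2[of i] by (auto simp: inner_mat_2 axis_def)
              have "sqrt (w (int n)) * (?e \<bullet> (M x *v V (int n) l) - ?e \<bullet> (M x *v V (int n) x))
                 = M x $ i $ 1 * (u 1 n l - u 1 n x) + M x $ i $ 2 * (u 2 n l - u 2 n x)"
                unfolding ej u_def by algebra
              also have "\<bar>\<dots>\<bar> \<le> ?T * (2 * C * \<eta>) + ?T * (2 * C * \<eta>)"
              proof -
                have du: "\<bar>u j n l - u j n x\<bar> \<le> 2 * C * \<eta>" for j
                proof -
                  have "\<bar>u j n l - u j n x\<bar> \<le> C * (real n + 1) * \<bar>l - x\<bar>" by (rule C(2)[OF l xK])
                  also have "\<dots> \<le> C * (2 * real N) * (h - l)"
                    using x n C(1) by (intro mult_mono) auto
                  also have "\<dots> = 2 * C * ((h - l) * real N)" by simp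
                  also have "\<dots> \<le> 2 * C * \<eta>" using N\<eta> C(1) by (intro mult_left_mono) auto
                  finally show ?thesis .
                qed
                have "\<bar>M x $ i $ j * (u j n l - u j n x)\<bar> \<le> ?T * (2 * C * \<eta>)" for j
                  unfolding abs_mult using pos_semidef_entry_le_trace[OF P] du T by (intro mult_mono) auto
                then show ?thesis by (intro order_trans[OF abs_triangle_ineq add_mono])
              qed
              finally show ?thesis using x by (simp add: algebra_simps)
            qed simp
          qed
        qed
        also have "\<dots> = 4 * C * \<eta> * \<tau>" unfolding \<tau>_def tr_mass_eq(1)[OF I] by simp
        finally have "d\<^sup>2 \<le> (4 * C * \<eta> * \<tau>)\<^sup>2" using power_mono[of "\<bar>d\<bar>" _ 2] by simp
        moreover have "w (int n) * (V (int n) l \<bullet> z)\<^sup>2 = (d + sqrt (w (int n)) * B ?f (V (int n)))\<^sup>2"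
        proof -
          have "d + sqrt (w (int n)) * B ?f (V (int n)) = sqrt (w (int n)) * (V (int n) l \<bullet> z)"
            unfolding d_def by algebra
          then show ?thesis using w_pos[of "int n"] by (simp add: power_mult_distrib)
        qed
        moreover have "(d + sqrt (w (int n)) * B ?f (V (int n)))\<^sup>2 \<le> 2 * d\<^sup>2 + 2 * (sqrt (w (int n)) * B ?f (V (int n)))\<^sup>2"
          using sum_squares_bound[of d "sqrt (w (int n)) * B ?f (V (int n))"] unfolding power2_sum by linarith
        moreover have "(sqrt (w (int n)) * B ?f (V (int n)))\<^sup>2 = w (int n) * (B ?f (V (int n)))\<^sup>2"
          using w_pos[of "int n"] by (simp add: power_mult_distrib)
        ultimately show ?thesis by linarith
      qed
      have "(mass ?I $ i $ i)\<^sup>2 \<le> z \<bullet> z"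
        unfolding zi[symmetric] using Cauchy_Schwarz_ineq[of ?e z] by (simp add: inner_axis_axis)
      then have "c * real N * (mass ?I $ i $ i)\<^sup>2 \<le> c * real N * (z \<bullet> z)"
        using c by (intro mult_left_mono) auto
      also have "\<dots> \<le> (\<Sum>n<2 * N. w (int n) * (V (int n) l \<bullet> z)\<^sup>2)" by (rule c(2)[OF l])
      also have "\<dots> \<le> (\<Sum>n<2 * N. 2 * (w (int n) * (B ?f (V (int n)))\<^sup>2) + 2 * (4 * C * \<eta> * \<tau>)\<^sup>2)"
        by (intro sum_mono bound) simp
      also have "\<dots> = 2 * (\<Sum>k\<in>int ` {..<2 * N}. w k * (B ?f (V k))\<^sup>2) + 4 * real N * (4 * C * \<eta> * \<tau>)\<^sup>2"
        by (simp add: sum.distrib sum_distrib_left sum.reindex)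
      also have "\<dots> \<le> 2 * B ?f ?f + 4 * real N * (4 * C * \<eta> * \<tau>)\<^sup>2"
        using bessel[OF f, of "int ` {..<2 * N}"] by simp
      also have "B ?f ?f = mass ?I $ i $ i" unfolding B_indicator[OF I] by (rule inner_axis_mat)
      also have "4 * real N * (4 * C * \<eta> * \<tau>)\<^sup>2 = real N * (c / 8) * \<tau>\<^sup>2"
        unfolding power_mult_distrib[of _ \<tau>] \<eta>2 by simp
      finally show ?thesis .
    qed
    have "\<tau>\<^sup>2 \<le> 2 * ((mass ?I $ 1 $ 1)\<^sup>2 + (mass ?I $ 2 $ 2)\<^sup>2)"
    proof -
      have "\<tau>\<^sup>2 + (mass ?I $ 1 $ 1 - mass ?I $ 2 $ 2)\<^sup>2 = 2 * ((mass ?I $ 1 $ 1)\<^sup>2 + (mass ?I $ 2 $ 2)\<^sup>2)"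
        unfolding \<tau>_def tr_mass_def by algebra
      then show ?thesis by (metis le_add_same_cancel1 zero_le_power2)
    qed
    then have "c * real N * \<tau>\<^sup>2 \<le> c * real N * (2 * ((mass ?I $ 1 $ 1)\<^sup>2 + (mass ?I $ 2 $ 2)\<^sup>2))"
      using c by (intro mult_left_mono) auto
    also have "\<dots> = 2 * (c * real N * (mass ?I $ 1 $ 1)\<^sup>2 + c * real N * (mass ?I $ 2 $ 2)\<^sup>2)"
      by algebra
    also have "\<dots> \<le> 2 * ((2 * mass ?I $ 1 $ 1 + real N * (c / 8) * \<tau>\<^sup>2) + (2 * mass ?I $ 2 $ 2 + real N * (c / 8) * \<tau>\<^sup>2))"
      by (intro mult_left_mono add_mono main) simp
    also have "\<dots> = 4 * \<tau> + (c * real N * \<tau>\<^sup>2) / 2" unfolding \<tau>_def tr_mass_def by (simp add: algebra_simps)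
    finally have "(c * real N * \<tau>) * \<tau> \<le> 8 * \<tau>" by (simp add: power2_eq_square mult.assoc)
    then have "c * real N * \<tau> \<le> 8"
      using \<tau> mult_right_le_imp_le[of "c * real N * \<tau>" \<tau> 8] by (cases "\<tau> = 0") auto
    then show "tr_mass ?I * real N \<le> 8 / c"
      unfolding \<tau>_def[symmetric] using c by (simp add: pos_le_divide_eq mult_ac)
  qed
qed

lemma tr_mass_lipschitz:
  assumes \<delta>: "0 < \<delta>" "\<delta> < 1/2"
  obtains C where "0 \<le> C" "\<And>l h. \<delta> \<le> l \<Longrightarrow> l < h \<Longrightarrow> h \<le> 1 - \<delta> \<Longrightarrow> tr_mass {l..h} \<le> C * (h - l)"
proof -
  obtain C \<eta> where C: "0 < C" "0 < \<eta>"
    "\<And>N l h. 0 < N \<Longrightarrow> \<delta> \<le> l \<Longrightarrow> l \<le> h \<Longrightarrow> h \<le> 1 - \<delta> \<Longrightarrow> (h - l) * real N \<le> \<eta> \<Longrightarrow> tr_mass {l..h} * real N \<le> C"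
    by (rule tr_mass_interval[OF \<delta>]) (rule that)
  define K where "K = 2 * C / \<eta> + tr_mass UNIV / \<eta>"
  have t: "0 \<le> tr_mass UNIV" by (rule tr_mass_nonneg) simp
  show thesis
  proof (rule that)
    show "0 \<le> K" using C t by (simp add: K_def)
    fix l h assume lh: "\<delta> \<le> l" "l < h" "h \<le> 1 - \<delta>"
    show "tr_mass {l..h} \<le> K * (h - l)"
    proof (cases "h - l \<le> \<eta>")
      case True
      define N where "N = nat \<lfloor>\<eta> / (h - l)\<rfloor>"
      have "1 \<le> \<eta> / (h - l)" using True lh by simp
      then have "1 \<le> \<lfloor>\<eta> / (h - l)\<rfloor>" by (simp add: le_floor_iff)
      then have N: "0 < N" "real N \<le> \<eta> / (h - l)" "\<eta> / (h - l) < real N + 1"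
        unfolding N_def by simp_all
      have "\<eta> / (h - l) \<le> 2 * real N" using N by simp
      then have "\<eta> \<le> 2 * real N * (h - l)" using lh by (simp add: pos_divide_le_eq)
      then have "tr_mass {l..h} * \<eta> \<le> tr_mass {l..h} * (2 * real N * (h - l))"
        using tr_mass_nonneg[of "{l..h}"] by (intro mult_left_mono) auto
      also have "\<dots> = 2 * (tr_mass {l..h} * real N) * (h - l)" by simp
      also have "\<dots> \<le> 2 * C * (h - l)"
        using C(3)[OF N(1), of l h] N(2) lh by (intro mult_right_mono mult_left_mono) (auto simp: pos_le_divide_eq mult.commute)
      finally have "tr_mass {l..h} \<le> 2 * C / \<eta> * (h - l)" using C by (simp add: pos_le_divide_eq)
      also have "\<dots> \<le> K * (h - l)" using lh t C by (intro mult_right_mono) (auto simp: K_def)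
      finally show ?thesis .
    next
      case False
      have "tr_mass {l..h} \<le> tr_mass UNIV" by (rule tr_mass_mono) auto
      also have "\<dots> \<le> tr_mass UNIV / \<eta> * (h - l)"
        using False C t mult_left_mono[of \<eta> "h - l" "tr_mass UNIV"] by (simp add: pos_le_divide_eq)
      also have "\<dots> \<le> K * (h - l)" using lh t C by (intro mult_right_mono) (auto simp: K_def)
      finally show ?thesis .
    qed
  qed
qed

end


lemma (in nevai_chain) mass_null_set:
  assumes \<mu>: "finite_measure \<mu>" "\<And>A. A \<in> sets borel \<Longrightarrow> emeasure \<mu> A = ennreal (tr_mass A)"
    and at: "mass {0} = 0" "mass {1} = 0" and out: "tr_mass (- {0..1}) = 0"
    and A: "A \<in> null_sets lborel"
  shows "mass A = 0"
proof -
  interpret finite_measure \<mu> by fact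
  have bA: "A \<in> sets borel" using A by auto
  let ?K = "\<lambda>n::nat. {1 / (real n + 3)<..<1 - 1 / (real n + 3)}"
  have K: "emeasure \<mu> (A \<inter> ?K n) = 0" for n
  proof -
    let ?\<delta> = "1 / (real n + 3)"
    have \<delta>: "0 < ?\<delta>" "?\<delta> < 1/2" by (auto simp: field_simps)
    obtain C where C: "0 \<le> C" "\<And>l h. ?\<delta> \<le> l \<Longrightarrow> l < h \<Longrightarrow> h \<le> 1 - ?\<delta> \<Longrightarrow> tr_mass {l..h} \<le> C * (h - l)"
      by (rule tr_mass_lipschitz[OF \<delta>]) (rule that)
    show ?thesis
    proof (rule null_set_of_lipschitz[where c="?\<delta>" and d="1 - ?\<delta>", OF \<mu>(1) sets_\<mu> _ C(1)])
      show "?\<delta> < 1 - ?\<delta>" using \<delta> by linarith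
      show "A \<inter> ?K n \<in> null_sets lborel" using A by (intro null_set_Int2) auto
      fix l h assume lh: "?\<delta> \<le> l" "l < h" "h \<le> 1 - ?\<delta>"
      have "measure \<mu> {l..h} = tr_mass {l..h}"
        unfolding measure_def \<mu>(2)[of "{l..h}", simplified] using tr_mass_nonneg[of "{l..h}"] by simp
      then show "measure \<mu> {l..h} \<le> C * (h - l)" using C(2)[OF lh] by simp
    qed auto
  qed
  have cover: "A \<subseteq> (- {0..1}) \<union> {0} \<union> {1} \<union> (\<Union>n. A \<inter> ?K n)"
  proof
    fix x assume x: "x \<in> A"
    show "x \<in> (- {0..1}) \<union> {0} \<union> {1} \<union> (\<Union>n. A \<inter> ?K n)"
    proof (cases "0 < x \<and> x < 1")
      case True
      obtain n where n: "inverse (real (Suc n)) < min x (1 - x)" using True reals_Archimedean[of "min x (1 - x)"] by auto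
      have "1 / (real n + 3) \<le> inverse (real (Suc n))" by (auto simp: field_simps)
      then have "x \<in> ?K n" using n by (auto simp: min_less_iff_conj)
      then show ?thesis using x by blast
    qed auto
  qed
  have z: "emeasure \<mu> {0} = 0" "emeasure \<mu> {1} = 0" "emeasure \<mu> (- {0..1}) = 0"
    using at out by (auto simp: \<mu>(2) tr_mass_def)
  have z': "emeasure \<mu> (\<Union>n. A \<inter> ?K n) = 0"
    using bA sets_\<mu> K by (intro emeasure_UN_eq_0) auto
  have "(- {0..1}) \<union> {0} \<union> {1} \<union> (\<Union>n. A \<inter> ?K n) \<in> null_sets \<mu>"
    by (intro null_sets.Un null_setsI z z') (use bA sets_\<mu> in auto)
  then have "emeasure \<mu> ((- {0..1}) \<union> {0} \<union> {1} \<union> (\<Union>n. A \<inter> ?K n)) = 0" (is "emeasure \<mu> ?U = 0") by blast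
  moreover have "emeasure \<mu> A \<le> emeasure \<mu> ?U"
    using bA sets_\<mu> by (intro emeasure_mono[OF cover]) auto
  ultimately have "emeasure \<mu> A = 0" by (metis le_zero_eq)
  then have "tr_mass A = 0" using tr_mass_nonneg[OF bA] by (simp add: \<mu>(2)[OF bA])
  then show ?thesis unfolding tr_mass_def by (rule pos_semidef_trace_0[OF mass_psd[OF bA]])
qed

section \<open>Square summable solutions\<close>

text \<open>
  A solution at \<open>y\<close> has the form \<open>R n * H n\<close>, and constancy of the Casoratian with \<open>H\<close> gives
  \<open>R (n + 1) - R n = C / (w n * p n * (H n * H (n + 1)))\<close>. Either \<open>C = 0\<close> and \<open>R\<close> is a nonzero constant, or
  \<open>\<bar>R n\<bar>\<close> tends to infinity; in both cases the solution dominates a multiple of \<open>H\<close>.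
\<close>

lemma (in ortho_chain) not_square_summable:
  fixes H :: "nat \<Rightarrow> real"
  assumes H: "\<And>n. H n \<noteq> 0"
    and rec: "\<And>n. y * H (Suc n) = p (int n + 1) * H (Suc (Suc n)) + r (int n + 1) * H (Suc n) + q (int n + 1) * H n"
    and div: "\<not> summable (\<lambda>n. w (int n) * (H n)\<^sup>2)"
    and dom: "LIM n sequentially. \<bar>\<Sum>k<n. 1 / (w (int k) * p (int k) * (H k * H (Suc k)))\<bar> :> at_top"
    and v: "v \<noteq> 0"
  shows "\<not> summable (\<lambda>n. w (int n) * (V (int n) y \<bullet> v)\<^sup>2)"
proof
  define \<phi> where "\<phi> n = V (int n) y \<bullet> v" for n :: nat
  assume sm: "summable (\<lambda>n. w (int n) * (V (int n) y \<bullet> v)\<^sup>2)"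
  have \<phi>_rec: "y * \<phi> (Suc n) = p (int n + 1) * \<phi> (Suc (Suc n)) + r (int n + 1) * \<phi> (Suc n) + q (int n + 1) * \<phi> n" for n
  proof -
    have "(y *\<^sub>R V (int n + 1) y) \<bullet> v = (p (int n + 1) *\<^sub>R V (int n + 2) y + r (int n + 1) *\<^sub>R V (int n + 1) y + q (int n + 1) *\<^sub>R V (int n) y) \<bullet> v"
      using V_rec[of y "int n + 1"] by (simp add: add.commute)
    then have "y * (V (int n + 1) y \<bullet> v) = p (int n + 1) * (V (int n + 2) y \<bullet> v) + r (int n + 1) * (V (int n + 1) y \<bullet> v) + q (int n + 1) * (V (int n) y \<bullet> v)"
      by (simp only: inner_add_left inner_scaleR_left)
    then show ?thesis by (simp add: \<phi>_def add.commute)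
  qed
  define C where "C = w 0 * p 0 * (H 0 * \<phi> 1 - H 1 * \<phi> 0)"
  have wron: "w (int n) * p (int n) * (H n * \<phi> (Suc n) - H (Suc n) * \<phi> n) = C" for n
  proof (induction n)
    case (Suc n)
    have "w (int n + 1) * (p (int n + 1) * (H (Suc n) * \<phi> (Suc (Suc n)) - H (Suc (Suc n)) * \<phi> (Suc n)))
        = (w (int n + 1) * q (int n + 1)) * (H n * \<phi> (Suc n) - H (Suc n) * \<phi> n)"
    proof -
      have "p (int n + 1) * (H (Suc n) * \<phi> (Suc (Suc n)) - H (Suc (Suc n)) * \<phi> (Suc n))
         = q (int n + 1) * (H n * \<phi> (Suc n) - H (Suc n) * \<phi> n)"
        using \<phi>_rec[of n] rec[of n] by algebra
      then show ?thesis by simp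
    qed
    then show ?case using Suc unfolding w_Suc by (simp add: add.commute)
  qed (simp add: C_def)
  define R where "R n = \<phi> n / H n" for n
  have \<phi>R: "\<phi> n = R n * H n" for n using H by (simp add: R_def)
  have step: "R (Suc n) - R n = C * (1 / (w (int n) * p (int n) * (H n * H (Suc n))))" for n
  proof -
    have "w (int n) * p (int n) \<noteq> 0" using w_pos[of "int n"] p_pos[of "int n"] by simp
    then have "C * (1 / (w (int n) * p (int n) * (H n * H (Suc n)))) = (H n * \<phi> (Suc n) - H (Suc n) * \<phi> n) / (H n * H (Suc n))"
      unfolding wron[of n, symmetric] using H by simp
    also have "\<dots> = R (Suc n) - R n" unfolding R_def using H[of n] H[of "Suc n"] by (simp add: field_simps)
    finally show ?thesis by simp
  qed
  have Rn: "R n = R 0 + C * (\<Sum>k<n. 1 / (w (int k) * p (int k) * (H k * H (Suc k))))" for n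
  proof (induction n)
    case (Suc n)
    then show ?case using step[of n] by (simp only: sum.lessThan_Suc distrib_left)
  qed simp
  have "\<exists>\<kappa>>0. eventually (\<lambda>n. \<kappa> \<le> \<bar>R n\<bar>) sequentially"
  proof (cases "C = 0")
    case True
    have "R 0 \<noteq> 0"
    proof
      assume "R 0 = 0"
      then have "\<phi> n = 0" for n using Rn[of n] True by (simp add: \<phi>R)
      then have f: "V 0 y \<bullet> v = 0" "V 1 y \<bullet> v = 0" using \<phi>_def[of 0] \<phi>_def[of 1] by auto
      have v1: "v $ 1 = 0" using f(1) by (simp add: V_0 inner_vec_def sum_2 axis_def)
      have "V 1 y $ 2 \<noteq> 0" using casoratian[of 0 y] q_pos[of 0] by (auto simp: V_0 axis_def)
      then have "v $ 2 = 0" using f(2) v1 by (simp add: inner_vec_def sum_2)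
      then show False using v v1 by (simp add: vec_eq_iff forall_2)
    qed
    moreover have "\<bar>R 0\<bar> \<le> \<bar>R n\<bar>" for n using Rn[of n] unfolding True by simp
    ultimately show ?thesis by (intro exI[of _ "\<bar>R 0\<bar>"] conjI always_eventually allI) auto
  next
    case False
    have "eventually (\<lambda>n. (1 + \<bar>R 0\<bar>) / \<bar>C\<bar> \<le> \<bar>\<Sum>k<n. 1 / (w (int k) * p (int k) * (H k * H (Suc k)))\<bar>) sequentially"
      using dom by (auto simp: filterlim_at_top)
    then have "eventually (\<lambda>n. 1 \<le> \<bar>R n\<bar>) sequentially"
    proof (rule eventually_mono)
      fix n assume "(1 + \<bar>R 0\<bar>) / \<bar>C\<bar> \<le> \<bar>\<Sum>k<n. 1 / (w (int k) * p (int k) * (H k * H (Suc k)))\<bar>"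
      then have "1 + \<bar>R 0\<bar> \<le> \<bar>C * (\<Sum>k<n. 1 / (w (int k) * p (int k) * (H k * H (Suc k))))\<bar>"
        unfolding abs_mult using False by (simp add: pos_divide_le_eq mult.commute)
      then show "1 \<le> \<bar>R n\<bar>" unfolding Rn[of n] by linarith
    qed
    then show ?thesis by (intro exI[of _ 1]) simp
  qed
  then obtain \<kappa> where \<kappa>: "0 < \<kappa>" "eventually (\<lambda>n. \<kappa> \<le> \<bar>R n\<bar>) sequentially" by blast
  have "summable (\<lambda>n. \<kappa>\<^sup>2 * (w (int n) * (H n)\<^sup>2))"
  proof (rule summable_comparison_test_ev[OF _ sm])
    show "eventually (\<lambda>n. norm (\<kappa>\<^sup>2 * (w (int n) * (H n)\<^sup>2)) \<le> w (int n) * (V (int n) y \<bullet> v)\<^sup>2) sequentially"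
    proof (rule eventually_mono[OF \<kappa>(2)])
      fix n assume "\<kappa> \<le> \<bar>R n\<bar>"
      then have "\<kappa>\<^sup>2 \<le> (R n)\<^sup>2" using \<kappa>(1) power_mono[of \<kappa> "\<bar>R n\<bar>" 2] by simp
      then have "\<kappa>\<^sup>2 * (w (int n) * (H n)\<^sup>2) \<le> (R n)\<^sup>2 * (w (int n) * (H n)\<^sup>2)"
        using w_pos[of "int n"] by (intro mult_right_mono) auto
      also have "\<dots> = w (int n) * (V (int n) y \<bullet> v)\<^sup>2"
        unfolding \<phi>_def[symmetric] \<phi>R by (simp add: power_mult_distrib)
      finally show "norm (\<kappa>\<^sup>2 * (w (int n) * (H n)\<^sup>2)) \<le> w (int n) * (V (int n) y \<bullet> v)\<^sup>2"
        using w_pos[of "int n"] by simp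
    qed
  qed
  then have "summable (\<lambda>n. w (int n) * (H n)\<^sup>2)" using \<kappa>(1) by (simp add: summable_cmult_iff)
  with div show False by contradiction
qed

section \<open>Factorization into bidiagonal matrices\<close>

context ortho_system
begin

definition in_span :: "(real \<Rightarrow> real^2) \<Rightarrow> bool" where
  "in_span f \<longleftrightarrow> (\<exists>F c. finite F \<and> (\<forall>n. n \<notin> F \<longrightarrow> c n = 0) \<and> f = (\<lambda>x. \<Sum>n\<in>F. c n *\<^sub>R V n x))"

lemma in_span_V: "in_span (V n)"
  unfolding in_span_def by (intro exI[of _ "{n}"] exI[of _ "\<lambda>k. if k = n then 1 else 0"]) auto

lemma in_span_0: "in_span (\<lambda>x. 0)"
  unfolding in_span_def by (intro exI[of _ "{}"] exI[of _ "\<lambda>k. 0"]) auto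

lemma in_span_cscaleR: "in_span f \<Longrightarrow> in_span (\<lambda>x. a *\<^sub>R f x)"
  unfolding in_span_def
proof (elim exE conjE)
  fix F c assume "finite F" "\<forall>n. n \<notin> F \<longrightarrow> c n = 0" "f = (\<lambda>x. \<Sum>n\<in>F. c n *\<^sub>R V n x)"
  then show "\<exists>F c. finite F \<and> (\<forall>n. n \<notin> F \<longrightarrow> c n = 0) \<and> (\<lambda>x. a *\<^sub>R f x) = (\<lambda>x. \<Sum>n\<in>F. c n *\<^sub>R V n x)"
    by (intro exI[of _ F] exI[of _ "\<lambda>n. a * c n"]) (auto simp: scaleR_sum_right)
qed

lemma in_span_add:
  assumes "in_span f" "in_span g" shows "in_span (\<lambda>x. f x + g x)"
proof -
  obtain F c where f: "finite F" "\<forall>n. n \<notin> F \<longrightarrow> c n = 0" "f = (\<lambda>x. \<Sum>n\<in>F. c n *\<^sub>R V n x)"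
    using assms by (auto simp: in_span_def)
  obtain G d where g: "finite G" "\<forall>n. n \<notin> G \<longrightarrow> d n = 0" "g = (\<lambda>x. \<Sum>n\<in>G. d n *\<^sub>R V n x)"
    using assms by (auto simp: in_span_def)
  have "f x = (\<Sum>n\<in>F \<union> G. c n *\<^sub>R V n x)" "g x = (\<Sum>n\<in>F \<union> G. d n *\<^sub>R V n x)" for x
    unfolding f(3) g(3) using f(1,2) g(1,2) by (intro sum.mono_neutral_left; auto)+
  then have "(\<lambda>x. f x + g x) = (\<lambda>x. \<Sum>n\<in>F \<union> G. (c n + d n) *\<^sub>R V n x)"
    by (simp add: scaleR_add_left sum.distrib)
  then show ?thesis unfolding in_span_def using f(1,2) g(1,2)
    by (intro exI[of _ "F \<union> G"] exI[of _ "\<lambda>n. c n + d n"]) auto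
qed

lemma in_span_sum: "(\<And>i. i \<in> I \<Longrightarrow> in_span (f i)) \<Longrightarrow> in_span (\<lambda>x. \<Sum>i\<in>I. f i x)"
  by (induction I rule: infinite_finite_induct) (auto intro: in_span_0 in_span_add)

lemma in_span_bdd_borel: "in_span f \<Longrightarrow> bdd_borel f"
  unfolding in_span_def by (auto intro!: bdd_borel_sum bdd_borel_cscaleR bdd_borel_V)

lemma B_V_of_sum:
  assumes "finite F" "\<forall>n. n \<notin> F \<longrightarrow> c n = 0"
  shows "B (\<lambda>x. \<Sum>n\<in>F. c n *\<^sub>R V n x) (V m) = c m / w m"
proof -
  have "B (\<lambda>x. \<Sum>n\<in>F. c n *\<^sub>R V n x) (V m) = (\<Sum>n\<in>F. c n * (if n = m then 1 / w m else 0))"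
    by (simp add: B_sum_left bdd_borel_cscaleR bdd_borel_V B_cscaleR_left orth)
  also have "\<dots> = (\<Sum>n\<in>F. if n = m then c n / w m else 0)" by (intro sum.cong) auto
  finally show ?thesis using assms by (simp add: sum.delta)
qed

end

lemma (in ortho_chain) in_span_mult_x:
  assumes "in_span f" shows "in_span (\<lambda>x. x *\<^sub>R f x)"
proof -
  obtain F c where f: "finite F" "f = (\<lambda>x. \<Sum>n\<in>F. c n *\<^sub>R V n x)"
    using assms by (auto simp: in_span_def)
  have "(\<lambda>x. x *\<^sub>R f x) = (\<lambda>x. \<Sum>n\<in>F. c n *\<^sub>R (p n *\<^sub>R V (n + 1) x + r n *\<^sub>R V n x + q n *\<^sub>R V (n - 1) x))"
    unfolding f(2) V_rec[symmetric] by (simp add: scaleR_sum_right mult.commute)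
  then show ?thesis
    by (simp only:) (intro in_span_sum in_span_cscaleR in_span_add in_span_V)
qed

lemma (in ortho_chain) in_span_poly:
  assumes "in_span f" shows "in_span (\<lambda>x. poly P x *\<^sub>R f x)"
proof (induction P)
  case (pCons a P)
  have "(\<lambda>x. poly (pCons a P) x *\<^sub>R f x) = (\<lambda>x. a *\<^sub>R f x + x *\<^sub>R (poly P x *\<^sub>R f x))"
    by (simp add: scaleR_add_left)
  then show ?case using assms pCons(2) by (simp only:) (intro in_span_add in_span_cscaleR in_span_mult_x)
qed (simp add: in_span_0)

text \<open>
  The tridiagonal matrix is the product of an upper bidiagonal matrix with entries \<open>Y\<close> (diagonal) and \<open>X\<close>,
  and a lower bidiagonal one with entries \<open>S\<close> (diagonal) and \<open>T\<close>. The vectors \<open>\<phi>\<close> are the image of the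
  solutions \<open>V\<close> under the lower factor; the upper factor maps them back to \<open>x *\<^sub>R V n x\<close>. The numbers
  \<open>h n\<close> will be the squared norms of \<open>\<phi> n\<close> for the weight \<open>M x / x\<close>.
\<close>

locale ul_chain = ortho_chain +
  fixes X Y S T :: "int \<Rightarrow> real"
  assumes X_pos: "0 < X n" and Y_pos: "0 < Y n" and S_pos: "0 < S n" and T_pos: "0 < T n"
    and p_eq: "p n = X n * S (n + 1)" and q_eq: "q n = Y n * T n"
    and r_eq: "r n = Y n * S n + X n * T (n + 1)"
begin

definition \<phi> :: "int \<Rightarrow> real \<Rightarrow> real^2" where "\<phi> n x = S n *\<^sub>R V n x + T n *\<^sub>R V (n - 1) x"

definition h :: "int \<Rightarrow> real" where "h n = S n / (w n * Y n)"

lemma h_pos: "0 < h n"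
  by (simp add: h_def S_pos w_pos Y_pos)

lemma h_Suc: "h (n + 1) = T (n + 1) / (w n * X n)"
proof -
  have "w (n + 1) * (Y (n + 1) * T (n + 1)) = w n * (X n * S (n + 1))"
    using w_Suc[of n] by (simp only: p_eq q_eq)
  moreover have "w n \<noteq> 0" "w (n + 1) \<noteq> 0" "X n \<noteq> 0" "Y (n + 1) \<noteq> 0"
    using w_pos[of n] w_pos[of "n + 1"] X_pos[of n] Y_pos[of "n + 1"] by auto
  ultimately show ?thesis unfolding h_def by (simp add: frac_eq_eq mult_ac)
qed

lemma x_V: "x *\<^sub>R V n x = Y n *\<^sub>R \<phi> n x + X n *\<^sub>R \<phi> (n + 1) x"
  unfolding V_rec \<phi>_def p_eq q_eq r_eq by (simp add: algebra_simps)

lemma cont_\<phi>: "continuous_on UNIV (\<phi> n)"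
  unfolding \<phi>_def by (intro continuous_intros cont_V)

lemma bdd_borel_\<phi>: "bdd_borel (\<phi> n)"
  by (rule bdd_borel_continuous[OF cont_\<phi>])

lemma in_span_\<phi>: "in_span (\<phi> n)"
  unfolding \<phi>_def by (intro in_span_add in_span_cscaleR in_span_V)

lemma B_\<phi>: "bdd_borel f \<Longrightarrow> B f (\<phi> n) = S n * B f (V n) + T n * B f (V (n - 1))"
  unfolding \<phi>_def by (simp add: B_add_right bdd_borel_cscaleR bdd_borel_V B_cscaleR_right)

text \<open>
  With respect to the weights \<open>w\<close> and \<open>1 / h\<close> the two bidiagonal factors are adjoint to each other. If \<open>f\<close> has
  the coordinates \<open>w n * d n\<close>, then multiplication by \<open>x\<close> acts on \<open>d\<close> as the tridiagonal matrix, so that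
  \<open>B (x f) f\<close> is the sum of \<open>(e n)\<^sup>2 / h n\<close>, where \<open>e = B f \<circ> \<phi>\<close> is the image of \<open>d\<close> under the lower factor.
\<close>

lemma factor_bound:
  assumes "in_span f"
  shows "0 \<le> B (\<lambda>x. x *\<^sub>R f x) f" "(B f (\<phi> i))\<^sup>2 \<le> h i * B (\<lambda>x. x *\<^sub>R f x) f"
proof -
  obtain F c where f: "finite F" "\<forall>n. n \<notin> F \<longrightarrow> c n = 0" "f = (\<lambda>x. \<Sum>n\<in>F. c n *\<^sub>R V n x)"
    using assms by (auto simp: in_span_def)
  note nf = in_span_bdd_borel[OF assms]
  define d where "d n = B f (V n)" for n
  define e where "e n = B f (\<phi> n)" for n
  have d: "d n = c n / w n" for n unfolding d_def f(3) by (rule B_V_of_sum[OF f(1,2)])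
  have d0: "d n = 0" if "n \<notin> F" for n using that f(2) by (simp add: d)
  have e: "e n = S n * d n + T n * d (n - 1)" for n unfolding e_def d_def by (rule B_\<phi>[OF nf])
  define F' where "F' = F \<union> (\<lambda>n. n + 1) ` F"
  have F': "finite F'" using f(1) by (simp add: F'_def)
  have e0: "e n = 0" if "n \<notin> F'" for n
  proof -
    have "n \<notin> F" "n - 1 \<notin> F" using that by (auto simp: F'_def image_iff)
    then show ?thesis by (simp add: e d0)
  qed
  have xV: "B (\<lambda>x. x *\<^sub>R V n x) f = Y n * e n + X n * e (n + 1)" for n
    unfolding x_V e_def using nf
    by (simp add: B_add_left bdd_borel_cscaleR bdd_borel_\<phi> B_cscaleR_left B_commute[of f])
  have xV': "bdd_borel (\<lambda>x. x *\<^sub>R V n x)" for n by (rule bdd_borel_scaleR[OF bdd_borel_id bdd_borel_V])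
  have "(\<lambda>x. x *\<^sub>R f x) = (\<lambda>x. \<Sum>n\<in>F. c n *\<^sub>R (x *\<^sub>R V n x))"
    unfolding f(3) by (simp add: scaleR_sum_right mult.commute)
  then have "B (\<lambda>x. x *\<^sub>R f x) f = (\<Sum>n\<in>F. c n * (Y n * e n + X n * e (n + 1)))"
    using nf xV' by (simp only: B_sum_left bdd_borel_cscaleR B_cscaleR_left xV)
  also have "\<dots> = (\<Sum>n\<in>F. S n * d n * e n / h n) + (\<Sum>n\<in>F. T (n + 1) * d n * e (n + 1) / h (n + 1))"
    unfolding sum.distrib[symmetric]
  proof (rule sum.cong[OF refl])
    fix n assume "n \<in> F"
    have nz: "w n \<noteq> 0" "X n \<noteq> 0" "Y n \<noteq> 0" "S n \<noteq> 0" "T (n + 1) \<noteq> 0"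
      using w_pos[of n] X_pos[of n] Y_pos[of n] S_pos[of n] T_pos[of "n + 1"] by auto
    have "S n * d n * e n / h n = c n * (Y n * e n)"
      using nz by (simp add: d h_def)
    moreover have "T (n + 1) * d n * e (n + 1) / h (n + 1) = c n * (X n * e (n + 1))"
      unfolding h_Suc using nz by (simp add: d)
    ultimately show "c n * (Y n * e n + X n * e (n + 1)) = S n * d n * e n / h n + T (n + 1) * d n * e (n + 1) / h (n + 1)"
      by (simp add: distrib_left)
  qed
  also have "(\<Sum>n\<in>F. S n * d n * e n / h n) = (\<Sum>n\<in>F'. S n * d n * e n / h n)"
    using F' d0 by (intro sum.mono_neutral_left) (auto simp: F'_def)
  also have "(\<Sum>n\<in>F. T (n + 1) * d n * e (n + 1) / h (n + 1)) = (\<Sum>n\<in>(\<lambda>n. n + 1) ` F. T n * d (n - 1) * e n / h n)"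
    by (subst sum.reindex) (auto simp: inj_on_def)
  also have "\<dots> = (\<Sum>n\<in>F'. T n * d (n - 1) * e n / h n)"
  proof (rule sum.mono_neutral_left)
    show "\<forall>n\<in>F' - (\<lambda>n. n + 1) ` F. T n * d (n - 1) * e n / h n = 0"
    proof
      fix n assume "n \<in> F' - (\<lambda>n. n + 1) ` F"
      then have "n - 1 \<notin> F" by (auto simp: image_iff)
      then show "T n * d (n - 1) * e n / h n = 0" by (simp add: d0)
    qed
  qed (use F' in \<open>auto simp: F'_def\<close>)
  also have "(\<Sum>n\<in>F'. S n * d n * e n / h n) + (\<Sum>n\<in>F'. T n * d (n - 1) * e n / h n) = (\<Sum>n\<in>F'. (e n)\<^sup>2 / h n)"
    unfolding sum.distrib[symmetric] by (intro sum.cong) (auto simp: e power2_eq_square algebra_simps add_divide_distrib)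
  finally have sum: "B (\<lambda>x. x *\<^sub>R f x) f = (\<Sum>n\<in>F'. (e n)\<^sup>2 / h n)" .
  have nn: "0 \<le> (e n)\<^sup>2 / h n" for n using h_pos[of n] by simp
  show "0 \<le> B (\<lambda>x. x *\<^sub>R f x) f" unfolding sum by (rule sum_nonneg) (rule nn)
  have "(e i)\<^sup>2 / h i \<le> B (\<lambda>x. x *\<^sub>R f x) f"
  proof (cases "i \<in> F'")
    case True
    then show ?thesis unfolding sum using F' nn by (intro member_le_sum) auto
  next
    case False
    then show ?thesis using e0 sum_nonneg[of F' "\<lambda>n. (e n)\<^sup>2 / h n"] nn by (simp add: sum)
  qed
  then show "(B f (\<phi> i))\<^sup>2 \<le> h i * B (\<lambda>x. x *\<^sub>R f x) f"
    using h_pos[of i] by (simp add: e_def pos_divide_le_eq mult.commute)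
qed

text \<open>
  The inequality \<open>0 \<le> B (x f) f\<close> is tested with \<open>f = (1 - x) ^ k *\<^sub>R axis i 1\<close>. On \<open>[0, 1]\<close> these functions are
  bounded by 1, while on \<open>x \<le> - \<epsilon>\<close> they grow exponentially with \<open>k\<close>.
\<close>

lemma support_nonneg: "AE x in \<mu>. x < 0 \<longrightarrow> M x = 0"
proof -
  have entry: "AE x in \<mu>. x \<le> - \<epsilon> \<longrightarrow> M x $ i $ i = 0" if \<epsilon>: "0 < \<epsilon>" for i \<epsilon>
  proof -
    let ?m = "\<lambda>x. M x $ i $ i"
    let ?A = "{..-\<epsilon>}" let ?P = "{0..}"
    have im: "integrable \<mu> (\<lambda>x. indicator A x * ?m x)" if "A \<in> sets borel" for A
      by (intro integrable_entry bdd_borel_indicator that)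
    have mnn: "AE x in \<mu>. 0 \<le> ?m x" by (rule eventually_mono[OF psd]) (rule pos_semidef_diag_nonneg)
    define a where "a = (\<integral>x. indicator ?A x * ?m x \<partial>\<mu>)"
    define b where "b = (\<integral>x. indicator ?P x * ?m x \<partial>\<mu>)"
    have a0: "0 \<le> a" unfolding a_def by (intro integral_nonneg_AE eventually_mono[OF mnn]) auto
    have main: "\<epsilon> * ((1 + \<epsilon>)\<^sup>2) ^ k * a \<le> b" for k
    proof -
      let ?f = "\<lambda>x. (1 - x) ^ k *\<^sub>R axis i 1 :: real^2"
      obtain n where n: "V n = (\<lambda>x. axis i 1)"
      proof -
        have "V (if i = 1 then 0 else - 1) = (\<lambda>x. axis i 1)"
          using exhaust_2[of i] by (auto simp: V_0 V_m1)
        then show thesis using that by blast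
      qed
      have "?f = (\<lambda>x. poly ([:1, -1:] ^ k) x *\<^sub>R V n x)" by (simp add: n poly_power)
      then have "in_span ?f" using in_span_poly[OF in_span_V[of n], of "[:1, -1:] ^ k"] by simp
      then have "0 \<le> B (\<lambda>x. x *\<^sub>R ?f x) ?f" by (rule factor_bound)
      also have "B (\<lambda>x. x *\<^sub>R ?f x) ?f = (\<integral>x. (x * ((1 - x) ^ k * (1 - x) ^ k)) * ?m x \<partial>\<mu>)"
        unfolding B_def by (intro Bochner_Integration.integral_cong)
          (simp_all add: matrix_vector_mult_scaleR inner_axis_mat)
      also have "\<dots> \<le> (\<integral>x. indicator ?P x * ?m x - (\<epsilon> * ((1 + \<epsilon>)\<^sup>2) ^ k) * (indicator ?A x * ?m x) \<partial>\<mu>)"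
      proof (rule integral_mono_AE)
        show "integrable \<mu> (\<lambda>x. (x * ((1 - x) ^ k * (1 - x) ^ k)) * ?m x)"
          by (intro integrable_entry bdd_borel_continuous continuous_intros)
        show "integrable \<mu> (\<lambda>x. indicator ?P x * ?m x - (\<epsilon> * ((1 + \<epsilon>)\<^sup>2) ^ k) * (indicator ?A x * ?m x))"
          by (intro Bochner_Integration.integrable_diff integrable_mult_right im) auto
        show "AE x in \<mu>. (x * ((1 - x) ^ k * (1 - x) ^ k)) * ?m x
            \<le> indicator ?P x * ?m x - (\<epsilon> * ((1 + \<epsilon>)\<^sup>2) ^ k) * (indicator ?A x * ?m x)"
          using mnn supp
        proof eventually_elim
          case (elim x)
          show ?case
          proof (cases "x \<in> {-1..1}")
            case x: True
            have "x * ((1 - x) ^ k * (1 - x) ^ k) \<le> indicator ?P x - (\<epsilon> * ((1 + \<epsilon>)\<^sup>2) ^ k) * indicator ?A x"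
            proof (cases "0 \<le> x")
              case True
              have "(1 - x) ^ k * (1 - x) ^ k \<le> 1" using x True by (intro mult_le_one power_le_one) auto
              then have "x * ((1 - x) ^ k * (1 - x) ^ k) \<le> 1 * 1"
                using x True by (intro mult_mono) (auto intro: mult_nonneg_nonneg)
              then show ?thesis using True \<epsilon> by simp
            next
              case False
              have sq: "(1 - x) ^ k * (1 - x) ^ k = ((1 - x)\<^sup>2) ^ k"
                by (simp add: power2_eq_square power_mult_distrib)
              show ?thesis
              proof (cases "x \<le> - \<epsilon>")
                case True
                have "((1 + \<epsilon>)\<^sup>2) ^ k \<le> ((1 - x)\<^sup>2) ^ k" using True \<epsilon> by (intro power_mono) auto
                then have "\<epsilon> * ((1 + \<epsilon>)\<^sup>2) ^ k \<le> (- x) * ((1 - x)\<^sup>2) ^ k"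
                  using True \<epsilon> by (intro mult_mono) auto
                then show ?thesis using True False by (simp add: sq)
              next
                case 2: False
                have "x * ((1 - x)\<^sup>2) ^ k \<le> 0" using False by (intro mult_nonpos_nonneg) auto
                then show ?thesis using 2 False by (simp add: sq)
              qed
            qed
            from mult_right_mono[OF this elim(1)] show ?thesis by (simp add: left_diff_distrib mult.assoc)
          next
            case False
            then show ?thesis using elim(2) by simp
          qed
        qed
      qed
      also have "\<dots> = b - \<epsilon> * ((1 + \<epsilon>)\<^sup>2) ^ k * a"
        unfolding a_def b_def using im by simp
      finally show ?thesis by simp
    qed
    have "a = 0"
    proof (rule ccontr)
      assume "a \<noteq> 0"
      then have a: "0 < a" using a0 by simp
      have g1: "1 < (1 + \<epsilon>)\<^sup>2" using \<epsilon> by (simp add: power2_eq_square algebra_simps add_pos_pos)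
      obtain k where "b / (\<epsilon> * a) < ((1 + \<epsilon>)\<^sup>2) ^ k" using real_arch_pow[OF g1] by blast
      then show False using main[of k] a \<epsilon> by (simp add: pos_divide_less_eq mult_ac)
    qed
    then have "AE x in \<mu>. indicator ?A x * ?m x = 0"
      unfolding a_def by (subst (asm) integral_nonneg_eq_0_iff_AE[OF im]) (auto intro!: eventually_mono[OF mnn])
    then show ?thesis by (rule eventually_mono) (auto simp: indicator_def split: if_splits)
  qed
  have "AE x in \<mu>. \<forall>n::nat. (x \<le> - inverse (real (Suc n)) \<longrightarrow> M x $ 1 $ 1 = 0) \<and> (x \<le> - inverse (real (Suc n)) \<longrightarrow> M x $ 2 $ 2 = 0)"
    unfolding AE_all_countable by (intro allI eventually_conj entry) auto
  with psd show ?thesis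
  proof eventually_elim
    case (elim x)
    show ?case
    proof
      assume "x < 0"
      then obtain n where "inverse (real (Suc n)) < - x" using reals_Archimedean[of "- x"] by auto
      then have "M x $ 1 $ 1 = 0" "M x $ 2 $ 2 = 0" using elim(2)[rule_format, of n] by auto
      then show "M x = 0" using pos_semidef_trace_0[OF elim(1)] by simp
    qed
  qed
qed

end


section \<open>The Darboux transformation of a weight\<close>

lemma int_rec_zero:
  fixes F :: "int \<Rightarrow> 'a::zero"
  assumes "F 0 = 0" "\<And>n. F n = 0 \<Longrightarrow> F (n + 1) = 0" "\<And>n. F (n + 1) = 0 \<Longrightarrow> F n = 0"
  shows "F n = 0"
proof (induction n rule: int_induct[where k=0])
  case (step2 i)
  then show ?case using assms(3)[of "i - 1"] by simp
qed (use assms in auto)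

lemma integrable_matrixI:
  fixes M :: "real \<Rightarrow> real^2^2"
  assumes "\<And>i j. integrable \<mu> (\<lambda>x. M x $ i $ j)"
  shows "integrable \<mu> M"
proof -
  have "M x = (\<Sum>i\<in>UNIV. \<Sum>j\<in>UNIV. M x $ i $ j *\<^sub>R axis i (axis j 1))" for x
    by (auto simp: vec_eq_iff forall_2 sum_2 axis_def)
  then have "M = (\<lambda>x. \<Sum>i\<in>UNIV. \<Sum>j\<in>UNIV. M x $ i $ j *\<^sub>R axis i (axis j 1))" by blast
  moreover have "integrable \<mu> (\<lambda>x. \<Sum>i\<in>UNIV. \<Sum>j\<in>UNIV. M x $ i $ j *\<^sub>R (axis i (axis j 1) :: real^2^2))"
    using assms by (intro Bochner_Integration.integrable_sum integrable_scaleR_left) auto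
  ultimately show ?thesis by metis
qed

locale positive_ul_chain = ul_chain +
  assumes supp_pos: "AE x in \<mu>. x \<le> 0 \<longrightarrow> M x = 0"
begin

text \<open>
  The polynomials \<open>K k x = (\<Sum>j<k. (1 - x) ^ j)\<close> increase to \<open>1 / x\<close> and satisfy \<open>x * K k x \<le> 1\<close> on \<open>(0, 1]\<close>.
  Applying the second part of \<open>factor_bound\<close> to \<open>f = K k *\<^sub>R \<phi> i\<close> gives \<open>I\<^sup>2 \<le> h i * I\<close> for the
  integral \<open>I\<close> of \<open>K k x * (\<phi> i x \<bullet> (M x *v \<phi> i x))\<close>, hence \<open>I \<le> h i\<close>, and the claims follow by monotone
  convergence.
\<close>

lemma gram_diag:
  shows "integrable \<mu> (\<lambda>x. (\<phi> i x \<bullet> (M x *v \<phi> i x)) / x)" (is ?I)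
    and "(\<integral>x. (\<phi> i x \<bullet> (M x *v \<phi> i x)) / x \<partial>\<mu>) \<le> h i"
proof -
  define g where "g x = \<phi> i x \<bullet> (M x *v \<phi> i x)" for x
  define K where "K k x = (\<Sum>j<k. (1 - x) ^ j)" for k and x :: real
  have xK: "x * K k x = 1 - (1 - x) ^ k" for k x
    using one_diff_power_eq[of "1 - x" k] by (simp add: K_def)
  have KP: "K k x = poly (\<Sum>j<k. [:1, -1:] ^ j) x" for k x
    by (simp add: K_def poly_sum poly_power)
  have nK: "bdd_borel (K k)" for k unfolding K_def by (intro bdd_borel_continuous continuous_intros)
  have good: "AE x in \<mu>. (0 < x \<and> x \<le> 1 \<and> 0 \<le> g x) \<or> g x = 0"
    using psd supp supp_pos
  proof eventually_elim
    case (elim x)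
    then show ?case by (cases "0 < x \<and> x \<le> 1") (auto simp: g_def pos_semidef_iff)
  qed
  have Kg: "integrable \<mu> (\<lambda>x. K k x * g x)" for k
    using integrable_form[OF bdd_borel_scaleR[OF nK bdd_borel_\<phi>] bdd_borel_\<phi>, of k i i] by (simp add: g_def)
  have xKKg: "integrable \<mu> (\<lambda>x. (x * K k x) * (K k x * g x))" for k
    using integrable_form[OF bdd_borel_scaleR[OF bdd_borel_mult[OF bdd_borel_id nK] bdd_borel_\<phi>] bdd_borel_scaleR[OF nK bdd_borel_\<phi>], of k i k i]
    by (simp add: g_def matrix_vector_mult_scaleR mult_ac)
  have K01: "0 \<le> K k x" "x * K k x \<le> 1" if "0 < x" "x \<le> 1" for k x
    using that unfolding xK by (auto simp: K_def intro!: sum_nonneg)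
  define I where "I k = (\<integral>x. K k x * g x \<partial>\<mu>)" for k
  have I0: "0 \<le> I k" for k
    unfolding I_def
  proof (intro integral_nonneg_AE eventually_mono[OF good])
    fix x assume "(0 < x \<and> x \<le> 1 \<and> 0 \<le> g x) \<or> g x = 0"
    then show "0 \<le> K k x * g x" using K01(1)[of x k] by auto
  qed
  have Ih: "I k \<le> h i" for k
  proof -
    let ?f = "\<lambda>x. K k x *\<^sub>R \<phi> i x"
    have f: "in_span ?f" unfolding KP by (rule in_span_poly[OF in_span_\<phi>])
    have "(B ?f (\<phi> i))\<^sup>2 \<le> h i * B (\<lambda>x. x *\<^sub>R ?f x) ?f" by (rule factor_bound[OF f])
    moreover have "B ?f (\<phi> i) = I k" unfolding B_def I_def g_def by simp
    moreover have "B (\<lambda>x. x *\<^sub>R ?f x) ?f = (\<integral>x. (x * K k x) * (K k x * g x) \<partial>\<mu>)"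
      unfolding B_def g_def
      by (intro Bochner_Integration.integral_cong) (simp_all add: matrix_vector_mult_scaleR mult_ac)
    moreover have "(\<integral>x. (x * K k x) * (K k x * g x) \<partial>\<mu>) \<le> I k"
      unfolding I_def
    proof (intro integral_mono_AE xKKg Kg eventually_mono[OF good])
      fix x assume "(0 < x \<and> x \<le> 1 \<and> 0 \<le> g x) \<or> g x = 0"
      then show "(x * K k x) * (K k x * g x) \<le> K k x * g x"
        using mult_right_mono[OF K01(2)[of x k], of "K k x * g x"] K01(1)[of x k] by auto
    qed
    ultimately have "(I k)\<^sup>2 \<le> h i * (\<integral>x. (x * K k x) * (K k x * g x) \<partial>\<mu>)"
      "(\<integral>x. (x * K k x) * (K k x * g x) \<partial>\<mu>) \<le> I k" by simp_all
    then have "(I k)\<^sup>2 \<le> h i * I k"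
      using h_pos[of i] by (meson order_trans mult_left_mono less_imp_le)
    then show ?thesis
      using I0[of k] h_pos[of i] mult_right_le_imp_le[of "I k" "I k" "h i"]
      by (cases "I k = 0") (auto simp: power2_eq_square)
  qed
  have mono: "AE x in \<mu>. mono (\<lambda>k. K k x * g x)"
  proof (rule eventually_mono[OF good])
    fix x assume x: "(0 < x \<and> x \<le> 1 \<and> 0 \<le> g x) \<or> g x = 0"
    show "mono (\<lambda>k. K k x * g x)"
      unfolding mono_iff_le_Suc using x
      by (cases "g x = 0") (auto intro!: mult_right_mono simp: K_def)
  qed
  have lim: "AE x in \<mu>. (\<lambda>k. K k x * g x) \<longlonglongrightarrow> g x / x"
  proof (rule eventually_mono[OF good])
    fix x assume x: "(0 < x \<and> x \<le> 1 \<and> 0 \<le> g x) \<or> g x = 0"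
    show "(\<lambda>k. K k x * g x) \<longlonglongrightarrow> g x / x"
    proof (cases "g x = 0")
      case False
      then have x: "0 < x" "x \<le> 1" using x by auto
      have "K k x = (1 - (1 - x) ^ k) / x" for k using xK[of x k] x by (simp add: field_simps)
      moreover have "(\<lambda>k. (1 - (1 - x) ^ k) / x * g x) \<longlonglongrightarrow> (1 - 0) / x * g x"
        using x by (intro tendsto_intros LIMSEQ_realpow_zero) auto
      ultimately show ?thesis by simp
    qed simp
  qed
  have "incseq I"
    unfolding incseq_Suc_iff I_def
    by (intro allI integral_mono_AE Kg eventually_mono[OF mono]) (auto simp: mono_iff_le_Suc)
  then obtain L where L: "I \<longlonglongrightarrow> L" "L \<le> h i"
    using incseq_convergent[of I "h i"] Ih LIMSEQ_le_const2 by metis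
  have "(\<lambda>x. g x / x) \<in> borel_measurable \<mu>"
    using Kg[of 1] bdd_borel_measurable[OF bdd_borel_id]
    by (auto dest: borel_measurable_integrable simp: K_def intro!: borel_measurable_divide)
  note mc = integral_monotone_convergence[OF Kg mono lim L(1)[unfolded I_def] this]
    integrable_monotone_convergence[OF Kg mono lim L(1)[unfolded I_def] this]
  show ?I using mc(2) by (simp add: g_def)
  show "(\<integral>x. (\<phi> i x \<bullet> (M x *v \<phi> i x)) / x \<partial>\<mu>) \<le> h i" using mc(1) L(2) by (simp add: g_def)
qed

definition G :: "int \<Rightarrow> int \<Rightarrow> real" where
  "G i j = (\<integral>x. (\<phi> i x \<bullet> (M x *v \<phi> j x)) / x \<partial>\<mu>)"

lemma gram_integrable: "integrable \<mu> (\<lambda>x. (\<phi> i x \<bullet> (M x *v \<phi> j x)) / x)"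
proof (rule Bochner_Integration.integrable_bound)
  show "integrable \<mu> (\<lambda>x. (\<phi> i x \<bullet> (M x *v \<phi> i x)) / x + (\<phi> j x \<bullet> (M x *v \<phi> j x)) / x)"
    by (intro Bochner_Integration.integrable_add gram_diag)
  show "(\<lambda>x. (\<phi> i x \<bullet> (M x *v \<phi> j x)) / x) \<in> borel_measurable \<mu>"
    using borel_measurable_integrable[OF integrable_form[OF bdd_borel_\<phi> bdd_borel_\<phi>]] bdd_borel_measurable[OF bdd_borel_id]
    by (intro borel_measurable_divide)
  show "AE x in \<mu>. norm ((\<phi> i x \<bullet> (M x *v \<phi> j x)) / x)
      \<le> norm ((\<phi> i x \<bullet> (M x *v \<phi> i x)) / x + (\<phi> j x \<bullet> (M x *v \<phi> j x)) / x)"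
    using psd supp_pos
  proof eventually_elim
    case (elim x)
    show ?case
    proof (cases "0 < x")
      case True
      have nn: "0 \<le> \<phi> i x \<bullet> (M x *v \<phi> i x)" "0 \<le> \<phi> j x \<bullet> (M x *v \<phi> j x)"
        using elim(1) by (auto simp: pos_semidef_iff)
      have "\<bar>\<phi> i x \<bullet> (M x *v \<phi> j x)\<bar> \<le> \<phi> i x \<bullet> (M x *v \<phi> i x) + \<phi> j x \<bullet> (M x *v \<phi> j x)"
        using pos_semidef_inner_le[OF elim(1), of "\<phi> i x" "\<phi> j x"] nn by linarith
      then show ?thesis using True nn
        unfolding add_divide_distrib[symmetric] real_norm_def abs_divide by (simp add: divide_right_mono)
    qed (use elim(2) in auto)
  qed
qed

lemma gram_sum_nonneg:
  assumes "finite F"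
  shows "0 \<le> (\<Sum>n\<in>F. \<Sum>m\<in>F. c n * c m * G n m)"
proof -
  have "0 \<le> (\<integral>x. (\<Sum>n\<in>F. \<Sum>m\<in>F. c n * c m * ((\<phi> n x \<bullet> (M x *v \<phi> m x)) / x)) \<partial>\<mu>)"
  proof (rule integral_nonneg_AE)
    show "AE x in \<mu>. 0 \<le> (\<Sum>n\<in>F. \<Sum>m\<in>F. c n * c m * ((\<phi> n x \<bullet> (M x *v \<phi> m x)) / x))"
      using psd supp_pos
    proof eventually_elim
      case (elim x)
      let ?v = "\<Sum>n\<in>F. c n *\<^sub>R \<phi> n x"
      have lin: "M x *v ?v = (\<Sum>m\<in>F. c m *\<^sub>R (M x *v \<phi> m x))"
        by (simp add: linear_sum[OF matrix_vector_mul_linear] o_def matrix_vector_mult_scaleR)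
      have "(\<Sum>n\<in>F. \<Sum>m\<in>F. c n * c m * ((\<phi> n x \<bullet> (M x *v \<phi> m x)) / x)) = (?v \<bullet> (M x *v ?v)) / x"
        unfolding lin inner_sum_left inner_sum_right sum_divide_distrib
        by (subst sum.swap) (intro sum.cong, auto simp: mult_ac)
      also have "\<dots> \<ge> 0" using elim by (cases "0 < x") (auto simp: pos_semidef_iff)
      finally show ?case .
    qed
  qed
  also have "\<dots> = (\<Sum>n\<in>F. \<Sum>m\<in>F. c n * c m * G n m)"
    unfolding G_def
    by (subst Bochner_Integration.integral_sum, (intro Bochner_Integration.integrable_sum integrable_mult_right gram_integrable),
        subst Bochner_Integration.integral_sum, (intro integrable_mult_right gram_integrable))
      (simp only: integral_mult_right_zero)
  finally show ?thesis .
qed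

lemma G_commute: "G i j = G j i"
  unfolding G_def
  by (intro integral_cong_AE borel_measurable_integrable gram_integrable eventually_mono[OF psd])
    (auto dest: pos_semidef_inner_commute)

lemma G_step: "Y n * G n j + X n * G (n + 1) j = B (V n) (\<phi> j)"
proof -
  have "Y n * G n j + X n * G (n + 1) j
      = (\<integral>x. Y n * ((\<phi> n x \<bullet> (M x *v \<phi> j x)) / x) + X n * ((\<phi> (n + 1) x \<bullet> (M x *v \<phi> j x)) / x) \<partial>\<mu>)"
    unfolding G_def
    by (subst Bochner_Integration.integral_add[OF integrable_mult_right[OF gram_integrable] integrable_mult_right[OF gram_integrable]])
      (simp only: integral_mult_right_zero)
  also have "\<dots> = (\<integral>x. V n x \<bullet> (M x *v \<phi> j x) \<partial>\<mu>)"
  proof (intro integral_cong_AE borel_measurable_integrable Bochner_Integration.integrable_add integrable_mult_right gram_integrable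
      integrable_form bdd_borel_V bdd_borel_\<phi>)
    show "AE x in \<mu>. Y n * ((\<phi> n x \<bullet> (M x *v \<phi> j x)) / x) + X n * ((\<phi> (n + 1) x \<bullet> (M x *v \<phi> j x)) / x)
        = V n x \<bullet> (M x *v \<phi> j x)"
    proof (rule eventually_mono[OF supp_pos])
      fix x assume x: "x \<le> 0 \<longrightarrow> M x = 0"
      show "Y n * ((\<phi> n x \<bullet> (M x *v \<phi> j x)) / x) + X n * ((\<phi> (n + 1) x \<bullet> (M x *v \<phi> j x)) / x)
        = V n x \<bullet> (M x *v \<phi> j x)"
      proof (cases "x \<le> 0")
        case False
        have "x * (V n x \<bullet> (M x *v \<phi> j x)) = (x *\<^sub>R V n x) \<bullet> (M x *v \<phi> j x)" by simp
        also have "\<dots> = Y n * (\<phi> n x \<bullet> (M x *v \<phi> j x)) + X n * (\<phi> (n + 1) x \<bullet> (M x *v \<phi> j x))"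
          unfolding x_V by (simp only: inner_add_left inner_scaleR_left)
        finally show ?thesis using False by (simp add: field_simps)
      qed (use x in simp)
    qed
  qed
  finally show ?thesis unfolding B_def .
qed

text \<open>
  Multiplying by the upper factor and using \<open>x *\<^sub>R V n x = Y n *\<^sub>R \<phi> n x + X n *\<^sub>R \<phi> (n + 1) x\<close> shows that each
  column of \<open>D i j = G i j - (if i = j then h i else 0)\<close> lies in the kernel of that factor, so that
  \<open>D n m = f n * f m * D 0 0\<close>, where \<open>f\<close> spans the kernel. The bound on the diagonal yields \<open>D 0 0 \<le> 0\<close>. If this
  were strict, positivity of the Gram matrix \<open>G\<close>, tested on the vector \<open>f / h\<close> cut off at \<open>N\<close>, would bound the
  partial sums of \<open>f\<^sup>2 / h\<close> by \<open>- 1 / D 0 0\<close>.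
\<close>

lemma gram_eq:
  assumes div: "\<not> summable (\<lambda>n::nat. (\<Prod>k<n. Y (int k) / X (int k))\<^sup>2 / h (int n))"
  shows "G i j = (if i = j then h i else 0)"
proof -
  define D where "D i j = G i j - (if i = j then h i else 0)" for i j
  have D_comm: "D i j = D j i" for i j by (simp add: D_def G_commute[of i j])
  have D_step: "Y n * D n j + X n * D (n + 1) j = 0" for n j
  proof -
    have nz: "w n \<noteq> 0" "X n \<noteq> 0" "Y n \<noteq> 0"
      using w_pos[of n] X_pos[of n] Y_pos[of n] by auto
    have "B (V n) (\<phi> j) = (if n = j then S n / w n else 0) + (if n = j - 1 then T (n + 1) / w n else 0)"
      by (auto simp: B_\<phi>[OF bdd_borel_V] orth)
    also have "(if n = j then S n / w n else 0) = Y n * (if n = j then h n else 0)"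
      using nz by (cases "n = j") (simp_all add: h_def)
    also have "(if n = j - 1 then T (n + 1) / w n else 0) = X n * (if n + 1 = j then h (n + 1) else 0)"
      using nz unfolding h_Suc by (cases "n + 1 = j") auto
    finally show ?thesis using G_step[of n j] unfolding D_def by (simp only: right_diff_distrib)
  qed
  \<comment> \<open>The sequence in the kernel of the upper factor with \<open>f 0 = 1\<close>.\<close>
  define f where "f n = (\<Prod>k<n. - (Y (int k) / X (int k)))" for n
  have f2: "(f n)\<^sup>2 = (\<Prod>k<n. Y (int k) / X (int k))\<^sup>2" for n
    by (simp add: f_def prod_power_distrib[symmetric] power2_eq_square flip: prod.distrib)
  have Df: "D (int n) j = f n * D 0 j" for n j
  proof (induction n)
    case (Suc n)
    have "D (int n + 1) j = - (Y (int n) / X (int n)) * D (int n) j"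
      using D_step[of "int n" j] X_pos[of "int n"] by (simp add: field_simps)
    then show ?case using Suc by (simp add: f_def add.commute)
  qed (simp add: f_def)
  have Dff: "D (int n) (int m) = f n * f m * D 0 0" for n m
    by (simp add: Df[of n "int m"] D_comm[of 0 "int m"] Df[of m 0])
  have D00: "D 0 0 = 0"
  proof (rule ccontr)
    assume "D 0 0 \<noteq> 0"
    moreover have "D 0 0 \<le> 0" using gram_diag(2)[of 0] by (simp add: D_def G_def)
    ultimately have neg: "D 0 0 < 0" by simp
    have "summable (\<lambda>n. (f n)\<^sup>2 / h (int n))"
    proof (rule summableI_nonneg_bounded)
      fix N
      define s where "s = (\<Sum>n<N. (f n)\<^sup>2 / h (int n))"
      have s0: "0 \<le> s" unfolding s_def using h_pos by (intro sum_nonneg) (simp add: less_imp_le)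
      \<comment> \<open>The vector at which the quadratic form of \<open>G\<close> is \<open>s + D 0 0 * s\<^sup>2\<close>.\<close>
      define c where "c k = f (nat k) / h k" for k
      have Gnm: "G (int n) (int m) = f n * f m * D 0 0 + (if n = m then h (int n) else 0)" for n m
        using Dff[of n m] by (auto simp: D_def)
      have "0 \<le> (\<Sum>n\<in>int ` {..<N}. \<Sum>m\<in>int ` {..<N}. c n * c m * G n m)" by (rule gram_sum_nonneg) simp
      also have "\<dots> = (\<Sum>n<N. \<Sum>m<N. f n / h (int n) * (f m / h (int m)) * G (int n) (int m))"
        by (simp add: sum.reindex c_def)
      also have "\<dots> = (\<Sum>n<N. \<Sum>m<N. D 0 0 * (((f n)\<^sup>2 / h (int n)) * ((f m)\<^sup>2 / h (int m))) + (if n = m then (f n)\<^sup>2 / h (int n) else 0))"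
      proof (intro sum.cong refl)
        fix n m
        show "f n / h (int n) * (f m / h (int m)) * G (int n) (int m)
          = D 0 0 * (((f n)\<^sup>2 / h (int n)) * ((f m)\<^sup>2 / h (int m))) + (if n = m then (f n)\<^sup>2 / h (int n) else 0)"
          unfolding Gnm using h_pos[of "int n"] h_pos[of "int m"]
          by (auto simp: power2_eq_square field_simps)
      qed
      also have "\<dots> = D 0 0 * s\<^sup>2 + s"
      proof -
        have "(\<Sum>n<N. \<Sum>m<N. D 0 0 * (((f n)\<^sup>2 / h (int n)) * ((f m)\<^sup>2 / h (int m)))) = D 0 0 * (s * s)"
        proof -
          have "s * s = (\<Sum>n<N. \<Sum>m<N. ((f n)\<^sup>2 / h (int n)) * ((f m)\<^sup>2 / h (int m)))"
            unfolding s_def sum_product ..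
          then show ?thesis by (simp only: sum_distrib_left)
        qed
        moreover have "(\<Sum>n<N. \<Sum>m<N. if n = m then (f n)\<^sup>2 / h (int n) else 0) = s"
          by (simp add: s_def)
        ultimately show ?thesis by (simp only: sum.distrib power2_eq_square)
      qed
      finally have "(- D 0 0 * s) * s \<le> 1 * s" by (simp add: power2_eq_square)
      then have "- D 0 0 * s \<le> 1" using s0 mult_right_le_imp_le[of "- D 0 0 * s" s 1] by (cases "s = 0") auto
      then show "s \<le> 1 / - D 0 0" using neg by (simp only: pos_le_divide_eq mult.commute)
    qed (use h_pos in \<open>simp add: less_imp_le\<close>)
    with div show False unfolding f2 by contradiction
  qed
  have zero: "D n j = 0" if "D 0 j = 0" for n j
  proof (rule int_rec_zero[where F="\<lambda>n. D n j", OF that])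
    show "D (n + 1) j = 0" if "D n j = 0" for n using D_step[of n j] X_pos[of n] that by simp
    show "D n j = 0" if "D (n + 1) j = 0" for n using D_step[of n j] Y_pos[of n] that by simp
  qed
  have "D 0 j = 0" using zero[OF D00, of j] D_comm by simp
  then have "D i j = 0" by (rule zero)
  then show ?thesis by (simp add: D_def)
qed

text \<open>
  The matrix polynomial whose rows are \<open>\<phi> 0\<close> and \<open>\<phi> (- 1)\<close>, followed by the transformed weight.
\<close>

definition S_poly :: "real \<Rightarrow> real^2^2" where
  "S_poly x = vector [vector [S 0, T 0], vector [- (X (- 1) * S 0) / Y (- 1), (x - X (- 1) * T 0) / Y (- 1)]]"

definition M_tilde :: "real \<Rightarrow> real^2^2" where
  "M_tilde x = (Y 0 / S 0) *\<^sub>R (S_poly x ** ((1 / x) *\<^sub>R M x) ** transpose (S_poly x))"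

lemma S_poly_axis: "transpose (S_poly x) *v axis 1 1 = \<phi> 0 x" "transpose (S_poly x) *v axis 2 1 = \<phi> (- 1) x"
proof -
  have p0: "\<phi> 0 x = S 0 *\<^sub>R axis 1 1 + T 0 *\<^sub>R axis 2 1" by (simp add: \<phi>_def V_0 V_m1)
  show "transpose (S_poly x) *v axis 1 1 = \<phi> 0 x" unfolding p0
    by (simp add: S_poly_def vec_eq_iff forall_2 matrix_vector_mult_def transpose_def sum_2 axis_def)
  have y: "Y (- 1) \<noteq> 0" using Y_pos[of "- 1"] by simp
  have "x *\<^sub>R axis 2 1 = Y (- 1) *\<^sub>R \<phi> (- 1) x + X (- 1) *\<^sub>R \<phi> 0 x"
    using x_V[of x "- 1"] by (simp add: V_m1)
  then have "(1 / Y (- 1)) *\<^sub>R (Y (- 1) *\<^sub>R \<phi> (- 1) x) = (1 / Y (- 1)) *\<^sub>R (x *\<^sub>R axis 2 1 - X (- 1) *\<^sub>R \<phi> 0 x)"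
    by (simp add: algebra_simps)
  then have "\<phi> (- 1) x = (1 / Y (- 1)) *\<^sub>R (x *\<^sub>R axis 2 1 - X (- 1) *\<^sub>R \<phi> 0 x)"
    using y by simp
  then show "transpose (S_poly x) *v axis 2 1 = \<phi> (- 1) x" unfolding p0
    by (simp add: S_poly_def vec_eq_iff forall_2 matrix_vector_mult_def transpose_def sum_2 axis_def diff_divide_distrib)
qed

lemma M_tilde_form: "v \<bullet> (M_tilde x *v u) = (Y 0 / S 0) * (((transpose (S_poly x) *v v) \<bullet> (M x *v (transpose (S_poly x) *v u))) / x)"
proof -
  have "v \<bullet> (S_poly x *v z) = (transpose (S_poly x) *v v) \<bullet> z" for z
    by (simp only: dot_lmul_matrix transpose_matrix_vector)
  then show ?thesis
    unfolding M_tilde_def scaleR_matrix_vector_assoc[symmetric] matrix_vector_mul_assoc[symmetric] inner_scaleR_right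
    by simp
qed

definition \<kappa> :: "2 \<Rightarrow> int" where "\<kappa> i = (if i = 1 then 0 else - 1)"

lemma S_poly_axis': "transpose (S_poly x) *v axis i 1 = \<phi> (\<kappa> i) x"
  using exhaust_2[of i] S_poly_axis by (auto simp: \<kappa>_def)

lemma weight_M_tilde: "weight \<mu> M_tilde"
proof
  show "sets \<mu> = sets borel" by (rule sets_\<mu>)
  show "integrable \<mu> M_tilde"
  proof (rule integrable_matrixI)
    fix i j
    have "M_tilde x $ i $ j = (Y 0 / S 0) * ((\<phi> (\<kappa> i) x \<bullet> (M x *v \<phi> (\<kappa> j) x)) / x)" for x
      unfolding inner_axis_mat[symmetric] M_tilde_form S_poly_axis' ..
    then show "integrable \<mu> (\<lambda>x. M_tilde x $ i $ j)"
      by (simp only:) (intro integrable_mult_right gram_integrable)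
  qed
  show "AE x in \<mu>. pos_semidef (M_tilde x)"
    using psd supp_pos
  proof eventually_elim
    case (elim x)
    have c: "0 \<le> Y 0 / S 0" using Y_pos[of 0] S_pos[of 0] by simp
    show ?case
      unfolding pos_semidef_iff
    proof
      show "M_tilde x $ 1 $ 2 = M_tilde x $ 2 $ 1"
        unfolding inner_axis_mat[symmetric] M_tilde_form using pos_semidef_inner_commute[OF elim(1)] by simp
      show "\<forall>v. 0 \<le> v \<bullet> (M_tilde x *v v)"
      proof
        fix v
        show "0 \<le> v \<bullet> (M_tilde x *v v)"
        proof (cases "0 < x")
          case True
          then show ?thesis unfolding M_tilde_form
            by (intro mult_nonneg_nonneg[OF c divide_nonneg_pos]) (use elim in \<open>auto simp: pos_semidef_iff\<close>)
        qed (use elim in \<open>simp add: M_tilde_form\<close>)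
      qed
    qed
  qed
  show "AE x in \<mu>. x \<notin> {-1..1} \<longrightarrow> M_tilde x = 0"
    by (rule eventually_mono[OF supp]) (auto simp: M_tilde_def)
qed

text \<open>
  The products in the opposite order give the recurrence of the \<open>\<phi> n\<close>. As \<open>transpose (S_poly x) *v Vt n x\<close>
  obeys the same recurrence with the same values at \<open>0\<close> and \<open>- 1\<close>, the two agree, and orthogonality of the
  \<open>Vt n\<close> for \<open>M_tilde\<close> is \<open>gram_eq\<close>.
\<close>

lemma darboux_chain:
  assumes div: "\<not> summable (\<lambda>n::nat. (\<Prod>k<n. Y (int k) / X (int k))\<^sup>2 / h (int n))"
    and cont: "\<And>n. continuous_on UNIV (Vt n)"
    and Vt_rec: "\<And>x n. x *\<^sub>R Vt n x = (S n * X n) *\<^sub>R Vt (n + 1) x + (S n * Y n + T n * X (n - 1)) *\<^sub>R Vt n x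
      + (T n * Y (n - 1)) *\<^sub>R Vt (n - 1) x"
    and Vt_0: "\<And>x. Vt 0 x = axis 1 1" "\<And>x. Vt (- 1) x = axis 2 1"
  shows "ortho_chain \<mu> M_tilde Vt (\<lambda>n. h 0 / h n) (\<lambda>n. S n * X n) (\<lambda>n. S n * Y n + T n * X (n - 1)) (\<lambda>n. T n * Y (n - 1))"
proof -
  interpret t: weight \<mu> M_tilde by (rule weight_M_tilde)
  have \<phi>_rec: "x *\<^sub>R \<phi> n x = (S n * X n) *\<^sub>R \<phi> (n + 1) x + (S n * Y n + T n * X (n - 1)) *\<^sub>R \<phi> n x
      + (T n * Y (n - 1)) *\<^sub>R \<phi> (n - 1) x" for x n
  proof -
    have "x *\<^sub>R \<phi> n x = S n *\<^sub>R (x *\<^sub>R V n x) + T n *\<^sub>R (x *\<^sub>R V (n - 1) x)"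
      unfolding \<phi>_def[of n] by (simp add: scaleR_add_right mult.commute)
    then show ?thesis unfolding x_V by (simp add: algebra_simps)
  qed
  have SX: "S n * X n \<noteq> 0" "T n * Y (n - 1) \<noteq> 0" for n
    using S_pos[of n] X_pos[of n] T_pos[of n] Y_pos[of "n - 1"] by auto
  define E where "E n x = transpose (S_poly x) *v Vt n x - \<phi> n x" for n x
  have E_rec: "x *\<^sub>R E n x = (S n * X n) *\<^sub>R E (n + 1) x + (S n * Y n + T n * X (n - 1)) *\<^sub>R E n x
      + (T n * Y (n - 1)) *\<^sub>R E (n - 1) x" for n x
  proof -
    have "x *\<^sub>R (transpose (S_poly x) *v Vt n x) = transpose (S_poly x) *v (x *\<^sub>R Vt n x)"
      by (simp add: matrix_vector_mult_scaleR)
    then show ?thesis unfolding E_def scaleR_diff_right \<phi>_rec[of x n] Vt_rec[of x n]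
      by (simp add: matrix_vector_right_distrib matrix_vector_mult_scaleR algebra_simps)
  qed
  have "(E n x, E (n - 1) x) = 0" for n x
  proof (rule int_rec_zero[where F="\<lambda>n. (E n x, E (n - 1) x)"])
    show "(E 0 x, E (0 - 1) x) = 0" by (simp only: E_def Vt_0 S_poly_axis zero_prod_def diff_0 diff_self)
    show "(E (n + 1) x, E (n + 1 - 1) x) = 0" if "(E n x, E (n - 1) x) = 0" for n
      using that E_rec[of x n] SX[of n] by (simp add: zero_prod_def)
    show "(E n x, E (n - 1) x) = 0" if "(E (n + 1) x, E (n + 1 - 1) x) = 0" for n
      using that E_rec[of x n] SX[of n] by (simp add: zero_prod_def)
  qed
  then have Vt_\<phi>: "transpose (S_poly x) *v Vt n x = \<phi> n x" for n x
    by (simp add: zero_prod_def E_def)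
  have h0: "h 0 = S 0 / Y 0" by (simp add: h_def w_0)
  show ?thesis
  proof
    show "continuous_on UNIV (Vt n)" for n by (rule cont)
    show "0 < h 0 / h n" for n using h_pos by simp
    show "t.B (Vt i) (Vt j) = (if i = j then 1 / (h 0 / h j) else 0)" for i j
    proof -
      have "t.B (Vt i) (Vt j) = (\<integral>x. (Y 0 / S 0) * ((\<phi> i x \<bullet> (M x *v \<phi> j x)) / x) \<partial>\<mu>)"
        unfolding t.B_def M_tilde_form Vt_\<phi> ..
      also have "\<dots> = (Y 0 / S 0) * G i j" unfolding G_def by (rule integral_mult_right_zero)
      finally show ?thesis unfolding gram_eq[OF div] by (simp add: h0)
    qed
    show "0 < S n * X n" "0 < T n * Y (n - 1)" for n
      using S_pos[of n] X_pos[of n] T_pos[of n] Y_pos[of "n - 1"] by auto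
    show "h 0 / h 0 = 1" using h_pos[of 0] by simp
    show "h 0 / h (n + 1) * (T (n + 1) * Y (n + 1 - 1)) = h 0 / h n * (S n * X n)" for n
    proof -
      have nz: "w n \<noteq> 0" "X n \<noteq> 0" "Y n \<noteq> 0" "S n \<noteq> 0" "T (n + 1) \<noteq> 0"
        using w_pos[of n] X_pos[of n] Y_pos[of n] S_pos[of n] T_pos[of "n + 1"] by auto
      have "T (n + 1) * Y n / h (n + 1) = S n * X n / h n"
        unfolding h_Suc unfolding h_def using nz by (simp add: field_simps)
      then have "h 0 * (T (n + 1) * Y n / h (n + 1)) = h 0 * (S n * X n / h n)" by (simp only:)
      then show ?thesis by simp
    qed
    show "x *\<^sub>R Vt n x = (S n * X n) *\<^sub>R Vt (n + 1) x + (S n * Y n + T n * X (n - 1)) *\<^sub>R Vt n x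
      + (T n * Y (n - 1)) *\<^sub>R Vt (n - 1) x" for x n by (rule Vt_rec)
    show "Vt 0 x = axis 1 1" "Vt (- 1) x = axis 2 1" for x by (rule Vt_0)+
  qed
qed

end


section \<open>Tridiagonal matrices and their spectral matrices\<close>

lemma pot_0: "pot P 0 = 1"
  by (simp add: pot_def)

lemma pot_Suc:
  assumes nz: "\<And>n. P n (n + 1) \<noteq> 0" "\<And>n. P n (n - 1) \<noteq> 0"
  shows "pot P (n + 1) * P (n + 1) n = pot P n * P n (n + 1)"
proof -
  have nz': "P (n + 1) n \<noteq> 0" for n using nz(2)[of "n + 1"] by simp
  consider "0 \<le> n" | "n = - 1" | "n < - 1" by linarith
  then show ?thesis
  proof cases
    case 1
    have "{0..<n + 1} = insert n {0..<n}" "{1..n + 1} = insert (n + 1) {1..n}" using 1 by auto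
    then have "(\<Prod>k\<in>{0..<n + 1}. P k (k + 1)) = P n (n + 1) * (\<Prod>k\<in>{0..<n}. P k (k + 1))"
      "(\<Prod>k\<in>{1..n + 1}. P k (k - 1)) = P (n + 1) n * (\<Prod>k\<in>{1..n}. P k (k - 1))" by auto
    then show ?thesis using 1 nz'[of n] by (simp add: pot_def)
  next
    case 2
    then show ?thesis using nz(1)[of "- 1"] by (simp add: pot_def)
  next
    case 3
    have "{n + 1..0} = insert (n + 1) {n + 2..0}" "{n..-1} = insert n {n + 1..-1}" using 3 by auto
    then have "(\<Prod>k\<in>{n + 1..0}. P k (k - 1)) = P (n + 1) n * (\<Prod>k\<in>{n + 2..0}. P k (k - 1))"
      "(\<Prod>k\<in>{n..-1}. P k (k + 1)) = P n (n + 1) * (\<Prod>k\<in>{n + 1..-1}. P k (k + 1))" by auto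
    then show ?thesis using 3 nz(1)[of n] by (simp add: pot_def add.commute add.left_commute)
  qed
qed

lemma pot_pos:
  assumes "\<And>n. 0 < P n (n + 1)" "\<And>n. 0 < P n (n - 1)"
  shows "0 < pot P n"
  using assms by (auto simp: pot_def intro!: divide_pos_pos prod_pos)

lemma pot_unique:
  assumes "\<And>n. 0 < P n (n + 1)" "\<And>n. 0 < P n (n - 1)"
    and w: "w 0 = 1" "\<And>n. w (n + 1) * P (n + 1) n = w n * P n (n + 1)"
  shows "w n = pot P n"
proof -
  have nz: "P n (n + 1) \<noteq> 0" "P n (n - 1) \<noteq> 0" "P (n + 1) n \<noteq> 0" for n
    using assms(1)[of n] assms(2)[of n] assms(2)[of "n + 1"] by auto
  have e: "(w (n + 1) - pot P (n + 1)) * P (n + 1) n = (w n - pot P n) * P n (n + 1)" for n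
    using w(2)[of n] pot_Suc[of P n, OF nz(1,2)] by (simp add: algebra_simps)
  have "w n - pot P n = 0"
    by (rule int_rec_zero[where F="\<lambda>n. w n - pot P n"])
      (use e nz in \<open>auto simp: w(1) pot_0\<close>, metis e nz(3) mult_eq_0_iff mult_zero_left right_minus_eq, metis e nz(1) mult_eq_0_iff mult_zero_left right_minus_eq)
  then show ?thesis by simp
qed

text \<open>
  The polynomials at \<open>(n, n - 1)\<close> and, for the backward recursion, at \<open>(- n - 1, - n)\<close>; the argument \<open>z\<close> holds
  the initial polynomials at \<open>0\<close> and \<open>- 1\<close>.
\<close>

primrec forward_Q :: "dimat \<Rightarrow> real poly \<times> real poly \<Rightarrow> nat \<Rightarrow> real poly \<times> real poly" where
  "forward_Q P z 0 = z"
| "forward_Q P z (Suc n) = (let (a, b) = forward_Q P z n; k = int n in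
     (smult (1 / P k (k + 1)) ([:0, 1:] * a - smult (P k k) a - smult (P k (k - 1)) b), a))"

primrec backward_Q :: "dimat \<Rightarrow> real poly \<times> real poly \<Rightarrow> nat \<Rightarrow> real poly \<times> real poly" where
  "backward_Q P z 0 = (snd z, fst z)"
| "backward_Q P z (Suc n) = (let (a, b) = backward_Q P z n; k = - int n - 1 in
     (smult (1 / P k (k - 1)) ([:0, 1:] * a - smult (P k k) a - smult (P k (k + 1)) b), a))"

lemma Q_system_exists:
  assumes nz: "\<And>n. P n (n + 1) \<noteq> 0" "\<And>n. P n (n - 1) \<noteq> 0"
  obtains Q where "Q_system P Q"
proof -
  define z :: "2 \<Rightarrow> real poly \<times> real poly" where "z \<eta> = (if \<eta> = 1 then (1, 0) else (0, 1))" for \<eta>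
  define Q where "Q \<eta> n = (if 0 \<le> n then fst (forward_Q P (z \<eta>) (nat n)) else fst (backward_Q P (z \<eta>) (nat (- n - 1))))" for \<eta> n
  have sf: "snd (forward_Q P (z \<eta>) n) = Q \<eta> (int n - 1)" for \<eta> n
    by (cases n) (auto simp: Q_def Let_def split_beta)
  have sb: "snd (backward_Q P (z \<eta>) n) = Q \<eta> (- int n)" for \<eta> n
    by (cases n) (auto simp: Q_def Let_def split_beta)
  have "[:0, 1:] * Q \<eta> n = smult (P n (n + 1)) (Q \<eta> (n + 1)) + smult (P n n) (Q \<eta> n) + smult (P n (n - 1)) (Q \<eta> (n - 1))" for \<eta> n
  proof (cases "0 \<le> n")
    case True
    then obtain m where m: "n = int m" using nonneg_int_cases by blast
    have a: "fst (forward_Q P (z \<eta>) m) = Q \<eta> n" by (simp add: Q_def m)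
    have "Q \<eta> (n + 1) = fst (forward_Q P (z \<eta>) (Suc m))" by (simp add: Q_def m nat_add_distrib)
    also have "\<dots> = smult (1 / P n (n + 1)) ([:0, 1:] * Q \<eta> n - smult (P n n) (Q \<eta> n) - smult (P n (n - 1)) (Q \<eta> (n - 1)))"
      using sf[of \<eta> m] a by (simp add: Let_def split_beta m)
    finally have "smult (P n (n + 1)) (Q \<eta> (n + 1)) = [:0, 1:] * Q \<eta> n - smult (P n n) (Q \<eta> n) - smult (P n (n - 1)) (Q \<eta> (n - 1))"
      using nz(1)[of n] by simp
    then show ?thesis by simp
  next
    case False
    define m where "m = nat (- n - 1)"
    have m: "n = - int m - 1" using False by (simp add: m_def)
    have a: "fst (backward_Q P (z \<eta>) m) = Q \<eta> n" by (simp add: Q_def m)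
    have "Q \<eta> (n - 1) = fst (backward_Q P (z \<eta>) (Suc m))" by (simp add: Q_def m nat_add_distrib)
    also have "\<dots> = smult (1 / P n (n - 1)) ([:0, 1:] * Q \<eta> n - smult (P n n) (Q \<eta> n) - smult (P n (n + 1)) (Q \<eta> (n + 1)))"
      using sb[of \<eta> m] a by (simp add: Let_def split_beta m)
    finally have "smult (P n (n - 1)) (Q \<eta> (n - 1)) = [:0, 1:] * Q \<eta> n - smult (P n n) (Q \<eta> n) - smult (P n (n + 1)) (Q \<eta> (n + 1))"
      using nz(2)[of n] by simp
    then show ?thesis by simp
  qed
  then have "Q_system P Q" unfolding Q_system_def by (auto simp: Q_def z_def)
  then show thesis by (rule that)
qed

definition vec_Q :: "(2 \<Rightarrow> int \<Rightarrow> real poly) \<Rightarrow> int \<Rightarrow> real \<Rightarrow> real^2" where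
  "vec_Q Q n x = (\<chi> \<eta>. poly (Q \<eta> n) x)"

lemma cont_vec_Q: "continuous_on UNIV (vec_Q Q n)"
  unfolding vec_Q_def by (intro continuous_intros)

lemma vec_Q_rec:
  assumes "Q_system P Q"
  shows "x *\<^sub>R vec_Q Q n x = P n (n + 1) *\<^sub>R vec_Q Q (n + 1) x + P n n *\<^sub>R vec_Q Q n x + P n (n - 1) *\<^sub>R vec_Q Q (n - 1) x"
    and "vec_Q Q 0 x = axis 1 1" and "vec_Q Q (- 1) x = axis 2 1"
proof -
  have e: "[:0, 1:] * Q \<eta> n = smult (P n (n + 1)) (Q \<eta> (n + 1)) + smult (P n n) (Q \<eta> n) + smult (P n (n - 1)) (Q \<eta> (n - 1))" for \<eta>
    using assms by (auto simp: Q_system_def)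
  have "x * poly (Q \<eta> n) x = P n (n + 1) * poly (Q \<eta> (n + 1)) x + P n n * poly (Q \<eta> n) x + P n (n - 1) * poly (Q \<eta> (n - 1)) x" for \<eta>
    using arg_cong[OF e[of \<eta>], of "\<lambda>p. poly p x"] by simp
  then show "x *\<^sub>R vec_Q Q n x = P n (n + 1) *\<^sub>R vec_Q Q (n + 1) x + P n n *\<^sub>R vec_Q Q n x + P n (n - 1) *\<^sub>R vec_Q Q (n - 1) x"
    by (simp add: vec_eq_iff vec_Q_def)
  show "vec_Q Q 0 x = axis 1 1" "vec_Q Q (- 1) x = axis 2 1"
    using assms by (auto simp: vec_eq_iff forall_2 vec_Q_def Q_system_def axis_def)
qed

lemma weight_of_represents:
  assumes R: "represents \<mu> M \<Psi>" and "sigma_finite_measure \<mu>" and "supported_on \<Psi> {-1..1}"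
  shows "weight \<mu> M"
  using R represents_support[OF assms] by unfold_locales (auto simp: represents_def)

lemma sum_entry_integral_eq:
  assumes R: "represents \<mu> M \<Psi>" and W: "weight \<mu> M"
  shows "(\<Sum>\<eta>\<in>UNIV. \<Sum>\<zeta>\<in>UNIV. entry_integral \<Psi> \<eta> \<zeta> (\<lambda>x. poly (Q \<eta> i) x * poly (Q \<zeta> j) x))
     = weight.B \<mu> M (vec_Q Q i) (vec_Q Q j)"
proof -
  interpret weight \<mu> M by fact
  have n: "bdd_borel (vec_Q Q k)" for k by (rule bdd_borel_continuous[OF cont_vec_Q])
  have "entry_integral \<Psi> \<eta> \<zeta> (\<lambda>x. poly (Q \<eta> i) x * poly (Q \<zeta> j) x)
      = (\<integral>x. (vec_Q Q i x $ \<eta> * vec_Q Q j x $ \<zeta>) * M x $ \<eta> $ \<zeta> \<partial>\<mu>)" for \<eta> \<zeta>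
  proof -
    have "bdd_borel (\<lambda>x. poly (Q \<eta> i) x * poly (Q \<zeta> j) x)" by (intro bdd_borel_mult bdd_borel_poly)
    then show ?thesis
      by (subst entry_integral_eq[OF R _ integrable_scaleR_M]) (auto simp: bdd_borel_def vec_Q_def)
  qed
  then show ?thesis using sum_entries_eq_B[OF n n] by simp
qed

lemma spectral_matrix_chain:
  assumes R: "represents \<mu> M \<Psi>" and W: "weight \<mu> M" and S: "spectral_matrix P \<Psi>"
    and pos: "\<And>n. 0 < P n (n + 1)" "\<And>n. 0 < P n (n - 1)"
  obtains V where "ortho_chain \<mu> M V (pot P) (\<lambda>n. P n (n + 1)) (\<lambda>n. P n n) (\<lambda>n. P n (n - 1))"
proof -
  interpret weight \<mu> M by fact
  obtain Q where Q: "Q_system P Q" "\<And>i j. (\<Sum>\<eta>\<in>UNIV. \<Sum>\<zeta>\<in>UNIV.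
      entry_integral \<Psi> \<eta> \<zeta> (\<lambda>x. poly (Q \<eta> i) x * poly (Q \<zeta> j) x)) = (if i = j then 1 / pot P j else 0)"
    using S by (auto simp: spectral_matrix_def)
  have nz: "P n (n + 1) \<noteq> 0" "P n (n - 1) \<noteq> 0" for n using pos[of n] by auto
  have "ortho_chain \<mu> M (vec_Q Q) (pot P) (\<lambda>n. P n (n + 1)) (\<lambda>n. P n n) (\<lambda>n. P n (n - 1))"
  proof
    show "B (vec_Q Q i) (vec_Q Q j) = (if i = j then 1 / pot P j else 0)" for i j
      using Q(2)[of i j] unfolding sum_entry_integral_eq[OF R W] .
    show "pot P (n + 1) * P (n + 1) (n + 1 - 1) = pot P n * P n (n + 1)" for n
      using pot_Suc[of P n, OF nz] by simp
  qed (use pos vec_Q_rec[OF Q(1)] pot_pos[of P, OF pos] in \<open>simp_all add: cont_vec_Q pot_0\<close>)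
  then show thesis by (rule that)
qed

text \<open>
  The moments of the density are functions of the entries of \<open>P\<close>, and a compactly supported measure is
  determined by its moments.
\<close>

lemma spectral_matrix_unique:
  assumes S: "spectral_matrix P \<Psi>" "spectral_matrix P \<Psi>'"
    and pos: "\<And>n. 0 < P n (n + 1)" "\<And>n. 0 < P n (n - 1)"
  shows "\<Psi> = \<Psi>'"
proof -
  have "\<exists>\<mu> M. weight \<mu> M \<and> represents \<mu> M \<Psi> \<and> (\<forall>k i j. (\<integral>x. x ^ k * M x $ i $ j \<partial>\<mu>)
      = chain_moment (\<lambda>n. P n (n + 1)) (\<lambda>n. P n n) (\<lambda>n. P n (n - 1)) (pot P) k (if i = 1 then 0 else - 1) (if j = 1 then 0 else - 1))"
    if S: "spectral_matrix P \<Psi>" for \<Psi>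
  proof -
    obtain \<mu> M where m: "finite_measure \<mu>" "represents \<mu> M \<Psi>"
      using matrix_measure_represents S unfolding spectral_matrix_def by metis
    interpret finite_measure \<mu> by fact
    have W: "weight \<mu> M"
      using S sigma_finite_measure_axioms by (intro weight_of_represents[OF m(2)]) (auto simp: spectral_matrix_def)
    obtain V where V: "ortho_chain \<mu> M V (pot P) (\<lambda>n. P n (n + 1)) (\<lambda>n. P n n) (\<lambda>n. P n (n - 1))"
      by (rule spectral_matrix_chain[OF m(2) W S pos]) (rule that)
    interpret ortho_chain \<mu> M V "pot P" "\<lambda>n. P n (n + 1)" "\<lambda>n. P n n" "\<lambda>n. P n (n - 1)" by (rule V)
    show ?thesis using W m(2) moment_eq by blast
  qed
  note rep = this
  obtain \<mu> M where 1: "weight \<mu> M" "represents \<mu> M \<Psi>" "\<And>k i j. (\<integral>x. x ^ k * M x $ i $ j \<partial>\<mu>)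
      = chain_moment (\<lambda>n. P n (n + 1)) (\<lambda>n. P n n) (\<lambda>n. P n (n - 1)) (pot P) k (if i = 1 then 0 else - 1) (if j = 1 then 0 else - 1)"
    using rep[OF S(1)] by auto
  obtain \<mu>' M' where 2: "weight \<mu>' M'" "represents \<mu>' M' \<Psi>'" "\<And>k i j. (\<integral>x. x ^ k * M' x $ i $ j \<partial>\<mu>')
      = chain_moment (\<lambda>n. P n (n + 1)) (\<lambda>n. P n n) (\<lambda>n. P n (n - 1)) (pot P) k (if i = 1 then 0 else - 1) (if j = 1 then 0 else - 1)"
    using rep[OF S(2)] by auto
  show ?thesis by (rule represents_unique[OF 1(1,2) 2(1,2)]) (simp only: 1(3) 2(3))
qed

section \<open>Growth of products of linear factors\<close>

text \<open>
  The expansion \<open>f n = 1 + c / n + o(1/n)\<close>. The exponents \<open>c\<close> add up in products, which gives the growth of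
  products of quotients of linear factors without the Gamma function.
\<close>

definition ratio_exp :: "real \<Rightarrow> (nat \<Rightarrow> real) \<Rightarrow> bool" where
  "ratio_exp c f \<longleftrightarrow> (\<lambda>n. real n * (f n - 1)) \<longlonglongrightarrow> c"

lemma tendsto_n_over: "(\<lambda>n. real n / (real n + b)) \<longlonglongrightarrow> 1"
proof -
  have "(\<lambda>n. 1 - b / (real n + b)) \<longlonglongrightarrow> 1 - 0"
    by (intro tendsto_intros tendsto_divide_0[OF tendsto_const] filterlim_at_top_imp_at_infinity
        filterlim_tendsto_add_at_top[OF tendsto_const, of _ _ b, unfolded add.commute[of b]] filterlim_real_sequentially)
  moreover have "eventually (\<lambda>n. 1 - b / (real n + b) = real n / (real n + b)) sequentially"
  proof -
    obtain N where N: "\<bar>b\<bar> < real N" using reals_Archimedean2 by blast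
    have "1 - b / (real n + b) = real n / (real n + b)" if "n \<ge> N" for n
    proof -
      have "real n + b \<noteq> 0" using N that by linarith
      then show ?thesis by (simp add: field_simps)
    qed
    then show ?thesis by (auto simp: eventually_sequentially)
  qed
  ultimately show ?thesis by (simp add: tendsto_cong)
qed

lemma ratio_exp_tendsto_1:
  assumes "ratio_exp c f" shows "f \<longlonglongrightarrow> 1"
proof -
  have "(\<lambda>n. 1 / real n * (real n * (f n - 1))) \<longlonglongrightarrow> 0 * c"
    using assms lim_1_over_n by (intro tendsto_mult) (auto simp: ratio_exp_def)
  moreover have "eventually (\<lambda>n. 1 / real n * (real n * (f n - 1)) = f n - 1) sequentially"
    using eventually_gt_at_top[of 0] by eventually_elim simp
  ultimately have "(\<lambda>n. f n - 1) \<longlonglongrightarrow> 0" by (simp add: tendsto_cong)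
  then show ?thesis by (simp add: LIM_zero_iff)
qed

lemma ratio_exp_mult:
  assumes "ratio_exp c f" "ratio_exp d g"
  shows "ratio_exp (c + d) (\<lambda>n. f n * g n)"
proof -
  have "(\<lambda>n. real n * (f n - 1) * g n + real n * (g n - 1)) \<longlonglongrightarrow> c * 1 + d"
    using assms ratio_exp_tendsto_1[OF assms(2)] by (intro tendsto_intros) (auto simp: ratio_exp_def)
  then show ?thesis by (simp add: ratio_exp_def algebra_simps)
qed

lemma ratio_exp_linear: "ratio_exp (a - b) (\<lambda>n. (real n + a) / (real n + b))"
proof -
  have "(\<lambda>n. (a - b) * (real n / (real n + b))) \<longlonglongrightarrow> (a - b) * 1"
    by (intro tendsto_mult tendsto_const tendsto_n_over)
  moreover have "eventually (\<lambda>n. (a - b) * (real n / (real n + b)) = real n * ((real n + a) / (real n + b) - 1)) sequentially"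
  proof -
    obtain N where N: "\<bar>b\<bar> < real N" using reals_Archimedean2 by blast
    have "(a - b) * (real n / (real n + b)) = real n * ((real n + a) / (real n + b) - 1)" if "n \<ge> N" for n
    proof -
      have "real n + b \<noteq> 0" using N that by linarith
      then show ?thesis by (simp add: field_simps)
    qed
    then show ?thesis by (auto simp: eventually_sequentially)
  qed
  ultimately show ?thesis by (simp add: ratio_exp_def tendsto_cong)
qed

text \<open>
  Raabe's test: the sequence \<open>n * c n\<close> is eventually increasing.
\<close>

lemma raabe_divergence:
  fixes c :: "nat \<Rightarrow> real"
  assumes pos: "\<And>n. 0 < c n" and ratio: "\<And>n. c (Suc n) = f n * c n"
    and f: "ratio_exp d f" "- 1 < d"
  shows "\<not> summable c" and "LIM n sequentially. (\<Sum>k<n. c k) :> at_top"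
proof -
  have "(\<lambda>n. real n * (f n - 1) + f n) \<longlonglongrightarrow> d + 1"
    using f ratio_exp_tendsto_1[OF f(1)] by (intro tendsto_add) (auto simp: ratio_exp_def)
  then have "eventually (\<lambda>n. 0 < real n * (f n - 1) + f n) sequentially"
    using f(2) by (intro order_tendstoD) auto
  then obtain N where N: "\<And>n. n \<ge> N \<Longrightarrow> 0 < real n * (f n - 1) + f n" by (auto simp: eventually_sequentially)
  define m where "m = max N 1"
  have inc: "real n * c n \<le> real (Suc n) * c (Suc n)" if "n \<ge> m" for n
  proof -
    have "real n \<le> real (Suc n) * f n" using N[of n] that by (simp add: m_def algebra_simps)
    from mult_right_mono[OF this, of "c n"] show ?thesis using pos[of n] by (simp add: ratio mult.assoc)
  qed
  define \<kappa> where "\<kappa> = real m * c m"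
  have \<kappa>: "0 < \<kappa>" using pos[of m] by (simp add: \<kappa>_def m_def)
  have lb: "\<kappa> \<le> real n * c n" if "n \<ge> m" for n
    using that
  proof (induction n rule: dec_induct)
    case (step n)
    then show ?case using inc[of n] by linarith
  qed (simp add: \<kappa>_def)
  show ns: "\<not> summable c"
  proof
    assume "summable c"
    then have "summable (\<lambda>n. \<kappa> * inverse (real n))"
    proof (rule summable_comparison_test_ev[rotated])
      have "norm (\<kappa> * inverse (real n)) \<le> c n" if "n \<ge> m" for n
      proof -
        have "0 < real n" using that by (simp add: m_def)
        then show ?thesis using lb[OF that] \<kappa> by (simp add: field_simps)
      qed
      then show "eventually (\<lambda>n. norm (\<kappa> * inverse (real n)) \<le> c n) sequentially"
        by (auto simp: eventually_sequentially)
    qed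
    then have "summable (\<lambda>n. inverse (real n))" using \<kappa> by (simp add: summable_cmult_iff)
    then show False using not_summable_harmonic[where 'a=real] by (simp add: inverse_eq_divide summable_Suc_iff)
  qed
  show "LIM n sequentially. (\<Sum>k<n. c k) :> at_top"
    unfolding filterlim_at_top
  proof
    fix Z
    have "\<exists>n. Z < (\<Sum>k<n. c k)"
    proof (rule ccontr)
      assume "\<nexists>n. Z < (\<Sum>k<n. c k)"
      then have "summable c" using pos by (intro summableI_nonneg_bounded[of _ Z]) (auto simp: less_imp_le not_less)
      then show False using ns by contradiction
    qed
    then obtain n0 where n0: "Z < (\<Sum>k<n0. c k)" by blast
    have "Z \<le> (\<Sum>k<n. c k)" if "n \<ge> n0" for n
    proof -
      have "(\<Sum>k<n0. c k) \<le> (\<Sum>k<n. c k)" using that pos by (intro sum_mono2) (auto simp: less_imp_le)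
      then show ?thesis using n0 by simp
    qed
    then show "eventually (\<lambda>n. Z \<le> (\<Sum>k<n. c k)) sequentially" by (auto simp: eventually_sequentially)
  qed
qed

lemma summable_inverse_square_shift:
  fixes \<gamma> K :: real
  shows "summable (\<lambda>n. \<bar>K / ((2 * real n + \<gamma>)\<^sup>2 - 1)\<bar>)"
proof -
  obtain N where N: "\<bar>\<gamma>\<bar> + 2 < real N" using reals_Archimedean2 by blast
  have "summable (\<lambda>n. \<bar>K\<bar> * inverse (real n ^ 2))"
    by (intro summable_mult inverse_power_summable) simp
  then show ?thesis
  proof (rule summable_comparison_test_ev[rotated])
    have "norm \<bar>K / ((2 * real n + \<gamma>)\<^sup>2 - 1)\<bar> \<le> \<bar>K\<bar> * inverse (real n ^ 2)" if "n \<ge> N" for n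
    proof -
      have n: "\<bar>\<gamma>\<bar> + 2 < real n" using N that by linarith
      have "(real n + 1)\<^sup>2 \<le> (2 * real n + \<gamma>)\<^sup>2" using n by (intro power_mono) auto
      then have "(real n)\<^sup>2 \<le> (2 * real n + \<gamma>)\<^sup>2 - 1" by (simp add: power2_sum)
      moreover have "0 < (real n)\<^sup>2" using n by simp
      ultimately show ?thesis by (simp add: frac_le divide_inverse[symmetric])
    qed
    then show "eventually (\<lambda>n. norm \<bar>K / ((2 * real n + \<gamma>)\<^sup>2 - 1)\<bar> \<le> \<bar>K\<bar> * inverse (real n ^ 2)) sequentially"
      by (auto simp: eventually_sequentially)
  qed
qed


lemma ratio_expI:
  assumes "\<And>n. f n = (real n + a) / (real n + b)" "c = a - b"
  shows "ratio_exp c f"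
proof -
  have "f = (\<lambda>n. (real n + a) / (real n + b))" using assms(1) by blast
  then show ?thesis using ratio_exp_linear[of a b] assms(2) by simp
qed

lemma ratio_expI2:
  assumes "\<And>n. f n = ((real n + a) / (2 * (real n + b))) / ((real n + c) / (2 * (real n + d)))"
    and "e = (a - c) + (d - b)"
  shows "ratio_exp e f"
proof -
  have "f = (\<lambda>n. (real n + a) / (real n + c) * ((real n + d) / (real n + b)))"
  proof
    fix n
    have "(A / (2 * B)) / (C / (2 * D)) = A / C * (D / B)" for A B C D :: real by simp
    then show "f n = (real n + a) / (real n + c) * ((real n + d) / (real n + b))" unfolding assms(1) .
  qed
  then show ?thesis
    using ratio_exp_mult[OF ratio_exp_linear[of a c] ratio_exp_linear[of d b]] assms(2) by simp
qed

section \<open>The coefficients\<close>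

lemma same_side:
  fixes a b :: real and k n :: int
  assumes "of_int k < a" "a < of_int k + 1" "of_int k < b" "b < of_int k + 1"
  shows "(0 < of_int n + a \<and> 0 < of_int n + b) \<or> (of_int n + a < 0 \<and> of_int n + b < 0)"
proof (cases "0 \<le> n + k")
  case True
  then have "0 \<le> of_int n + (of_int k :: real)" by (metis of_int_0_le_iff of_int_add)
  then show ?thesis using assms by linarith
next
  case False
  then have "n + k \<le> - 1" by simp
  then have "of_int n + (of_int k :: real) \<le> - 1" by (metis of_int_add of_int_le_iff of_int_minus of_int_1)
  then show ?thesis using assms by linarith
qed

lemma same_side_shift:
  fixes a b :: real and m n :: int
  assumes "(of_int m < a \<and> a < of_int m + 1 \<and> of_int m < b \<and> b < of_int m + 1) \<or>
    (of_int m - 1 < a \<and> a < of_int m \<and> of_int m - 1 < b \<and> b < of_int m) \<or>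
    (of_int m + 1 < a \<and> a < of_int m + 2 \<and> of_int m + 1 < b \<and> b < of_int m + 2)"
  shows "(0 < of_int n + a \<and> 0 < of_int n + b) \<or> (of_int n + a < 0 \<and> of_int n + b < 0)"
  using same_side[of m a b n] same_side[of "m - 1" a b n] same_side[of "m + 1" a b n] assms by auto

text \<open>
  No integer lies in the closed interval between \<open>- a\<close> and \<open>- b\<close>. The four cases of admissibility serve to
  make this true for the numerators of each of the two bidiagonal factors; then the denominator, being the
  sum of the two numerators, has their sign as well, and all four coefficients are positive.
\<close>

definition same_sign :: "real \<Rightarrow> real \<Rightarrow> bool" where
  "same_sign a b \<longleftrightarrow> (\<forall>n::int. (0 < of_int n + a \<and> 0 < of_int n + b) \<or> (of_int n + a < 0 \<and> of_int n + b < 0))"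

lemma admissible_same_sign:
  assumes "admissible \<alpha> \<beta> t"
  shows "same_sign (t + \<alpha>) (t + \<beta> + 1)" and "same_sign (t + \<alpha> + \<beta>) t"
proof -
  have ab: "0 < \<alpha>" "\<alpha> < 1" "- 1 < \<beta>" "\<beta> < 0" using assms by (auto simp: admissible_def)
  have "\<exists>m::int.
     (0 < \<beta> - \<alpha> + 1 \<and> - \<beta> < \<alpha> \<and> (of_int m < t \<and> t < of_int m - \<beta> \<or> of_int m - \<alpha> < t \<and> t < of_int m - \<alpha> - \<beta>)) \<or>
     (0 < \<beta> - \<alpha> + 1 \<and> \<alpha> < - \<beta> \<and> (of_int m - \<alpha> < t \<and> t < of_int m \<or> of_int m - \<alpha> - \<beta> < t \<and> t < of_int m - \<beta>)) \<or>
     (\<beta> - \<alpha> + 1 < 0 \<and> - \<beta> < \<alpha> \<and> (of_int m < t \<and> t < of_int m - \<alpha> + 1 \<or> of_int m - \<beta> < t \<and> t < of_int m - \<alpha> - \<beta> + 1)) \<or>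
     (\<beta> - \<alpha> + 1 < 0 \<and> \<alpha> < - \<beta> \<and> (of_int m - \<beta> - 1 < t \<and> t < of_int m \<or> of_int m - \<alpha> - \<beta> < t \<and> t < of_int m - \<alpha> + 1))"
    using assms unfolding admissible_def by auto
  then obtain m :: int where m:
    "(0 < \<beta> - \<alpha> + 1 \<and> - \<beta> < \<alpha> \<and> (of_int m < t \<and> t < of_int m - \<beta> \<or> of_int m - \<alpha> < t \<and> t < of_int m - \<alpha> - \<beta>)) \<or>
     (0 < \<beta> - \<alpha> + 1 \<and> \<alpha> < - \<beta> \<and> (of_int m - \<alpha> < t \<and> t < of_int m \<or> of_int m - \<alpha> - \<beta> < t \<and> t < of_int m - \<beta>)) \<or>
     (\<beta> - \<alpha> + 1 < 0 \<and> - \<beta> < \<alpha> \<and> (of_int m < t \<and> t < of_int m - \<alpha> + 1 \<or> of_int m - \<beta> < t \<and> t < of_int m - \<alpha> - \<beta> + 1)) \<or>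
     (\<beta> - \<alpha> + 1 < 0 \<and> \<alpha> < - \<beta> \<and> (of_int m - \<beta> - 1 < t \<and> t < of_int m \<or> of_int m - \<alpha> - \<beta> < t \<and> t < of_int m - \<alpha> + 1))" ..
  show "same_sign (t + \<alpha>) (t + \<beta> + 1)"
    unfolding same_sign_def
  proof
    fix n :: int
    show "(0 < of_int n + (t + \<alpha>) \<and> 0 < of_int n + (t + \<beta> + 1)) \<or> (of_int n + (t + \<alpha>) < 0 \<and> of_int n + (t + \<beta> + 1) < 0)"
      by (rule same_side_shift[of m]) (use m ab in \<open>elim disjE conjE; smt (verit)\<close>)
  qed
  show "same_sign (t + \<alpha> + \<beta>) t"
    unfolding same_sign_def
  proof
    fix n :: int
    show "(0 < of_int n + (t + \<alpha> + \<beta>) \<and> 0 < of_int n + t) \<or> (of_int n + (t + \<alpha> + \<beta>) < 0 \<and> of_int n + t < 0)"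
      by (rule same_side_shift[of m]) (use m ab in \<open>elim disjE conjE; smt (verit)\<close>)
  qed
qed

lemma same_sign_frac:
  assumes "same_sign a b" "of_int n + a + (of_int n + b) = d"
  shows "0 < (of_int n + a) / d" "0 < (of_int n + b) / d" "d \<noteq> 0" "of_int n + a \<noteq> 0" "of_int n + b \<noteq> 0"
    "(of_int n + a) / d + (of_int n + b) / d = 1"
proof -
  consider "0 < of_int n + a \<and> 0 < of_int n + b" | "of_int n + a < 0 \<and> of_int n + b < 0"
    using assms(1) unfolding same_sign_def by blast
  then have "0 < (of_int n + a) / d \<and> 0 < (of_int n + b) / d \<and> d \<noteq> 0 \<and> of_int n + a \<noteq> 0 \<and> of_int n + b \<noteq> 0"
  proof cases
    case 1
    then show ?thesis using assms(2) by (auto intro!: divide_pos_pos)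
  next
    case 2
    then show ?thesis using assms(2) by (auto intro!: divide_neg_neg)
  qed
  then show "0 < (of_int n + a) / d" "0 < (of_int n + b) / d" "d \<noteq> 0" "of_int n + a \<noteq> 0" "of_int n + b \<noteq> 0"
    "(of_int n + a) / d + (of_int n + b) / d = 1"
    using assms(2) by (auto simp: add_divide_distrib[symmetric])
qed

locale ul_coefficients =
  fixes \<alpha> \<beta> t :: real
  assumes \<alpha>: "0 < \<alpha>" "\<alpha> < 1" and \<beta>: "- 1 < \<beta>" "\<beta> < 0"
    and free_U: "same_sign (t + \<alpha>) (t + \<beta> + 1)" and free_L: "same_sign (t + \<alpha> + \<beta>) t"
begin

abbreviation "x \<equiv> coef_x \<alpha> \<beta> t"
abbreviation "y \<equiv> coef_y \<alpha> \<beta> t"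
abbreviation "s \<equiv> coef_s \<alpha> \<beta> t"
abbreviation "\<tau> \<equiv> coef_t \<alpha> \<beta> t"
abbreviation "p \<equiv> coef_p \<alpha> \<beta> t"
abbreviation "q \<equiv> coef_q \<alpha> \<beta> t"
abbreviation "r \<equiv> coef_r \<alpha> \<beta> t"

lemma PU_coefs: "0 < y n" "0 < x n" "y n + x n = 1" "of_int n + t + \<alpha> \<noteq> 0" "of_int n + t + \<beta> + 1 \<noteq> 0"
  "2 * of_int n + 2 * t + \<alpha> + \<beta> + 1 \<noteq> 0"
  using same_sign_frac[OF free_U, of n "2 * of_int n + 2 * t + \<alpha> + \<beta> + 1"]
  by (simp_all add: coef_y_def coef_x_def add.assoc)

lemma PL_coefs: "0 < s n" "0 < \<tau> n" "s n + \<tau> n = 1" "of_int n + t + \<alpha> + \<beta> \<noteq> 0" "of_int n + t \<noteq> 0"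
  "2 * of_int n + 2 * t + \<alpha> + \<beta> \<noteq> 0"
  using same_sign_frac[OF free_L, of n "2 * of_int n + 2 * t + \<alpha> + \<beta>"]
  by (simp_all add: coef_s_def coef_t_def add.assoc)

lemma p_eq: "p n = x n * s (n + 1)"
  by (simp add: coef_p_def coef_x_def coef_s_def add_ac)

lemma q_eq: "q n = y n * \<tau> n"
  by (simp add: coef_q_def coef_y_def coef_t_def mult_ac)

lemma r_eq: "r n = y n * s n + x n * \<tau> (n + 1)"
  by (simp add: coef_r_def coef_y_def coef_s_def coef_x_def coef_t_def add_ac mult_ac)

lemma pq_pos: "0 < p n" "0 < q n"
  by (simp_all add: p_eq q_eq PU_coefs PL_coefs)

lemma row_sum: "p n + r n + q n = 1"
proof -
  have "p n + r n + q n = y n * (s n + \<tau> n) + x n * (s (n + 1) + \<tau> (n + 1))"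
    unfolding p_eq q_eq r_eq by algebra
  then show ?thesis by (simp add: PL_coefs PU_coefs)
qed

text \<open>
  The off-diagonal identities hold factor by factor. On the diagonal the two products differ from the two
  summands of \<open>coef_r (\<alpha> - 1) \<beta> t n\<close> by \<open>(\<alpha> - 1) / D\<close> and \<open>- (\<alpha> - 1) / D\<close>,
  where \<open>D = 2 (n + t) + \<alpha> + \<beta>\<close>.
\<close>

lemma darboux_coefs:
  "s n * x n = coef_p (\<alpha> - 1) \<beta> t n" "\<tau> n * y (n - 1) = coef_q (\<alpha> - 1) \<beta> t n"
  "s n * y n + \<tau> n * x (n - 1) = coef_r (\<alpha> - 1) \<beta> t n"
proof -
  show "s n * x n = coef_p (\<alpha> - 1) \<beta> t n"
    by (simp add: coef_p_def coef_s_def coef_x_def algebra_simps)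
  show "\<tau> n * y (n - 1) = coef_q (\<alpha> - 1) \<beta> t n"
    by (simp add: coef_q_def coef_t_def coef_y_def algebra_simps)
  define \<nu> where "\<nu> = of_int n + t"
  define D where "D = 2 * \<nu> + \<alpha> + \<beta>"
  have D: "D \<noteq> 0" "D + 1 \<noteq> 0" "D - 1 \<noteq> 0"
    using PL_coefs(6)[of n] PU_coefs(6)[of n] PU_coefs(6)[of "n - 1"] by (auto simp: D_def \<nu>_def algebra_simps)
  have e: "s n = (\<nu> + \<alpha> + \<beta>) / D" "y n = (\<nu> + \<alpha>) / (D + 1)" "\<tau> n = \<nu> / D" "x (n - 1) = (\<nu> + \<beta>) / (D - 1)"
    "coef_r (\<alpha> - 1) \<beta> t n = (\<nu> + \<beta> + 1) * (\<nu> + 1) / (D * (D + 1)) + (\<nu> + \<alpha> - 1) * (\<nu> + \<alpha> + \<beta> - 1) / ((D - 1) * D)"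
    by (simp_all add: coef_s_def coef_y_def coef_t_def coef_x_def coef_r_def D_def \<nu>_def algebra_simps)
  have a: "(\<nu> + \<alpha> + \<beta>) * (\<nu> + \<alpha>) = (\<nu> + \<beta> + 1) * (\<nu> + 1) + (\<alpha> - 1) * (D + 1)" unfolding D_def by algebra
  have b: "\<nu> * (\<nu> + \<beta>) = (\<nu> + \<alpha> - 1) * (\<nu> + \<alpha> + \<beta> - 1) - (\<alpha> - 1) * (D - 1)" unfolding D_def by algebra
  have "s n * y n = ((\<nu> + \<beta> + 1) * (\<nu> + 1) + (\<alpha> - 1) * (D + 1)) / (D * (D + 1))"
    unfolding e a[symmetric] by simp
  also have "\<dots> = (\<nu> + \<beta> + 1) * (\<nu> + 1) / (D * (D + 1)) + (\<alpha> - 1) / D"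
    using D by (simp add: add_divide_distrib)
  finally have 1: "s n * y n = (\<nu> + \<beta> + 1) * (\<nu> + 1) / (D * (D + 1)) + (\<alpha> - 1) / D" .
  have "\<tau> n * x (n - 1) = ((\<nu> + \<alpha> - 1) * (\<nu> + \<alpha> + \<beta> - 1) - (\<alpha> - 1) * (D - 1)) / ((D - 1) * D)"
    unfolding e b[symmetric] by simp
  also have "\<dots> = (\<nu> + \<alpha> - 1) * (\<nu> + \<alpha> + \<beta> - 1) / ((D - 1) * D) - (\<alpha> - 1) / D"
    using D by (simp add: diff_divide_distrib)
  finally show "s n * y n + \<tau> n * x (n - 1) = coef_r (\<alpha> - 1) \<beta> t n"
    unfolding 1 e(5) by simp
qed

lemma mat_Ptilde_entry:
  "mat_Ptilde \<alpha> \<beta> t i j = s i * mat_PU \<alpha> \<beta> t i j + \<tau> i * mat_PU \<alpha> \<beta> t (i - 1) j"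
proof -
  have "mat_Ptilde \<alpha> \<beta> t i j = (\<Sum>\<^sub>\<infinity>k\<in>{i - 1, i}. mat_PL \<alpha> \<beta> t i k * mat_PU \<alpha> \<beta> t k j)"
    unfolding mat_Ptilde_def mat_prod_def by (rule infsum_cong_neutral) (auto simp: mat_PL_def)
  also have "\<dots> = s i * mat_PU \<alpha> \<beta> t i j + \<tau> i * mat_PU \<alpha> \<beta> t (i - 1) j"
    by (simp add: mat_PL_def)
  finally show ?thesis .
qed

lemma mat_Ptilde_eq: "mat_Ptilde \<alpha> \<beta> t = mat_P (\<alpha> - 1) \<beta> t"
  by (intro ext) (auto simp: mat_Ptilde_entry mat_PU_def mat_P_def darboux_coefs)

lemma mat_Ptilde_entries:
  "mat_Ptilde \<alpha> \<beta> t n (n + 1) = s n * x n" "mat_Ptilde \<alpha> \<beta> t n n = s n * y n + \<tau> n * x (n - 1)"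
  "mat_Ptilde \<alpha> \<beta> t n (n - 1) = \<tau> n * y (n - 1)"
  by (auto simp: mat_Ptilde_entry mat_PU_def)

lemma stochastic_mat_Ptilde: "stochastic (mat_Ptilde \<alpha> \<beta> t)"
  unfolding stochastic_def
proof (intro conjI allI)
  fix i j
  show "0 \<le> mat_Ptilde \<alpha> \<beta> t i j"
    by (auto simp: mat_Ptilde_entry mat_PU_def intro!: add_nonneg_nonneg mult_nonneg_nonneg less_imp_le[OF PU_coefs(1)]
        less_imp_le[OF PU_coefs(2)] less_imp_le[OF PL_coefs(1)] less_imp_le[OF PL_coefs(2)])
next
  fix i
  have "(mat_Ptilde \<alpha> \<beta> t i has_sum (\<Sum>j\<in>{i - 1, i, i + 1}. mat_Ptilde \<alpha> \<beta> t i j)) {i - 1, i, i + 1}"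
    by (rule has_sum_finite) simp
  also have "(\<Sum>j\<in>{i - 1, i, i + 1}. mat_Ptilde \<alpha> \<beta> t i j) = s i * (y i + x i) + \<tau> i * (y (i - 1) + x (i - 1))"
    by (simp add: mat_Ptilde_entries distrib_left)
  also have "\<dots> = 1" by (simp add: PU_coefs PL_coefs)
  finally have "(mat_Ptilde \<alpha> \<beta> t i has_sum 1) {i - 1, i, i + 1}" .
  then show "(mat_Ptilde \<alpha> \<beta> t i has_sum 1) UNIV"
    by (subst (asm) has_sum_cong_neutral[where T=UNIV]) (auto simp: mat_Ptilde_entry mat_PU_def)
qed

lemma tridiagonal_mat_Ptilde: "tridiagonal (mat_Ptilde \<alpha> \<beta> t)"
  unfolding tridiagonal_def by (auto simp: mat_Ptilde_entries PU_coefs PL_coefs, auto simp: mat_Ptilde_entry mat_PU_def)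

lemma coef_shift_forms:
  "x (int n) = (real n + (t + \<beta> + 1)) / (2 * (real n + (t + (\<alpha> + \<beta> + 1) / 2)))"
  "y (int n + 1) = (real n + (t + \<alpha> + 1)) / (2 * (real n + (t + (\<alpha> + \<beta> + 3) / 2)))"
  "s (int n) = (real n + (t + \<alpha> + \<beta>)) / (2 * (real n + (t + (\<alpha> + \<beta>) / 2)))"
  "s (int n + 2) = (real n + (t + \<alpha> + \<beta> + 2)) / (2 * (real n + (t + (\<alpha> + \<beta> + 4) / 2)))"
  "\<tau> (int n + 1) = (real n + (t + 1)) / (2 * (real n + (t + (\<alpha> + \<beta> + 2) / 2)))"
  unfolding coef_x_def coef_y_def coef_s_def coef_t_def
  by (rule arg_cong2[where f="(/)"]; simp add: field_simps)+

lemma ratio_U: "ratio_exp (\<alpha> - \<beta> - 1) (\<lambda>n. y (int n) / x (int n))"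
  "ratio_exp (\<alpha> - \<beta> - 1) (\<lambda>n. y (int n + 1) / x (int n + 1))"
  "ratio_exp (\<beta> - \<alpha> + 1) (\<lambda>n. x (int n) / y (int n + 1))"
proof -
  have 1: "y k / x k = (of_int k + t + \<alpha>) / (of_int k + t + \<beta> + 1)" for k
    using PU_coefs(6)[of k] by (simp add: coef_y_def coef_x_def)
  show "ratio_exp (\<alpha> - \<beta> - 1) (\<lambda>n. y (int n) / x (int n))"
    by (rule ratio_expI[of _ "t + \<alpha>" "t + \<beta> + 1"]) (simp_all add: 1 add_ac)
  show "ratio_exp (\<alpha> - \<beta> - 1) (\<lambda>n. y (int n + 1) / x (int n + 1))"
    by (rule ratio_expI[of _ "t + \<alpha> + 1" "t + \<beta> + 2"]) (simp_all add: 1 add_ac)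
  show "ratio_exp (\<beta> - \<alpha> + 1) (\<lambda>n. x (int n) / y (int n + 1))"
    by (rule ratio_expI2[of _ "t + \<beta> + 1" "t + (\<alpha> + \<beta> + 1) / 2" "t + \<alpha> + 1" "t + (\<alpha> + \<beta> + 3) / 2"])
      (rule arg_cong2[where f="(/)", OF coef_shift_forms(1,2)], simp add: field_simps)
qed

lemma ratio_L: "ratio_exp (\<alpha> + \<beta>) (\<lambda>n. s (int n + 1) / \<tau> (int n + 1))"
  "ratio_exp (\<alpha> + \<beta>) (\<lambda>n. s (int n + 2) / \<tau> (int n + 2))"
  "ratio_exp (- (\<alpha> + \<beta>)) (\<lambda>n. \<tau> (int n + 1) / s (int n + 1))"
  "ratio_exp (- (\<alpha> + \<beta>)) (\<lambda>n. \<tau> (int n + 1) / s (int n + 2))"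
  "ratio_exp (\<alpha> + \<beta>) (\<lambda>n. s (int n) / \<tau> (int n + 1))"
proof -
  have 1: "s k / \<tau> k = (of_int k + t + \<alpha> + \<beta>) / (of_int k + t)" "\<tau> k / s k = (of_int k + t) / (of_int k + t + \<alpha> + \<beta>)" for k
    using PL_coefs(6)[of k] by (simp_all add: coef_s_def coef_t_def)
  show "ratio_exp (\<alpha> + \<beta>) (\<lambda>n. s (int n + 1) / \<tau> (int n + 1))"
    by (rule ratio_expI[of _ "t + \<alpha> + \<beta> + 1" "t + 1"]) (simp_all add: 1 add_ac)
  show "ratio_exp (\<alpha> + \<beta>) (\<lambda>n. s (int n + 2) / \<tau> (int n + 2))"
    by (rule ratio_expI[of _ "t + \<alpha> + \<beta> + 2" "t + 2"]) (simp_all add: 1 add_ac)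
  show "ratio_exp (- (\<alpha> + \<beta>)) (\<lambda>n. \<tau> (int n + 1) / s (int n + 1))"
    by (rule ratio_expI[of _ "t + 1" "t + \<alpha> + \<beta> + 1"]) (simp_all add: 1 add_ac)
  show "ratio_exp (- (\<alpha> + \<beta>)) (\<lambda>n. \<tau> (int n + 1) / s (int n + 2))"
    by (rule ratio_expI2[of _ "t + 1" "t + (\<alpha> + \<beta> + 2) / 2" "t + \<alpha> + \<beta> + 2" "t + (\<alpha> + \<beta> + 4) / 2"])
      (rule arg_cong2[where f="(/)", OF coef_shift_forms(5,4)], simp add: field_simps)
  show "ratio_exp (\<alpha> + \<beta>) (\<lambda>n. s (int n) / \<tau> (int n + 1))"
    by (rule ratio_expI2[of _ "t + \<alpha> + \<beta>" "t + (\<alpha> + \<beta>) / 2" "t + 1" "t + (\<alpha> + \<beta> + 2) / 2"])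
      (rule arg_cong2[where f="(/)", OF coef_shift_forms(3,5)], simp add: field_simps)
qed

text \<open>
  With \<open>D = 2 n + 2 t + \<alpha> + \<beta> + 1\<close> the difference is \<open>(\<alpha>\<^sup>2 - \<beta>\<^sup>2) / (2 (D\<^sup>2 - 1))\<close>.
\<close>

lemma summable_diagonal: "summable (\<lambda>n. \<bar>r (int n) - 1/2\<bar>)"
proof -
  have "r (int n) - 1/2 = ((\<alpha>\<^sup>2 - \<beta>\<^sup>2) / 2) / ((2 * real n + (2 * t + \<alpha> + \<beta> + 1))\<^sup>2 - 1)" for n
  proof -
    define D where "D = 2 * real n + (2 * t + \<alpha> + \<beta> + 1)"
    have D: "D \<noteq> 0" "D + 1 \<noteq> 0" "D - 1 \<noteq> 0"
      using PU_coefs(6)[of "int n"] PL_coefs(6)[of "int n"] PL_coefs(6)[of "int n + 1"] by (auto simp: D_def algebra_simps)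
    have n: "real n + t = (D - \<alpha> - \<beta> - 1) / 2" by (simp add: D_def field_simps)
    have "r (int n) = ((D + \<beta> - \<alpha> + 1) * (D + 1 - \<alpha> - \<beta>) / 4) / (D * (D + 1)) + ((D + \<alpha> - \<beta> - 1) * (D + \<alpha> + \<beta> - 1) / 4) / ((D - 1) * D)"
    proof -
      have "(real n + t + \<beta> + 1) * (real n + t + 1) = (D + \<beta> - \<alpha> + 1) * (D + 1 - \<alpha> - \<beta>) / 4"
        "(real n + t + \<alpha>) * (real n + t + \<alpha> + \<beta>) = (D + \<alpha> - \<beta> - 1) * (D + \<alpha> + \<beta> - 1) / 4"
        unfolding n by (simp_all add: field_simps)
      moreover have "2 * real n + 2 * t + \<alpha> + \<beta> + 1 = D" "2 * real n + 2 * t + \<alpha> + \<beta> + 2 = D + 1" "2 * real n + 2 * t + \<alpha> + \<beta> = D - 1"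
        by (simp_all add: D_def)
      ultimately show ?thesis unfolding coef_r_def of_int_of_nat_eq by (simp only:)
    qed
    also have "\<dots> = ((D + \<beta> - \<alpha> + 1) * (D + 1 - \<alpha> - \<beta>) * (D - 1) + (D + \<alpha> - \<beta> - 1) * (D + \<alpha> + \<beta> - 1) * (D + 1)) / (4 * D * (D\<^sup>2 - 1))"
    proof -
      have f: "D\<^sup>2 - 1 = (D + 1) * (D - 1)" by algebra
      show ?thesis unfolding f using D by (simp add: add_divide_distrib)
    qed
    also have "\<dots> = (2 * D * (D\<^sup>2 - 1) + 2 * D * (\<alpha>\<^sup>2 - \<beta>\<^sup>2)) / (4 * D * (D\<^sup>2 - 1))"
      by (rule arg_cong2[where f="(/)"]) (algebra, simp)
    also have "\<dots> = 1/2 + ((\<alpha>\<^sup>2 - \<beta>\<^sup>2) / 2) / (D\<^sup>2 - 1)"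
    proof -
      have f: "D\<^sup>2 - 1 = (D + 1) * (D - 1)" by algebra
      have "D\<^sup>2 - 1 \<noteq> 0" unfolding f using D by simp
      moreover have "(2 * D * E + 2 * D * k) / (4 * D * E) = 1/2 + (k / 2) / E" if "E \<noteq> 0" for E k
        using D that by (simp add: add_divide_distrib)
      ultimately show ?thesis by blast
    qed
    finally show ?thesis by (simp add: D_def)
  qed
  then show ?thesis by (simp only: summable_inverse_square_shift)
qed

text \<open>
  With \<open>m = 2 n + 2 t + \<alpha> + \<beta> + 2\<close> the product \<open>16 p\<^sub>n q\<^sub>n\<^sub>+\<^sub>1\<close> equals
  \<open>(m\<^sup>2 - (\<alpha> - \<beta>)\<^sup>2) (m\<^sup>2 - (\<alpha> + \<beta>)\<^sup>2) / (m\<^sup>2 (m\<^sup>2 - 1))\<close>, in which the terms of order \<open>1/m\<close> cancel. They would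
  not cancel in \<open>p\<close> and \<open>q\<close> separately.
\<close>

lemma summable_offdiagonal: "summable (\<lambda>n. \<bar>sqrt (p (int n) * q (int n + 1)) - 1/4\<bar>)"
proof -
  define K where "K = 1 - (\<alpha> - \<beta>)\<^sup>2 - (\<alpha> + \<beta>)\<^sup>2"
  define J where "J = (\<alpha> - \<beta>)\<^sup>2 * (\<alpha> + \<beta>)\<^sup>2"
  define \<gamma> where "\<gamma> = 2 * t + \<alpha> + \<beta> + 2"
  obtain N where N: "\<bar>\<gamma>\<bar> + 2 < real N" using reals_Archimedean2 by blast
  have "norm \<bar>sqrt (p (int n) * q (int n + 1)) - 1/4\<bar> \<le> \<bar>(\<bar>K\<bar> + \<bar>J\<bar>) / ((2 * real n + \<gamma>)\<^sup>2 - 1)\<bar>" if "n \<ge> N" for n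
  proof -
    define m where "m = 2 * real n + \<gamma>"
    have m1: "1 < m" using N that by (simp add: m_def abs_less_iff)
    then have m2: "1 < m\<^sup>2" by (simp add: power2_eq_square less_1_mult)
    define z where "z = p (int n) * q (int n + 1)"
    have z0: "0 < z" by (simp add: z_def pq_pos)
    have n: "real n + t = (m - \<alpha> - \<beta> - 2) / 2" by (simp add: m_def \<gamma>_def field_simps)
    have "z = ((m - \<alpha> + \<beta>) * (m + \<alpha> + \<beta>) / 4) / ((m - 1) * m) * (((m - \<alpha> - \<beta>) * (m + \<alpha> - \<beta>) / 4) / (m * (m + 1)))"
    proof -
      have "(real n + t + \<beta> + 1) * (real n + t + \<alpha> + \<beta> + 1) = (m - \<alpha> + \<beta>) * (m + \<alpha> + \<beta>) / 4"
        "(real n + 1 + t) * (real n + 1 + t + \<alpha>) = (m - \<alpha> - \<beta>) * (m + \<alpha> - \<beta>) / 4"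
      proof -
        have f: "real n + t + \<beta> + 1 = (m - \<alpha> + \<beta>) / 2" "real n + t + \<alpha> + \<beta> + 1 = (m + \<alpha> + \<beta>) / 2"
          "real n + 1 + t = (m - \<alpha> - \<beta>) / 2" "real n + 1 + t + \<alpha> = (m + \<alpha> - \<beta>) / 2"
          using n by (simp_all add: field_simps)
        show "(real n + t + \<beta> + 1) * (real n + t + \<alpha> + \<beta> + 1) = (m - \<alpha> + \<beta>) * (m + \<alpha> + \<beta>) / 4"
          unfolding f(1,2) by simp
        show "(real n + 1 + t) * (real n + 1 + t + \<alpha>) = (m - \<alpha> - \<beta>) * (m + \<alpha> - \<beta>) / 4"
          unfolding f(4) unfolding f(3) by simp
      qed
      moreover have "2 * real n + 2 * t + \<alpha> + \<beta> + 1 = m - 1" "2 * real n + 2 * t + \<alpha> + \<beta> + 2 = m"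
        "2 * (real n + 1) + 2 * t + \<alpha> + \<beta> = m" "2 * (real n + 1) + 2 * t + \<alpha> + \<beta> + 1 = m + 1"
        by (simp_all add: m_def \<gamma>_def)
      ultimately show ?thesis
        unfolding z_def coef_p_def coef_q_def of_int_add of_int_1 of_int_of_nat_eq by (simp only:)
    qed
    also have "\<dots> = ((m - \<alpha> + \<beta>) * (m + \<alpha> + \<beta>) * (m - \<alpha> - \<beta>) * (m + \<alpha> - \<beta>)) / (16 * m\<^sup>2 * (m\<^sup>2 - 1))"
    proof -
      have f: "m\<^sup>2 - 1 = (m - 1) * (m + 1)" by algebra
      have "(A / 4) / (P * m) * ((B / 4) / (m * R)) = (A * B) / (16 * m\<^sup>2 * (P * R))" for A B P R
      proof -
        have d: "(4 * (P * m)) * (4 * (m * R)) = 16 * m\<^sup>2 * (P * R)" by algebra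
        have "(A / 4) / (P * m) * ((B / 4) / (m * R)) = (A * B) / ((4 * (P * m)) * (4 * (m * R)))"
          by (simp only: divide_divide_eq_left times_divide_times_eq)
        then show ?thesis unfolding d .
      qed
      then show ?thesis unfolding f by (simp only: mult.assoc)
    qed
    also have "\<dots> = (m\<^sup>2 * (m\<^sup>2 - 1) + (K * m\<^sup>2 + J)) / (16 * m\<^sup>2 * (m\<^sup>2 - 1))"
      unfolding K_def J_def by (rule arg_cong2[where f="(/)"]) (algebra, simp)
    also have "\<dots> = 1/16 + (K * m\<^sup>2 + J) / (16 * m\<^sup>2 * (m\<^sup>2 - 1))"
    proof -
      have "(a * e + k) / (16 * a * e) = 1/16 + k / (16 * a * e)" if "a \<noteq> 0" "e \<noteq> 0" for a e k :: real
        using that by (simp add: add_divide_distrib)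
      moreover have "m\<^sup>2 \<noteq> 0" "m\<^sup>2 - 1 \<noteq> 0" using m2 by auto
      ultimately show ?thesis by blast
    qed
    finally have z: "z - 1/16 = (K * m\<^sup>2 + J) / (16 * m\<^sup>2 * (m\<^sup>2 - 1))" by simp
    have KJ: "\<bar>K * m\<^sup>2 + J\<bar> \<le> (\<bar>K\<bar> + \<bar>J\<bar>) * m\<^sup>2"
    proof -
      have "\<bar>K * m\<^sup>2 + J\<bar> \<le> \<bar>K\<bar> * m\<^sup>2 + \<bar>J\<bar> * 1"
        using abs_triangle_ineq[of "K * m\<^sup>2" J] by (simp add: abs_mult)
      also have "\<dots> \<le> \<bar>K\<bar> * m\<^sup>2 + \<bar>J\<bar> * m\<^sup>2" using m2 by (intro add_left_mono mult_left_mono) auto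
      finally show ?thesis by (simp add: distrib_right)
    qed
    define e where "e = m\<^sup>2 - 1"
    define b where "b = (\<bar>K\<bar> + \<bar>J\<bar>) / e"
    have e: "0 < e" and mm: "0 < m\<^sup>2" using m2 by (auto simp: e_def)
    have b: "0 \<le> b" using e by (simp add: b_def)
    have "\<bar>z - 1/16\<bar> = \<bar>K * m\<^sup>2 + J\<bar> / (16 * m\<^sup>2 * e)"
      unfolding z e_def[symmetric] abs_divide using e mm by (simp add: abs_mult)
    also have "\<dots> \<le> ((\<bar>K\<bar> + \<bar>J\<bar>) * m\<^sup>2) / (16 * m\<^sup>2 * e)"
      using KJ e mm by (intro divide_right_mono) auto
    also have "\<dots> = b / 16" unfolding b_def using mm by simp
    finally have zle: "\<bar>z - 1/16\<bar> \<le> b / 16" .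
    have "(sqrt z - 1/4) * (sqrt z + 1/4) = z - 1/16"
      using z0 by (simp add: algebra_simps)
    then have "\<bar>sqrt z - 1/4\<bar> * (sqrt z + 1/4) = \<bar>z - 1/16\<bar>"
      using z0 by (metis abs_mult abs_of_pos add_pos_pos real_sqrt_gt_0_iff zero_less_divide_1_iff zero_less_numeral)
    then have "\<bar>sqrt z - 1/4\<bar> * (1/4) \<le> \<bar>z - 1/16\<bar>"
      using mult_left_mono[of "1/4" "sqrt z + 1/4" "\<bar>sqrt z - 1/4\<bar>"] z0 by simp
    then have "\<bar>sqrt z - 1/4\<bar> \<le> b" using zle b by simp
    also have "b = \<bar>(\<bar>K\<bar> + \<bar>J\<bar>) / (m\<^sup>2 - 1)\<bar>" using e b by (simp add: b_def e_def)
    finally show ?thesis by (simp add: z_def m_def)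
  qed
  then have "eventually (\<lambda>n. norm \<bar>sqrt (p (int n) * q (int n + 1)) - 1/4\<bar> \<le> \<bar>(\<bar>K\<bar> + \<bar>J\<bar>) / ((2 * real n + \<gamma>)\<^sup>2 - 1)\<bar>) sequentially"
    by (auto simp: eventually_sequentially)
  then show ?thesis by (rule summable_comparison_test_ev[OF _ summable_inverse_square_shift])
qed

end

lemma admissible_ul_coefficients: "admissible \<alpha> \<beta> t \<Longrightarrow> ul_coefficients \<alpha> \<beta> t"
  using admissible_same_sign by unfold_locales (auto simp: admissible_def)


section \<open>The spectral matrices of the random walk and of its Darboux transform\<close>

context ul_coefficients
begin

lemma mat_P_coefs:
  "(\<lambda>n. mat_P \<alpha> \<beta> t n (n + 1)) = p" "(\<lambda>n. mat_P \<alpha> \<beta> t n n) = r" "(\<lambda>n. mat_P \<alpha> \<beta> t n (n - 1)) = q"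
  by (auto simp: mat_P_def)

lemma nevai_chainI: "ortho_chain \<mu> M V w p r q \<Longrightarrow> nevai_chain \<mu> M V w p r q"
  by (intro nevai_chain.intro nevai_chain_axioms.intro summable_diagonal summable_offdiagonal)

lemma ul_chainI: "ortho_chain \<mu> M V w p r q \<Longrightarrow> ul_chain \<mu> M V w p r q x y s \<tau>"
  by (intro ul_chain.intro ul_chain_axioms.intro p_eq q_eq r_eq PU_coefs PL_coefs)

lemma w_ratio:
  assumes "w (n + 1) * q (n + 1) = w n * p n"
  shows "w (n + 1) = x n / y (n + 1) * (s (n + 1) / \<tau> (n + 1)) * w n"
  using assms PU_coefs(1)[of "n + 1"] PL_coefs(2)[of "n + 1"] by (simp add: p_eq q_eq field_simps)

text \<open>
  At \<open>1\<close> the constants solve the recurrence because the rows sum to 1; here \<open>w n\<close> and \<open>1 / (w n * p n)\<close>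
  have the growth exponents \<open>2 \<beta> + 1\<close> and \<open>- 2 \<beta> - 1\<close>. At \<open>0\<close> the kernel of the lower bidiagonal factor supplies
  an alternating solution \<open>H\<close>, and the exponents of the two series are \<open>1 - 2 \<alpha>\<close> and \<open>2 \<alpha> - 1\<close>. All of them
  exceed \<open>- 1\<close> because \<open>- 1 < \<beta> < 0 < \<alpha> < 1\<close>.
\<close>

lemma atom_free_endpoints:
  assumes "ortho_chain \<mu> M V w p r q"
  shows "weight.mass \<mu> M {1} = 0" "weight.mass \<mu> M {0} = 0"
proof -
  interpret ortho_chain \<mu> M V w p r q by fact
  have w: "w (int (Suc n)) = x (int n) / y (int n + 1) * (s (int n + 1) / \<tau> (int n + 1)) * w (int n)" for n
    using w_ratio[OF w_Suc[of "int n"]] by (simp add: add.commute)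
  have wp: "0 < w (int n) * p (int n)" for n by (simp add: w_pos p_pos)
  have wp_Suc: "w (int (Suc n)) * p (int (Suc n)) = w (int n) * p (int n) * (p (int n + 1) / q (int n + 1))" for n
    using w_Suc[of "int n"] q_pos[of "int n + 1"] by (simp add: field_simps add.commute)
  have qp: "q (int n + 1) / p (int n + 1) = y (int n + 1) / x (int n + 1) * (\<tau> (int n + 1) / s (int n + 2))" for n
    by (simp add: p_eq q_eq add.commute)
  show "mass {1} = 0"
  proof (rule atom_free, rule not_square_summable[where H="\<lambda>n. 1"])
    show "1 * 1 = p (int n + 1) * 1 + r (int n + 1) * 1 + q (int n + 1) * 1" for n
      using row_sum[of "int n + 1"] by simp
    have "\<not> summable (\<lambda>n. w (int n))"
      by (rule raabe_divergence(1)[OF w_pos w ratio_exp_mult[OF ratio_U(3) ratio_L(1)]]) (use \<beta> in simp)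
    then show "\<not> summable (\<lambda>n. w (int n) * 1\<^sup>2)" by simp
    define c where "c n = 1 / (w (int n) * p (int n))" for n
    have c: "0 < c n" "c (Suc n) = (y (int n + 1) / x (int n + 1) * (\<tau> (int n + 1) / s (int n + 2))) * c n" for n
      unfolding c_def qp[symmetric] wp_Suc using wp by auto
    have "LIM n sequentially. (\<Sum>k<n. c k) :> at_top"
      by (rule raabe_divergence(2)[OF c ratio_exp_mult[OF ratio_U(2) ratio_L(4)]]) (use \<beta> in simp)
    moreover have "\<bar>\<Sum>k<n. 1 / (w (int k) * p (int k) * (1 * 1))\<bar> = (\<Sum>k<n. c k)" for n
      using c(1) by (simp add: c_def sum_nonneg less_imp_le)
    ultimately show "LIM n sequentially. \<bar>\<Sum>k<n. 1 / (w (int k) * p (int k) * (1 * 1))\<bar> :> at_top" by simp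
  qed auto
  \<comment> \<open>The kernel of the lower factor: \<open>s\<^sub>n H\<^sub>n + \<tau>\<^sub>n H\<^sub>n\<^sub>-\<^sub>1 = 0\<close>.\<close>
  define H where "H n = (\<Prod>k<n. - (\<tau> (int k + 1) / s (int k + 1)))" for n
  have H_Suc: "H (Suc n) = - (\<tau> (int n + 1) / s (int n + 1)) * H n" for n
    by (simp add: H_def)
  have H0: "H n \<noteq> 0" for n
    using PL_coefs(1) PL_coefs(2) by (auto simp: H_def) (metis less_irrefl)+
  have sH: "s (int n + 1) * H (Suc n) = - \<tau> (int n + 1) * H n" for n
    using PL_coefs(1)[of "int n + 1"] by (simp add: H_Suc)
  show "mass {0} = 0"
  proof (rule atom_free, rule not_square_summable[where H=H])
    show "0 * H (Suc n) = p (int n + 1) * H (Suc (Suc n)) + r (int n + 1) * H (Suc n) + q (int n + 1) * H n" for n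
    proof -
      have "s (int n + 2) * H (Suc (Suc n)) = - \<tau> (int n + 2) * H (Suc n)"
        using sH[of "Suc n"] by (simp add: add.commute)
      moreover have "p (int n + 1) = x (int n + 1) * s (int n + 2)" "r (int n + 1) = y (int n + 1) * s (int n + 1) + x (int n + 1) * \<tau> (int n + 2)"
        "q (int n + 1) = y (int n + 1) * \<tau> (int n + 1)"
        by (simp_all add: p_eq r_eq q_eq add.commute)
      ultimately show ?thesis using sH[of n] by algebra
    qed
    define b where "b n = w (int n) * (H n)\<^sup>2" for n
    have b: "0 < b n" for n using w_pos H0 by (simp add: b_def)
    have b_Suc: "b (Suc n) = (x (int n) / y (int n + 1) * (s (int n + 1) / \<tau> (int n + 1)) * ((\<tau> (int n + 1) / s (int n + 1)) * (\<tau> (int n + 1) / s (int n + 1)))) * b n" for n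
      unfolding b_def w H_Suc by (simp add: power2_eq_square)
    show "\<not> summable (\<lambda>n. w (int n) * (H n)\<^sup>2)"
      unfolding b_def[symmetric]
      by (rule raabe_divergence(1)[OF b b_Suc ratio_exp_mult[OF ratio_exp_mult[OF ratio_U(3) ratio_L(1)] ratio_exp_mult[OF ratio_L(3) ratio_L(3)]]])
        (use \<alpha> in simp)
    define c where "c n = 1 / (w (int n) * p (int n)) * (1 / - (H n * H (Suc n)))" for n
    have HH: "0 < - (H n * H (Suc n))" for n
    proof -
      have "- (H n * H (Suc n)) = \<tau> (int n + 1) / s (int n + 1) * (H n)\<^sup>2"
        unfolding H_Suc by (simp add: power2_eq_square)
      also have "\<dots> > 0" using PL_coefs(1)[of "int n + 1"] PL_coefs(2)[of "int n + 1"] H0[of n] by simp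
      finally show ?thesis .
    qed
    have c: "0 < c n" for n
      unfolding c_def
      by (rule mult_pos_pos[OF divide_pos_pos[OF zero_less_one wp[of n]] divide_pos_pos[OF zero_less_one HH[of n]]])
    have c_Suc: "c (Suc n) = (y (int n + 1) / x (int n + 1) * (\<tau> (int n + 1) / s (int n + 2)) * ((s (int n + 1) / \<tau> (int n + 1)) * (s (int n + 2) / \<tau> (int n + 2)))) * c n" for n
    proof -
      have 1: "1 / (w (int (Suc n)) * p (int (Suc n))) = (y (int n + 1) / x (int n + 1) * (\<tau> (int n + 1) / s (int n + 2))) * (1 / (w (int n) * p (int n)))"
        unfolding qp[symmetric] wp_Suc by simp
      have HSS: "H (Suc (Suc n)) = (\<tau> (int n + 2) / s (int n + 2)) * (\<tau> (int n + 1) / s (int n + 1)) * H n"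
        using H_Suc[of "Suc n"] H_Suc[of n] by (simp add: add.commute)
      have 2: "1 / - (H (Suc n) * H (Suc (Suc n))) = ((s (int n + 1) / \<tau> (int n + 1)) * (s (int n + 2) / \<tau> (int n + 2))) * (1 / - (H n * H (Suc n)))"
        unfolding HSS by (simp add: mult_ac)
      show ?thesis unfolding c_def 1 2 by (simp only: mult_ac)
    qed
    have "LIM n sequentially. (\<Sum>k<n. c k) :> at_top"
      by (rule raabe_divergence(2)[OF c c_Suc ratio_exp_mult[OF ratio_exp_mult[OF ratio_U(2) ratio_L(4)] ratio_exp_mult[OF ratio_L(1) ratio_L(2)]]])
        (use \<alpha> in simp)
    moreover have "\<bar>\<Sum>k<n. 1 / (w (int k) * p (int k) * (H k * H (Suc k)))\<bar> = (\<Sum>k<n. c k)" for n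
    proof -
      have "(\<Sum>k<n. 1 / (w (int k) * p (int k) * (H k * H (Suc k)))) = - (\<Sum>k<n. c k)"
        by (simp add: c_def sum_negf[symmetric])
      moreover have "0 \<le> (\<Sum>k<n. c k)" using c by (intro sum_nonneg) (simp add: less_imp_le)
      ultimately show ?thesis by simp
    qed
    ultimately show "LIM n sequentially. \<bar>\<Sum>k<n. 1 / (w (int k) * p (int k) * (H k * H (Suc k)))\<bar> :> at_top" by simp
  qed (use H0 in auto)
qed

text \<open>
  The quotient of consecutive terms is \<open>(y\<^sub>n / x\<^sub>n) (s\<^sub>n / \<tau>\<^sub>n\<^sub>+\<^sub>1)\<close>, with exponent
  \<open>(\<alpha> - \<beta> - 1) + (\<alpha> + \<beta>) = 2 \<alpha> - 1 > - 1\<close>.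
\<close>

lemma kernel_U_not_summable:
  assumes "ul_chain \<mu> M V w p r q x y s \<tau>"
  shows "\<not> summable (\<lambda>n::nat. (\<Prod>k<n. y (int k) / x (int k))\<^sup>2 / ul_chain.h w y s (int n))"
proof -
  interpret ul_chain \<mu> M V w p r q x y s \<tau> by fact
  define b where "b n = (\<Prod>k<n. y (int k) / x (int k))\<^sup>2 / h (int n)" for n
  have b: "0 < b n" for n
    unfolding b_def using h_pos PU_coefs(1) PU_coefs(2) by (intro divide_pos_pos zero_less_power prod_pos) auto
  have b_Suc: "b (Suc n) = (y (int n) / x (int n) * (s (int n) / \<tau> (int n + 1))) * b n" for n
  proof -
    have nz: "w (int n) \<noteq> 0" "x (int n) \<noteq> 0" "y (int n) \<noteq> 0" "s (int n) \<noteq> 0" "\<tau> (int n + 1) \<noteq> 0"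
      using w_pos[of "int n"] PU_coefs(1)[of "int n"] PU_coefs(2)[of "int n"] PL_coefs(1)[of "int n"] PL_coefs(2)[of "int n + 1"] by auto
    have hh: "1 / h (int n + 1) = (s (int n) * x (int n)) / (y (int n) * \<tau> (int n + 1)) * (1 / h (int n))"
      unfolding h_Suc unfolding h_def using nz by simp
    have "b (Suc n) = ((\<Prod>k<n. y (int k) / x (int k)) * (y (int n) / x (int n)))\<^sup>2 * (1 / h (int n + 1))"
      by (simp add: b_def add.commute)
    also have "\<dots> = (y (int n) / x (int n))\<^sup>2 * ((s (int n) * x (int n)) / (y (int n) * \<tau> (int n + 1))) * b n"
      unfolding hh b_def power_mult_distrib by simp
    also have "(y (int n) / x (int n))\<^sup>2 * ((s (int n) * x (int n)) / (y (int n) * \<tau> (int n + 1))) = y (int n) / x (int n) * (s (int n) / \<tau> (int n + 1))"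
      using nz by (simp add: power2_eq_square)
    finally show ?thesis .
  qed
  show ?thesis
    unfolding b_def[symmetric]
    by (rule raabe_divergence(1)[OF b b_Suc ratio_exp_mult[OF ratio_U(1) ratio_L(5)]]) (use \<alpha> in simp)
qed

lemma spectral_matrix_P:
  assumes S: "spectral_matrix (mat_P \<alpha> \<beta> t) \<Psi>"
  shows "supported_on \<Psi> {0..1}" "A \<in> null_sets lborel \<Longrightarrow> \<Psi> A = 0"
proof -
  have pos: "0 < mat_P \<alpha> \<beta> t n (n + 1)" "0 < mat_P \<alpha> \<beta> t n (n - 1)" for n
    by (auto simp: mat_P_def pq_pos)
  obtain \<mu> M where m: "finite_measure \<mu>" "represents \<mu> M \<Psi>"
    "\<And>A. A \<in> sets borel \<Longrightarrow> emeasure \<mu> A = ennreal (\<Psi> A $ 1 $ 1 + \<Psi> A $ 2 $ 2)"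
    using matrix_measure_represents S unfolding spectral_matrix_def by metis
  interpret finite_measure \<mu> by fact
  have W: "weight \<mu> M"
    using S sigma_finite_measure_axioms by (intro weight_of_represents[OF m(2)]) (auto simp: spectral_matrix_def)
  obtain V where V: "ortho_chain \<mu> M V (pot (mat_P \<alpha> \<beta> t)) p r q"
    by (rule spectral_matrix_chain[OF m(2) W S pos, unfolded mat_P_coefs]) (rule that)
  interpret ul: ul_chain \<mu> M V "pot (mat_P \<alpha> \<beta> t)" p r q x y s \<tau> by (rule ul_chainI[OF V])
  interpret nv: nevai_chain \<mu> M V "pot (mat_P \<alpha> \<beta> t)" p r q by (rule nevai_chainI[OF V])
  have \<Psi>: "\<Psi> A = ul.mass A" if "A \<in> sets borel" for A
    using m(2) that by (simp add: represents_def ul.mass_def)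
  have out: "ul.mass A = 0" if "A \<inter> {0..1} = {}" for A
    unfolding ul.mass_def set_lebesgue_integral_def
  proof (rule integral_eq_zero_AE)
    show "AE x in \<mu>. indicator A x *\<^sub>R M x = 0"
      using ul.support_nonneg ul.supp
    proof eventually_elim
      case (elim x)
      show ?case
      proof (cases "x \<in> A")
        case True
        then have "x \<notin> {0..1}" using that by blast
        then have "M x = 0" using elim by (cases "x < 0") auto
        then show ?thesis by simp
      qed simp
    qed
  qed
  then show "supported_on \<Psi> {0..1}" by (simp add: supported_on_def \<Psi>)
  assume A: "A \<in> null_sets lborel"
  have "ul.mass A = 0"
  proof (rule nv.mass_null_set[OF m(1) _ _ _ _ A])
    show "emeasure \<mu> A = ennreal (nv.tr_mass A)" if "A \<in> sets borel" for A
      using m(3)[OF that] \<Psi>[OF that] by (simp add: nv.tr_mass_def)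
    show "ul.mass {0} = 0" "ul.mass {1} = 0" using atom_free_endpoints[OF V] by auto
    show "nv.tr_mass (- {0..1}) = 0" using out[of "- {0..1}"] by (simp add: nv.tr_mass_def)
  qed
  then show "\<Psi> A = 0" using A \<Psi> by auto
qed

end

lemma density_exists:
  assumes \<Psi>: "matrix_measure \<Psi>" "supported_on \<Psi> S" "S \<in> sets borel"
    and ac: "\<And>A. A \<in> null_sets lborel \<Longrightarrow> \<Psi> A = 0"
  shows "\<exists>W. has_density_on \<Psi> W S"
proof -
  obtain \<mu> M where m: "finite_measure \<mu>" "represents \<mu> M \<Psi>"
    "\<And>A. A \<in> sets borel \<Longrightarrow> emeasure \<mu> A = ennreal (\<Psi> A $ 1 $ 1 + \<Psi> A $ 2 $ 2)"
    using matrix_measure_represents[OF \<Psi>(1)] by metis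
  interpret finite_measure \<mu> by fact
  have s: "sets \<mu> = sets borel" and iM: "integrable \<mu> M" and R: "\<And>A. A \<in> sets borel \<Longrightarrow> \<Psi> A = (LINT x:A|\<mu>. M x)"
    using m(2) by (auto simp: represents_def)
  have acm: "absolutely_continuous lborel \<mu>"
    unfolding absolutely_continuous_def
  proof
    fix A assume A: "A \<in> null_sets (lborel :: real measure)"
    then have "A \<in> sets borel" by auto
    then show "A \<in> null_sets \<mu>" using ac[OF A] m(3)[of A] s by (auto simp: null_sets_def)
  qed
  have sl: "sets \<mu> = sets lborel" using s by simp
  obtain D where D: "D \<in> borel_measurable lborel" "AE x in lborel. RN_deriv lborel \<mu> x = ennreal (D x)" "\<And>x. 0 \<le> D x"
    by (rule sigma_finite_measure.real_RN_deriv[OF sigma_finite_lborel m(1) acm sl]) (rule that)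
  have "density lborel (\<lambda>x. ennreal (D x)) = density lborel (RN_deriv lborel \<mu>)"
    using D by (intro density_cong) auto
  also have "\<dots> = \<mu>" using acm s by (intro sigma_finite_measure.density_RN_deriv[OF sigma_finite_lborel]) auto
  finally have d: "\<mu> = density lborel (\<lambda>x. ennreal (D x))" ..
  have Mm: "M \<in> borel_measurable borel" using borel_measurable_integrable[OF iM] s measurable_cong_sets by blast
  have iW: "integrable lborel (\<lambda>x. D x *\<^sub>R M x)"
    using iM Mm D unfolding d by (subst (asm) integrable_density) auto
  have "has_density_on \<Psi> (\<lambda>x. D x *\<^sub>R M x) S"
    unfolding has_density_on_def
  proof
    show "set_integrable lborel S (\<lambda>x. D x *\<^sub>R M x)"
      unfolding set_integrable_def using iW \<Psi>(3) by (intro integrable_mult_indicator) auto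
    show "\<forall>A\<in>sets borel. \<Psi> A = (LINT x:A \<inter> S|lborel. D x *\<^sub>R M x)"
    proof
      fix A assume A: "A \<in> sets (borel :: real measure)"
      have AS: "A \<inter> S \<in> sets borel" using A \<Psi>(3) by auto
      have "\<Psi> A = (LINT x:A|\<mu>. M x)" by (rule R[OF A])
      also have "\<dots> = (LINT x:A \<inter> S|\<mu>. M x)"
        unfolding set_lebesgue_integral_def
      proof (rule integral_cong_AE)
        show "(\<lambda>x. indicator A x *\<^sub>R M x) \<in> borel_measurable \<mu>" "(\<lambda>x. indicator (A \<inter> S) x *\<^sub>R M x) \<in> borel_measurable \<mu>"
          using A AS iM s by (auto intro!: borel_measurable_scaleR borel_measurable_indicator)
        show "AE x in \<mu>. indicator A x *\<^sub>R M x = indicator (A \<inter> S) x *\<^sub>R M x"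
          by (rule eventually_mono[OF represents_support[OF m(2) sigma_finite_measure_axioms \<Psi>(2,3)]])
            (auto simp: indicator_def)
      qed
      also have "\<dots> = (LINT x:A \<inter> S|lborel. D x *\<^sub>R M x)"
        unfolding set_lebesgue_integral_def d
        by (subst integral_density) (use AS Mm D in \<open>auto simp: mult.commute\<close>)
      finally show "\<Psi> A = (LINT x:A \<inter> S|lborel. D x *\<^sub>R M x)" .
    qed
  qed
  then show ?thesis by blast
qed

lemma has_density_on_represents:
  assumes "matrix_measure \<Psi>" "has_density_on \<Psi> W S" "S \<in> sets borel"
  shows "represents lborel (\<lambda>x. indicator S x *\<^sub>R W x) \<Psi>"
proof (rule representsI)
  show "sigma_finite_measure (lborel :: real measure)" by (rule sigma_finite_lborel)
  show "integrable lborel (\<lambda>x. indicator S x *\<^sub>R W x)"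
    using assms(2) by (simp add: has_density_on_def set_integrable_def)
  fix A assume "A \<in> sets (borel :: real measure)"
  then have "\<Psi> A = (LINT x:A \<inter> S|lborel. W x)" using assms(2) by (simp add: has_density_on_def)
  also have "\<dots> = (LINT x:A|lborel. indicator S x *\<^sub>R W x)"
    unfolding set_lebesgue_integral_def
    by (intro Bochner_Integration.integral_cong) (auto simp: indicator_def)
  finally show "\<Psi> A = (LINT x:A|lborel. indicator S x *\<^sub>R W x)" .
qed (use assms in auto)

context ul_coefficients
begin

text \<open>
  The transform is built from an arbitrary density \<open>W\<close> of \<open>\<Psi>\<close>, so that uniqueness of the spectral matrix of
  \<open>mat_Ptilde\<close> later gives the formula for all densities at once.
\<close>

lemma darboux_transform:
  assumes S: "spectral_matrix (mat_P \<alpha> \<beta> t) \<Psi>" and W: "has_density_on \<Psi> W {0..1}"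
  obtains \<Psi>t where "spectral_matrix (mat_Ptilde \<alpha> \<beta> t) \<Psi>t" "abs_continuous \<Psi>t" "supported_on \<Psi>t {0..1}"
    "has_density_on \<Psi>t (\<lambda>x. (y 0 / s 0) *\<^sub>R (S0 \<alpha> \<beta> t x ** ((1 / x) *\<^sub>R W x) ** transpose (S0 \<alpha> \<beta> t x))) {0..1}"
proof -
  let ?P = "mat_P \<alpha> \<beta> t" and ?Pt = "mat_Ptilde \<alpha> \<beta> t"
  define M where "M x = indicator {0..1} x *\<^sub>R W x" for x :: real
  have pos: "0 < ?P n (n + 1)" "0 < ?P n (n - 1)" for n
    by (auto simp: mat_P_def pq_pos)
  have mm: "matrix_measure \<Psi>" "supported_on \<Psi> {-1..1}" using S by (auto simp: spectral_matrix_def)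
  have R: "represents lborel M \<Psi>"
    unfolding M_def by (rule has_density_on_represents[OF mm(1) W]) simp
  have We: "weight lborel M" by (rule weight_of_represents[OF R sigma_finite_lborel mm(2)])
  obtain V where V: "ortho_chain lborel M V (pot ?P) p r q"
    by (rule spectral_matrix_chain[OF R We S pos, unfolded mat_P_coefs]) (rule that)
  have "AE x in lborel. x \<le> 0 \<longrightarrow> M x = 0"
    using AE_lborel_singleton[of 0] by eventually_elim (auto simp: M_def)
  then have "positive_ul_chain lborel M V (pot ?P) p r q x y s \<tau>"
    by (intro positive_ul_chain.intro positive_ul_chain_axioms.intro ul_chainI[OF V])
  then interpret pc: positive_ul_chain lborel M V "pot ?P" p r q x y s \<tau> .
  have tpos: "0 < ?Pt n (n + 1)" "0 < ?Pt n (n - 1)" for n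
    by (auto simp: mat_Ptilde_entries PU_coefs PL_coefs)
  have tnz: "?Pt n (n + 1) \<noteq> 0" "?Pt n (n - 1) \<noteq> 0" for n using tpos[of n] by auto
  obtain Q where Q: "Q_system ?Pt Q" by (rule Q_system_exists[of ?Pt, OF tnz]) (rule that)
  have ch: "ortho_chain lborel pc.M_tilde (vec_Q Q) (\<lambda>n. pc.h 0 / pc.h n) (\<lambda>n. s n * x n) (\<lambda>n. s n * y n + \<tau> n * x (n - 1)) (\<lambda>n. \<tau> n * y (n - 1))"
    using vec_Q_rec[OF Q] unfolding mat_Ptilde_entries
    by (intro pc.darboux_chain[OF kernel_U_not_summable[OF pc.ul_chain_axioms]] cont_vec_Q)
  interpret t: ortho_chain lborel pc.M_tilde "vec_Q Q" "\<lambda>n. pc.h 0 / pc.h n" "\<lambda>n. s n * x n" "\<lambda>n. s n * y n + \<tau> n * x (n - 1)" "\<lambda>n. \<tau> n * y (n - 1)"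
    by (rule ch)
  have pot: "pc.h 0 / pc.h n = pot ?Pt n" for n
  proof (rule pot_unique[of ?Pt, OF tpos])
    show "pc.h 0 / pc.h 0 = 1" by (rule t.w_0)
    show "pc.h 0 / pc.h (n + 1) * ?Pt (n + 1) n = pc.h 0 / pc.h n * ?Pt n (n + 1)" for n
      using t.w_Suc[of n] mat_Ptilde_entries(1)[of n] mat_Ptilde_entries(3)[of "n + 1"] by simp
  qed
  define \<Psi>t where "\<Psi>t A = (if A \<in> sets borel then LINT x:A|lborel. pc.M_tilde x else 0)" for A
  have Rt: "represents lborel pc.M_tilde \<Psi>t"
    unfolding represents_def \<Psi>t_def using t.sets_\<mu> t.integrable_M t.psd by auto
  have Mt0: "pc.M_tilde x = 0" if "x \<notin> {0..1}" for x
    using that by (simp add: pc.M_tilde_def M_def)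
  have supp: "supported_on \<Psi>t S" if "{0..1} \<subseteq> S" for S
    unfolding supported_on_def
  proof (intro ballI impI)
    fix A assume A: "A \<in> sets (borel :: real measure)" "A \<inter> S = {}"
    have "(\<lambda>x. indicator A x *\<^sub>R pc.M_tilde x) = (\<lambda>x. 0)"
    proof
      fix x
      show "indicator A x *\<^sub>R pc.M_tilde x = 0"
      proof (cases "x \<in> A")
        case True
        then have "x \<notin> {0..1}" using A(2) that by blast
        then have "pc.M_tilde x = 0" by (rule Mt0)
        then show ?thesis by (simp only: scaleR_zero_right)
      qed simp
    qed
    then show "\<Psi>t A = 0" by (simp add: \<Psi>t_def set_lebesgue_integral_def)
  qed
  show thesis
  proof (rule that)
    show "spectral_matrix ?Pt \<Psi>t"
      unfolding spectral_matrix_def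
    proof (intro conjI exI[of _ Q] Q allI)
      show "matrix_measure \<Psi>t" by (rule represents_matrix_measure[OF Rt])
      show "supported_on \<Psi>t {-1..1}" by (rule supp) auto
      show "(\<Sum>\<eta>\<in>UNIV. \<Sum>\<zeta>\<in>UNIV. entry_integral \<Psi>t \<eta> \<zeta> (\<lambda>x. poly (Q \<eta> i) x * poly (Q \<zeta> j) x))
          = (if i = j then 1 / pot ?Pt j else 0)" for i j
        unfolding sum_entry_integral_eq[OF Rt pc.weight_M_tilde] t.orth pot ..
    qed
    show "abs_continuous \<Psi>t"
      unfolding abs_continuous_def
    proof
      fix A assume A: "A \<in> null_sets (lborel :: real measure)"
      have "AE x in lborel. indicator A x *\<^sub>R pc.M_tilde x = 0"
        using AE_not_in[OF A] by eventually_elim simp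
      then have "(LINT x:A|lborel. pc.M_tilde x) = 0"
        unfolding set_lebesgue_integral_def by (rule integral_eq_zero_AE)
      then show "\<Psi>t A = 0" by (simp add: \<Psi>t_def)
    qed
    show "supported_on \<Psi>t {0..1}" by (rule supp) simp
    let ?F = "\<lambda>x. (y 0 / s 0) *\<^sub>R (S0 \<alpha> \<beta> t x ** ((1 / x) *\<^sub>R W x) ** transpose (S0 \<alpha> \<beta> t x))"
    have F: "indicator {0..1} x *\<^sub>R ?F x = pc.M_tilde x" for x
    proof (cases "x \<in> {0..1}")
      case True
      then show ?thesis by (simp add: pc.M_tilde_def M_def pc.S_poly_def S0_def)
    qed (use Mt0 in simp)
    show "has_density_on \<Psi>t ?F {0..1}"
      unfolding has_density_on_def
    proof
      show "set_integrable lborel {0..1} ?F"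
        unfolding set_integrable_def F by (rule t.integrable_M)
      show "\<forall>A\<in>sets borel. \<Psi>t A = (LINT x:A \<inter> {0..1}|lborel. ?F x)"
      proof
        fix A assume A: "A \<in> sets (borel :: real measure)"
        have "indicator (A \<inter> {0..1}) x *\<^sub>R ?F x = indicator A x *\<^sub>R pc.M_tilde x" for x
          unfolding F[symmetric] indicator_inter_arith by simp
        then show "\<Psi>t A = (LINT x:A \<inter> {0..1}|lborel. ?F x)"
          using A unfolding \<Psi>t_def set_lebesgue_integral_def by (simp only: if_True)
      qed
    qed
  qed
qed

end

theorem mainTheorem4:
  fixes \<alpha> \<beta> t :: real and \<Psi> :: "real set \<Rightarrow> real^2^2"
  assumes "admissible \<alpha> \<beta> t"
    and "spectral_matrix (mat_P \<alpha> \<beta> t) \<Psi>"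
  shows "stochastic (mat_Ptilde \<alpha> \<beta> t) \<and> tridiagonal (mat_Ptilde \<alpha> \<beta> t) \<and>
    (\<forall>n. mat_Ptilde \<alpha> \<beta> t n (n + 1) = coef_p (\<alpha> - 1) \<beta> t n \<and>
         mat_Ptilde \<alpha> \<beta> t n n = coef_r (\<alpha> - 1) \<beta> t n \<and>
         mat_Ptilde \<alpha> \<beta> t n (n - 1) = coef_q (\<alpha> - 1) \<beta> t n) \<and>
    (\<exists>W. has_density_on \<Psi> W {0..1}) \<and>
    (\<exists>!\<Psi>t. spectral_matrix (mat_Ptilde \<alpha> \<beta> t) \<Psi>t) \<and>
    (\<forall>\<Psi>t. spectral_matrix (mat_Ptilde \<alpha> \<beta> t) \<Psi>t \<longrightarrow>
       abs_continuous \<Psi>t \<and> supported_on \<Psi>t {0..1} \<and>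
       spectral_matrix (mat_P (\<alpha> - 1) \<beta> t) \<Psi>t \<and>
       (\<forall>W. has_density_on \<Psi> W {0..1} \<longrightarrow>
          has_density_on \<Psi>t
            (\<lambda>x. (coef_y \<alpha> \<beta> t 0 / coef_s \<alpha> \<beta> t 0) *\<^sub>R
               (S0 \<alpha> \<beta> t x ** ((1 / x) *\<^sub>R W x) ** transpose (S0 \<alpha> \<beta> t x)))
            {0..1}))"
proof -
  interpret ul_coefficients \<alpha> \<beta> t by (rule admissible_ul_coefficients[OF assms(1)])
  let ?Pt = "mat_Ptilde \<alpha> \<beta> t"
  have coefs: "?Pt n (n + 1) = coef_p (\<alpha> - 1) \<beta> t n" "?Pt n n = coef_r (\<alpha> - 1) \<beta> t n" "?Pt n (n - 1) = coef_q (\<alpha> - 1) \<beta> t n" for n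
    unfolding mat_Ptilde_eq by (auto simp: mat_P_def)
  have tpos: "0 < ?Pt n (n + 1)" "0 < ?Pt n (n - 1)" for n
    by (auto simp: mat_Ptilde_entries PU_coefs PL_coefs)
  have unique: "\<Psi>1 = \<Psi>2" if "spectral_matrix ?Pt \<Psi>1" "spectral_matrix ?Pt \<Psi>2" for \<Psi>1 \<Psi>2
    by (rule spectral_matrix_unique[OF that tpos])
  have W: "\<exists>W. has_density_on \<Psi> W {0..1}"
    using assms(2) spectral_matrix_P[OF assms(2)]
    by (intro density_exists) (auto simp: spectral_matrix_def)
  then obtain W0 where W0: "has_density_on \<Psi> W0 {0..1}" ..
  obtain \<Psi>0 where \<Psi>0: "spectral_matrix ?Pt \<Psi>0" "abs_continuous \<Psi>0" "supported_on \<Psi>0 {0..1}"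
    by (rule darboux_transform[OF assms(2) W0]) (rule that)
  have "has_density_on \<Psi>t (\<lambda>x. (y 0 / s 0) *\<^sub>R (S0 \<alpha> \<beta> t x ** ((1 / x) *\<^sub>R W x) ** transpose (S0 \<alpha> \<beta> t x))) {0..1}"
    if \<Psi>t: "spectral_matrix ?Pt \<Psi>t" and W: "has_density_on \<Psi> W {0..1}" for \<Psi>t W
  proof -
    obtain \<Psi>1 where 1: "spectral_matrix ?Pt \<Psi>1"
      "has_density_on \<Psi>1 (\<lambda>x. (y 0 / s 0) *\<^sub>R (S0 \<alpha> \<beta> t x ** ((1 / x) *\<^sub>R W x) ** transpose (S0 \<alpha> \<beta> t x))) {0..1}"
      by (rule darboux_transform[OF assms(2) W]) (rule that)
    have "\<Psi>t = \<Psi>1" by (rule unique[OF \<Psi>t 1(1)])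
    then show ?thesis using 1(2) by simp
  qed
  moreover have "\<exists>!\<Psi>t. spectral_matrix ?Pt \<Psi>t" using \<Psi>0(1) unique by blast
  moreover have "abs_continuous \<Psi>t \<and> supported_on \<Psi>t {0..1} \<and> spectral_matrix (mat_P (\<alpha> - 1) \<beta> t) \<Psi>t"
    if "spectral_matrix ?Pt \<Psi>t" for \<Psi>t
    using unique[OF that \<Psi>0(1)] \<Psi>0 that mat_Ptilde_eq by simp
  ultimately show ?thesis
    by (intro conjI allI impI stochastic_mat_Ptilde tridiagonal_mat_Ptilde coefs W) auto
qed

end
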